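(* Let $(\mathcal{F}(\Omega),\tau)$ be a bornological BC-space of $\mathbb{K}$-valued functions on a non-empty set $\Omega$, and let $\widetilde{\tau}$ be a locally convex Hausdorff topology on $\mathcal{F}(\Omega)$ with $\tau_{\mathrm{p}}\leq\widetilde{\tau}$ such that $(\mathcal{F}(\Omega),\tau)$ satisfies both (BBC) and (CNC) for $\widetilde{\tau}$, i.e. every $\tau$-bounded subset is contained in an absolutely convex $\tau$-bounded $\widetilde{\tau}$-compact set, and $\tau$ has a $0$-neighbourhood basis of absolutely convex $\widetilde{\tau}$-closed sets. Let $\mathcal{C}$ be a subclass of the class of complete barrelled locally convex Hausdorff spaces such that $\mathcal{C}$ is closed under topological isomorphisms and $\mathcal{F}(\Omega)_{\mathcal{B},\widetilde{\tau}}'\in\mathcal{C}$, where $\mathcal{B}$ is the family of $\tau$-bounded sets. Then the following assertions are equivalent. (a) $(\mathcal{F}(\Omega),\tau)$ has a unique $\mathcal{C}$ predual. (b) For every predual $(Z,\varphi)$ of $(\mathcal{F}(\Omega),\tau)$ such that $Z\in\mathcal{C}$ there is a topological isomorphism $\psi\colon(\mathcal{F}(\Omega),\tau)\to Z_{b}'$ such that for every $x\in\Omega$ there is a (unique) $z_{x}\in Z$ with $\delta_{x}=\psi(\cdot)(z_{x})$.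
   Context: $\mathbb{K}=\mathbb{R}$ or $\mathbb{C}$. $Y_{b}'$ is the topological dual $Y'$ with the topology of uniform convergence on bounded subsets of $Y$; a topological isomorphism is a linear homeomorphism. $\tau_{\mathrm{p}}$ is the topology of pointwise convergence; $\tau_{0}\leq\tau_{1}$ means $\tau_{0}$ is coarser than $\tau_{1}$. A locally convex Hausdorff space of functions on $\Omega$ is a linear subspace of $\mathbb{K}^{\Omega}$ with some locally convex Hausdorff topology. For $x\in\Omega$, $\delta_{x}\colon\mathcal{F}(\Omega)\to\mathbb{K}$, $\delta_{x}(f):=f(x)$; and $\psi(\cdot)(z)$ denotes the functional $f\mapsto\psi(f)(z)$. A locally convex Hausdorff space $X$ is a BC-space if for every Banach space $W$ every linear map $W\to X$ with closed graph in $W\times X$ is continuous. $\mathcal{F}(\Omega)_{\mathcal{B},\widetilde{\tau}}'$ is the space of all linear functionals $x^{\star}$ on $\mathcal{F}(\Omega)$ such that $x^{\star}|_{B}$ is $\widetilde{\tau}$-continuous for all $B\in\mathcal{B}$, equipped with the topology $\beta$ of uniform convergence on $\tau$-bounded sets. A predual of a locally convex Hausdorff space $X$ is a tuple $(Y,\varphi)$ of a locally convex Hausdorff space $Y$ and a topological isomorphism $\varphi\colon X\to Y_{b}'$. A class $\mathcal{C}$ is closed under topological isomorphisms if every locally convex Hausdorff space topologically isomorphic to a member of $\mathcal{C}$ belongs to $\mathcal{C}$. $X$ has a unique $\mathcal{C}$ predual if for all preduals $(Y,\varphi)$, $(Z,\psi)$ of $X$ with $Y,Z\in\mathcal{C}$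 there is a topological isomorphism $\lambda\colon Y\to Z$. The word "(unique)" in parentheses indicates that existence of $z_{x}$ is required and that it is then automatically uniquely determined (for the given $\psi$). *)

theory Defs
  imports "HOL-Analysis.Analysis" "HOL-Algebra.Module"
begin

section \<open>Scalars\<close>

text \<open>
  The scalar field is \<open>\<real>\<close> or \<open>\<complex>\<close>. In the second alternative below \<open>i\<close> plays the role of the
  imaginary unit; then \<open>(a, b) \<mapsto> a + b i\<close> identifies \<open>\<complex>\<close> with its absolute value and the
  scalar field with its norm.
\<close>

class real_or_complex = real_normed_field +
  assumes real_or_complex:
    "(\<forall>z::'a. \<exists>a. z = a *\<^sub>R 1) \<or>
     (\<exists>i::'a. i * i = - 1 \<and> (\<forall>z. \<exists>a b. z = a *\<^sub>R 1 + b *\<^sub>R i) \<and>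
        (\<forall>a b. norm (a *\<^sub>R 1 + b *\<^sub>R i) = sqrt (a\<^sup>2 + b\<^sup>2)))"

instance real :: real_or_complex
  by standard simp

instance complex :: real_or_complex
proof
  have "z = Re z *\<^sub>R 1 + Im z *\<^sub>R \<i>" for z
    by (simp add: complex_eq_iff)
  moreover have "norm (a *\<^sub>R 1 + b *\<^sub>R \<i>) = sqrt (a\<^sup>2 + b\<^sup>2)" for a b
    by (simp add: cmod_def)
  ultimately show "(\<forall>z::complex. \<exists>a. z = a *\<^sub>R 1) \<or>
     (\<exists>i::complex. i * i = - 1 \<and> (\<forall>z. \<exists>a b. z = a *\<^sub>R 1 + b *\<^sub>R i) \<and>
        (\<forall>a b. norm (a *\<^sub>R 1 + b *\<^sub>R i) = sqrt (a\<^sup>2 + b\<^sup>2)))"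
    using i_squared by blast
qed

definition scalars :: "'k::real_or_complex ring" where
  "scalars = \<lparr>carrier = UNIV, monoid.mult = (*), one = 1, zero = 0, add = (+)\<rparr>"


section \<open>Locally convex Hausdorff spaces\<close>

text \<open>The fields \<^const>\<open>monoid.mult\<close> and \<^const>\<open>one\<close> inherited from rings play no role, as in
  \<^locale>\<open>module\<close>.\<close>

record ('k, 'v) top_module = "('k, 'v) module" +
  topol :: "'v topology"

definition zero_nbhd :: "('k, 'v) top_module \<Rightarrow> 'v set \<Rightarrow> bool" where
  "zero_nbhd X U \<longleftrightarrow> U \<subseteq> carrier X \<and> (\<exists>G. openin (topol X) G \<and> \<zero>\<^bsub>X\<^esub> \<in> G \<and> G \<subseteq> U)"

definition absolutely_convex :: "('k::real_or_complex, 'v) top_module \<Rightarrow> 'v set \<Rightarrow> bool" where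
  "absolutely_convex X A \<longleftrightarrow> A \<subseteq> carrier X \<and>
     (\<forall>x\<in>A. \<forall>y\<in>A. \<forall>a b. norm a + norm b \<le> 1 \<longrightarrow> a \<odot>\<^bsub>X\<^esub> x \<oplus>\<^bsub>X\<^esub> b \<odot>\<^bsub>X\<^esub> y \<in> A)"

locale lc_hausdorff = module scalars X for X :: "('k::real_or_complex, 'v) top_module" (structure) +
  assumes topspace_topol: "topspace (topol X) = carrier X"
    and continuous_add:
      "continuous_map (prod_topology (topol X) (topol X)) (topol X) (\<lambda>(x, y). x \<oplus> y)"
    and continuous_smult:
      "continuous_map (prod_topology euclidean (topol X)) (topol X) (\<lambda>(c, x). c \<odot> x)"
    and Hausdorff: "Hausdorff_space (topol X)"
    and locally_convex:
      "zero_nbhd X U \<Longrightarrow> \<exists>W. zero_nbhd X W \<and> absolutely_convex X W \<and> W \<subseteq> U"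

definition absorbs :: "('k::real_or_complex, 'v) top_module \<Rightarrow> 'v set \<Rightarrow> 'v set \<Rightarrow> bool" where
  "absorbs X U A \<longleftrightarrow> (\<exists>r>0. \<forall>c. r \<le> norm c \<longrightarrow> A \<subseteq> (\<lambda>x. c \<odot>\<^bsub>X\<^esub> x) ` U)"

definition bounded_in :: "('k::real_or_complex, 'v) top_module \<Rightarrow> 'v set \<Rightarrow> bool" where
  "bounded_in X B \<longleftrightarrow> B \<subseteq> carrier X \<and> (\<forall>U. zero_nbhd X U \<longrightarrow> absorbs X U B)"

definition barrel :: "('k::real_or_complex, 'v) top_module \<Rightarrow> 'v set \<Rightarrow> bool" where
  "barrel X U \<longleftrightarrow> absolutely_convex X U \<and> closedin (topol X) U \<and>
     (\<forall>x\<in>carrier X. absorbs X U {x})"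

definition barrelled :: "('k::real_or_complex, 'v) top_module \<Rightarrow> bool" where
  "barrelled X \<longleftrightarrow> (\<forall>U. barrel X U \<longrightarrow> zero_nbhd X U)"

definition bornological :: "('k::real_or_complex, 'v) top_module \<Rightarrow> bool" where
  "bornological X \<longleftrightarrow>
     (\<forall>U. absolutely_convex X U \<and> (\<forall>B. bounded_in X B \<longrightarrow> absorbs X U B) \<longrightarrow> zero_nbhd X U)"

definition cauchy_filter_in :: "('k, 'v) top_module \<Rightarrow> 'v filter \<Rightarrow> bool" where
  "cauchy_filter_in X F \<longleftrightarrow> F \<noteq> bot \<and>
     (\<forall>U. zero_nbhd X U \<longrightarrow>
        (\<exists>A\<subseteq>carrier X. (\<forall>\<^sub>F x in F. x \<in> A) \<and> (\<forall>x\<in>A. \<forall>y\<in>A. x \<ominus>\<^bsub>X\<^esub> y \<in> U)))"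

definition complete_in :: "('k, 'v) top_module \<Rightarrow> bool" where
  "complete_in X \<longleftrightarrow> (\<forall>F. cauchy_filter_in X F \<longrightarrow> (\<exists>x\<in>carrier X. F \<le> nhdsin (topol X) x))"


section \<open>Linear maps and topological isomorphisms\<close>

definition linear_map ::
    "('k, 'v) top_module \<Rightarrow> ('k, 'w) top_module \<Rightarrow> ('v \<Rightarrow> 'w) \<Rightarrow> bool" where
  "linear_map X Y f \<longleftrightarrow> f \<in> carrier X \<rightarrow> carrier Y \<and>
     (\<forall>x\<in>carrier X. \<forall>y\<in>carrier X. f (x \<oplus>\<^bsub>X\<^esub> y) = f x \<oplus>\<^bsub>Y\<^esub> f y) \<and>
     (\<forall>c. \<forall>x\<in>carrier X. f (c \<odot>\<^bsub>X\<^esub> x) = c \<odot>\<^bsub>Y\<^esub> f x)"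

definition topological_isomorphism ::
    "('k, 'v) top_module \<Rightarrow> ('k, 'w) top_module \<Rightarrow> ('v \<Rightarrow> 'w) \<Rightarrow> bool" where
  "topological_isomorphism X Y f \<longleftrightarrow> linear_map X Y f \<and> homeomorphic_map (topol X) (topol Y) f"

text \<open>
  A class of spaces is represented by a set of spaces whose carriers lie in a common type \<open>'v\<close>.
  Since such classes are only considered when closed under topological isomorphisms, a space \<open>X\<close>
  over any other type counts as a member if it is topologically isomorphic to some element of the
  set. If \<open>X\<close> itself lives over \<open>'v\<close>, this is the same as \<open>X \<in> C\<close>.
\<close>

definition iso_closed :: "('k::real_or_complex, 'v) top_module set \<Rightarrow> bool" where
  "iso_closed C \<longleftrightarrow>
     (\<forall>Y\<in>C. \<forall>Z f. lc_hausdorff Z \<and> topological_isomorphism Z Y f \<longrightarrow> Z \<in> C)"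

definition iso_member ::
    "('k, 'w) top_module \<Rightarrow> ('k, 'v) top_module set \<Rightarrow> bool" where
  "iso_member X C \<longleftrightarrow> (\<exists>Y\<in>C. \<exists>f. topological_isomorphism X Y f)"

lemma iso_member_iff_mem:
  fixes C :: "('k::real_or_complex, 'v) top_module set"
  assumes "iso_closed C" "lc_hausdorff X"
  shows "iso_member X C \<longleftrightarrow> X \<in> C"
proof
  show "X \<in> C" if "iso_member X C"
    using assms that unfolding iso_member_def iso_closed_def by blast
  show "iso_member X C" if "X \<in> C"
  proof -
    have "topological_isomorphism X X id"
      by (auto simp: topological_isomorphism_def linear_map_def)
    with that show ?thesis unfolding iso_member_def by blast
  qed
qed


section \<open>Banach spaces and BC-spaces\<close>

definition vector_norm :: "('k::real_or_complex, 'v) top_module \<Rightarrow> ('v \<Rightarrow> real) \<Rightarrow> bool" where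
  "vector_norm W n \<longleftrightarrow>
     (\<forall>x\<in>carrier W. 0 \<le> n x \<and> (n x = 0 \<longleftrightarrow> x = \<zero>\<^bsub>W\<^esub>)) \<and>
     (\<forall>x\<in>carrier W. \<forall>y\<in>carrier W. n (x \<oplus>\<^bsub>W\<^esub> y) \<le> n x + n y) \<and>
     (\<forall>c. \<forall>x\<in>carrier W. n (c \<odot>\<^bsub>W\<^esub> x) = norm c * n x)"

text \<open>\<^locale>\<open>Metric_space\<close> asks for nonnegativity and symmetry also outside the carrier, so the
  distance is set to \<open>0\<close> there.\<close>

definition norm_dist :: "('k, 'v) top_module \<Rightarrow> ('v \<Rightarrow> real) \<Rightarrow> 'v \<Rightarrow> 'v \<Rightarrow> real" where
  "norm_dist W n x y = (if x \<in> carrier W \<and> y \<in> carrier W then n (x \<ominus>\<^bsub>W\<^esub> y) else 0)"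

definition banach_space :: "('k::real_or_complex, 'v) top_module \<Rightarrow> bool" where
  "banach_space W \<longleftrightarrow> module scalars W \<and>
     (\<exists>n. vector_norm W n \<and>
        topol W = Metric_space.mtopology (carrier W) (norm_dist W n) \<and>
        Metric_space.mcomplete (carrier W) (norm_dist W n))"

definition closed_graph ::
    "('k, 'w) top_module \<Rightarrow> ('k, 'v) top_module \<Rightarrow> ('w \<Rightarrow> 'v) \<Rightarrow> bool" where
  "closed_graph W X f \<longleftrightarrow>
     closedin (prod_topology (topol W) (topol X)) {(w, f w) |w. w \<in> carrier W}"

text \<open>
  The Banach spaces \<open>W\<close> range over those with carrier in the type of \<open>X\<close>. This is no restriction:
  see \<open>bc_space_closed_graph\<close> below, which covers Banach spaces over arbitrary types.
\<close>

definition bc_space :: "('k::real_or_complex, 'v) top_module \<Rightarrow> bool" where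
  "bc_space X \<longleftrightarrow> lc_hausdorff X \<and>
     (\<forall>(W::('k, 'v) top_module) f.
        banach_space W \<and> linear_map W X f \<and> closed_graph W X f \<longrightarrow>
        continuous_map (topol W) (topol X) f)"


lemma (in module) minus_conv_smult:
  assumes "x \<in> carrier M" "y \<in> carrier M"
  shows "x \<ominus>\<^bsub>M\<^esub> y = x \<oplus>\<^bsub>M\<^esub> (\<ominus> \<one>) \<odot>\<^bsub>M\<^esub> y"
  using assms by (simp add: a_minus_def smult_l_minus)

lemma scalars_simps [simp]:
  "carrier scalars = UNIV" "\<one>\<^bsub>scalars\<^esub> = 1" "\<zero>\<^bsub>scalars\<^esub> = 0"
  "a \<oplus>\<^bsub>scalars\<^esub> b = a + b" "a \<otimes>\<^bsub>scalars\<^esub> b = a * b"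
  by (simp_all add: scalars_def)

lemma cring_scalars: "cring (scalars :: 'k::real_or_complex ring)"
proof (rule cringI)
  show "abelian_group (scalars :: 'k ring)"
    by (rule abelian_groupI) (auto simp: algebra_simps intro: exI[of _ "- _"] add.left_inverse)
  show "comm_monoid (scalars :: 'k ring)"
    by (rule comm_monoidI) (auto simp: algebra_simps)
qed (auto simp: algebra_simps)

lemma scalars_uminus [simp]: "\<ominus>\<^bsub>scalars\<^esub> a = - (a::'k::real_or_complex)"
proof -
  interpret S: cring "scalars :: 'k ring" by (rule cring_scalars)
  show ?thesis
    using S.minus_equality[of "- a" a] by simp
qed

lemma Metric_space_norm_dist:
  fixes W :: "('k::real_or_complex, 'v) top_module"
  assumes "module scalars W" and n: "vector_norm W n"
  shows "Metric_space (carrier W) (norm_dist W n)"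
proof -
  interpret module scalars W by fact
  have nonneg: "0 \<le> n x" if "x \<in> carrier W" for x
    using n that by (auto simp: vector_norm_def)
  have neg: "n (\<ominus>\<^bsub>W\<^esub> x) = n x" if x: "x \<in> carrier W" for x
  proof -
    have "\<ominus>\<^bsub>W\<^esub> x = (- 1) \<odot>\<^bsub>W\<^esub> x"
      using smult_l_minus[of 1 x] smult_one[of x] x by simp
    then show ?thesis using n x by (simp add: vector_norm_def)
  qed
  show ?thesis
  proof
    fix x y z
    show "0 \<le> norm_dist W n x y"
      by (simp add: norm_dist_def nonneg)
    show "norm_dist W n x y = norm_dist W n y x"
    proof (cases "x \<in> carrier W \<and> y \<in> carrier W")
      case True
      then have "y \<ominus>\<^bsub>W\<^esub> x = \<ominus>\<^bsub>W\<^esub> (x \<ominus>\<^bsub>W\<^esub> y)"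
        by (simp add: a_minus_def M.minus_add M.a_comm)
      then show ?thesis using True neg by (simp add: norm_dist_def)
    qed (auto simp: norm_dist_def)
    assume x: "x \<in> carrier W" and y: "y \<in> carrier W"
    have "n (x \<ominus>\<^bsub>W\<^esub> y) = 0 \<longleftrightarrow> x \<ominus>\<^bsub>W\<^esub> y = \<zero>\<^bsub>W\<^esub>"
      using n x y by (simp add: vector_norm_def)
    also have "\<dots> \<longleftrightarrow> x = y"
    proof
      assume "x \<ominus>\<^bsub>W\<^esub> y = \<zero>\<^bsub>W\<^esub>"
      then have "\<ominus>\<^bsub>W\<^esub> (\<ominus>\<^bsub>W\<^esub> y) = x"
        using M.minus_equality[of x "\<ominus>\<^bsub>W\<^esub> y"] x y by (simp add: a_minus_def)
      then show "x = y" using y by simp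
    qed (use y in \<open>simp add: a_minus_def M.r_neg\<close>)
    finally show "norm_dist W n x y = 0 \<longleftrightarrow> x = y"
      using x y by (simp add: norm_dist_def)
    assume z: "z \<in> carrier W"
    have "x \<ominus>\<^bsub>W\<^esub> z = (x \<ominus>\<^bsub>W\<^esub> y) \<oplus>\<^bsub>W\<^esub> (y \<ominus>\<^bsub>W\<^esub> z)"
    proof -
      have "(x \<ominus>\<^bsub>W\<^esub> y) \<oplus>\<^bsub>W\<^esub> (y \<ominus>\<^bsub>W\<^esub> z) = x \<oplus>\<^bsub>W\<^esub> (\<ominus>\<^bsub>W\<^esub> y \<oplus>\<^bsub>W\<^esub> (y \<oplus>\<^bsub>W\<^esub> \<ominus>\<^bsub>W\<^esub> z))"
        using x y z by (simp add: a_minus_def M.a_assoc)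
      also have "\<dots> = x \<ominus>\<^bsub>W\<^esub> z"
        using x y z by (simp add: a_minus_def M.r_neg1)
      finally show ?thesis by simp
    qed
    then show "norm_dist W n x z \<le> norm_dist W n x y + norm_dist W n y z"
      using n x y z by (simp add: vector_norm_def norm_dist_def)
  qed
qed

lemma bc_space_closed_graph:
  fixes X :: "('k::real_or_complex, 'v) top_module" and W :: "('k, 'w) top_module"
  assumes X: "bc_space X" and W: "banach_space W"
    and f: "linear_map W X f" and graph: "closed_graph W X f"
  shows "continuous_map (topol W) (topol X) f"
proof -
  interpret X: lc_hausdorff X using X by (simp add: bc_space_def)
  interpret W: module scalars W using W by (simp add: banach_space_def)
  obtain n where n: "vector_norm W n"
    and topW: "topol W = Metric_space.mtopology (carrier W) (norm_dist W n)"
    and complW: "Metric_space.mcomplete (carrier W) (norm_dist W n)"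
    using W by (auto simp: banach_space_def)
  interpret MW: Metric_space "carrier W" "norm_dist W n"
    by (rule Metric_space_norm_dist) (use n in \<open>simp_all add: W.module_axioms\<close>, unfold_locales)
  have n_nonneg: "0 \<le> n w" if "w \<in> carrier W" for w
    using n that by (auto simp: vector_norm_def)
  have n_add: "n (w \<oplus>\<^bsub>W\<^esub> v) \<le> n w + n v" if "w \<in> carrier W" "v \<in> carrier W" for w v
    using n that by (auto simp: vector_norm_def)
  have n_smult: "n (c \<odot>\<^bsub>W\<^esub> w) = norm c * n w" if "w \<in> carrier W" for c w
    using n that by (auto simp: vector_norm_def)
  have n_zero: "n \<zero>\<^bsub>W\<^esub> = 0"
    using n by (auto simp: vector_norm_def)
  have f_in [simp]: "f w \<in> carrier X" if "w \<in> carrier W" for w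
    using f that by (auto simp: linear_map_def)
  have f_add: "f (w \<oplus>\<^bsub>W\<^esub> v) = f w \<oplus>\<^bsub>X\<^esub> f v" if "w \<in> carrier W" "v \<in> carrier W" for w v
    using f that by (auto simp: linear_map_def)
  have f_smult: "f (c \<odot>\<^bsub>W\<^esub> w) = c \<odot>\<^bsub>X\<^esub> f w" if "w \<in> carrier W" for c w
    using f that by (auto simp: linear_map_def)
  have f_zero: "f \<zero>\<^bsub>W\<^esub> = \<zero>\<^bsub>X\<^esub>"
    using f_smult[of "\<zero>\<^bsub>W\<^esub>" 0] W.smult_l_null[of "\<zero>\<^bsub>W\<^esub>"] X.smult_l_null[of "f \<zero>\<^bsub>W\<^esub>"] by simp
  have f_minus: "f (w \<ominus>\<^bsub>W\<^esub> v) = f w \<ominus>\<^bsub>X\<^esub> f v" if "w \<in> carrier W" "v \<in> carrier W" for w v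
    using that W.smult_closed[of "-1" v]
    by (simp add: W.minus_conv_smult X.minus_conv_smult f_add f_smult)
  have dist_add: "norm_dist W n w (w \<oplus>\<^bsub>W\<^esub> v) = n v" if "w \<in> carrier W" "v \<in> carrier W" for w v
  proof -
    have "norm_dist W n w (w \<oplus>\<^bsub>W\<^esub> v) = norm_dist W n (w \<oplus>\<^bsub>W\<^esub> v) w"
      by (rule MW.commute)
    also have "(w \<oplus>\<^bsub>W\<^esub> v) \<ominus>\<^bsub>W\<^esub> w = v"
      using that by (simp add: a_minus_def W.M.a_ac W.M.r_neg W.M.r_neg1 W.M.r_neg2)
    then have "norm_dist W n (w \<oplus>\<^bsub>W\<^esub> v) w = n v"
      using that by (simp add: norm_dist_def)
    finally show ?thesis .
  qed

  \<comment> \<open>A graph that is closed separates \<open>(w, x)\<close> from nearby points.\<close>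
  have sep: "\<exists>r>0. \<exists>B. openin (topol X) B \<and> x \<in> B \<and>
      (\<forall>v\<in>carrier W. n v < r \<longrightarrow> f (w \<oplus>\<^bsub>W\<^esub> v) \<notin> B)"
    if w: "w \<in> carrier W" and x: "x \<in> carrier X" and ne: "x \<noteq> f w" for w x
  proof -
    let ?G = "{(w, f w) |w. w \<in> carrier W}"
    let ?T = "topspace (prod_topology (topol W) (topol X))"
    have "openin (prod_topology (topol W) (topol X)) (?T - ?G)"
      using graph unfolding closed_graph_def closedin_def by blast
    moreover have "(w, x) \<in> ?T - ?G"
      using w x ne by (simp add: topW X.topspace_topol)
    ultimately obtain A B where A: "openin (topol W) A" "w \<in> A"
      and B: "openin (topol X) B" "x \<in> B" and AB: "A \<times> B \<subseteq> ?T - ?G"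
      unfolding openin_prod_topology_alt by meson
    obtain r where r: "r > 0" "MW.mball w r \<subseteq> A"
      using A unfolding topW MW.openin_mtopology by blast
    have "f (w \<oplus>\<^bsub>W\<^esub> v) \<notin> B" if v: "v \<in> carrier W" "n v < r" for v
    proof
      assume "f (w \<oplus>\<^bsub>W\<^esub> v) \<in> B"
      moreover have "w \<oplus>\<^bsub>W\<^esub> v \<in> A"
        using r(2) v w dist_add[OF w v(1)] by (auto simp: subset_iff)
      ultimately have "(w \<oplus>\<^bsub>W\<^esub> v, f (w \<oplus>\<^bsub>W\<^esub> v)) \<in> ?T - ?G" using AB by blast
      then show False using w v by auto
    qed
    then show ?thesis using r(1) B by blast
  qed

  define R where "R = f ` carrier W"
  define q where "q y = Inf (n ` {w \<in> carrier W. f w = y})" for y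
  have R_sub: "R \<subseteq> carrier X" by (auto simp: R_def)
  have bdd: "bdd_below (n ` {w \<in> carrier W. f w = y})" for y
    by (rule bdd_belowI[of _ 0]) (auto simp: n_nonneg)
  have q_le: "q (f w) \<le> n w" if "w \<in> carrier W" for w
    unfolding q_def by (rule cInf_lower[OF _ bdd]) (use that in auto)
  have q_nonneg: "0 \<le> q y" if "y \<in> R" for y
    unfolding q_def by (rule cInf_greatest) (use that in \<open>auto simp: R_def n_nonneg\<close>)
  have q_attain: "\<exists>w\<in>carrier W. f w = y \<and> n w < c" if "y \<in> R" "q y < c" for y c
  proof -
    have "n ` {w \<in> carrier W. f w = y} \<noteq> {}" using that by (auto simp: R_def)
    from cInf_lessD[OF this] that show ?thesis unfolding q_def by blast
  qed
  have R_zero: "\<zero>\<^bsub>X\<^esub> \<in> R"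
    unfolding R_def using f_zero by (metis W.M.zero_closed image_eqI)
  have R_add: "x \<oplus>\<^bsub>X\<^esub> y \<in> R" if "x \<in> R" "y \<in> R" for x y
    using that unfolding R_def by (auto simp flip: f_add)
  have R_smult: "c \<odot>\<^bsub>X\<^esub> x \<in> R" if "x \<in> R" for c x
    using that unfolding R_def by (auto simp flip: f_smult)
  have q_zero_imp: "y = \<zero>\<^bsub>X\<^esub>" if y: "y \<in> R" and "q y = 0" for y
  proof (rule ccontr)
    assume "y \<noteq> \<zero>\<^bsub>X\<^esub>"
    then have "y \<noteq> f \<zero>\<^bsub>W\<^esub>" by (simp add: f_zero)
    with sep[of "\<zero>\<^bsub>W\<^esub>" y] y R_sub obtain r B where "r > 0" and B: "y \<in> B"
      and *: "\<And>v. v \<in> carrier W \<Longrightarrow> n v < r \<Longrightarrow> f (\<zero>\<^bsub>W\<^esub> \<oplus>\<^bsub>W\<^esub> v) \<notin> B"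
      by (metis W.M.zero_closed subsetD)
    then obtain v where "v \<in> carrier W" "f v = y" "n v < r"
      using q_attain[OF y, of r] \<open>q y = 0\<close> by auto
    then show False using * B by fastforce
  qed
  have q_zero: "q \<zero>\<^bsub>X\<^esub> = 0"
    using q_le[of "\<zero>\<^bsub>W\<^esub>"] q_nonneg[OF R_zero] by (simp add: f_zero n_zero)
  have q_add: "q (x \<oplus>\<^bsub>X\<^esub> y) \<le> q x + q y" if x: "x \<in> R" and y: "y \<in> R" for x y
  proof (rule field_le_epsilon)
    fix e :: real assume "e > 0"
    then obtain w v where "w \<in> carrier W" "f w = x" "n w < q x + e / 2"
        "v \<in> carrier W" "f v = y" "n v < q y + e / 2"
      using q_attain[OF x, of "q x + e / 2"] q_attain[OF y, of "q y + e / 2"] by auto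
    then show "q (x \<oplus>\<^bsub>X\<^esub> y) \<le> q x + q y + e"
      using q_le[of "w \<oplus>\<^bsub>W\<^esub> v"] n_add[of w v] by (simp add: f_add)
  qed
  have q_smult_le: "q (c \<odot>\<^bsub>X\<^esub> y) \<le> norm c * q y" if y: "y \<in> R" for c y
  proof (cases "c = 0")
    case True
    have "y \<in> carrier X" using y R_sub by blast
    then have "0 \<odot>\<^bsub>X\<^esub> y = \<zero>\<^bsub>X\<^esub>" using X.smult_l_null[of y] by simp
    with True show ?thesis by (simp add: q_zero)
  next
    case False
    show ?thesis
    proof (rule field_le_epsilon)
      fix e :: real assume "e > 0"
      with False have "q y < q y + e / norm c" by simp
      then obtain v where v: "v \<in> carrier W" "f v = y" "n v < q y + e / norm c"
        using q_attain[OF y] by blast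
      have "q (c \<odot>\<^bsub>X\<^esub> y) \<le> norm c * n v"
        using q_le[of "c \<odot>\<^bsub>W\<^esub> v"] v by (simp add: f_smult n_smult)
      also have "\<dots> \<le> norm c * (q y + e / norm c)"
        using v by (intro mult_left_mono) auto
      also have "\<dots> = norm c * q y + e" using False by (simp add: distrib_left)
      finally show "q (c \<odot>\<^bsub>X\<^esub> y) \<le> norm c * q y + e" .
    qed
  qed
  have q_smult: "q (c \<odot>\<^bsub>X\<^esub> y) = norm c * q y" if y: "y \<in> R" for c y
  proof (cases "c = 0")
    case True
    have "y \<in> carrier X" using y R_sub by blast
    then have "0 \<odot>\<^bsub>X\<^esub> y = \<zero>\<^bsub>X\<^esub>" using X.smult_l_null[of y] by simp
    with True show ?thesis by (simp add: q_zero)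
  next
    case False
    have yX: "y \<in> carrier X" using y R_sub by blast
    have "inverse c \<odot>\<^bsub>X\<^esub> (c \<odot>\<^bsub>X\<^esub> y) = y"
      using X.smult_assoc1[of "inverse c" c y] X.smult_one[of y] yX False by simp
    then have "q y \<le> norm (inverse c) * q (c \<odot>\<^bsub>X\<^esub> y)"
      using q_smult_le[OF R_smult[OF y], of "inverse c" c] by simp
    then have "norm c * q y \<le> norm c * (norm (inverse c) * q (c \<odot>\<^bsub>X\<^esub> y))"
      by (rule mult_left_mono) simp
    also have "\<dots> = norm (c * inverse c) * q (c \<odot>\<^bsub>X\<^esub> y)"
      by (simp add: norm_mult)
    also have "\<dots> = q (c \<odot>\<^bsub>X\<^esub> y)"
      using False by simp
    finally have "norm c * q y \<le> q (c \<odot>\<^bsub>X\<^esub> y)" .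
    with q_smult_le[OF y, of c] show ?thesis by simp
  qed

  \<comment> \<open>The image of \<open>f\<close> with the quotient norm.\<close>
  define Q0 where "Q0 = X\<lparr>carrier := R\<rparr>"
  define Q where "Q = Q0\<lparr>topol := Metric_space.mtopology R (norm_dist Q0 q)\<rparr>"
  have Q_simps [simp]: "carrier Q = R" "add Q = add X" "smult Q = smult X" "zero Q = zero X"
    "topol Q = Metric_space.mtopology R (norm_dist Q0 q)"
    by (simp_all add: Q_def Q0_def)
  have "abelian_group Q"
  proof (rule abelian_groupI)
    fix x assume "x \<in> carrier Q"
    then have x: "x \<in> R" "x \<in> carrier X" using R_sub by auto
    have "(- 1) \<odot>\<^bsub>X\<^esub> x = \<ominus>\<^bsub>X\<^esub> x"
      using X.smult_l_minus[of 1 x] X.smult_one[of x] x by simp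
    then show "\<exists>y\<in>carrier Q. y \<oplus>\<^bsub>Q\<^esub> x = \<zero>\<^bsub>Q\<^esub>"
      using x R_smult[of x "- 1"] by (intro bexI[of _ "(- 1) \<odot>\<^bsub>X\<^esub> x"]) (auto simp: X.M.l_neg)
  next
    fix x y z assume "x \<in> carrier Q" "y \<in> carrier Q" "z \<in> carrier Q"
    then have "x \<in> carrier X" "y \<in> carrier X" "z \<in> carrier X" using R_sub by auto
    then show "x \<oplus>\<^bsub>Q\<^esub> y \<oplus>\<^bsub>Q\<^esub> z = x \<oplus>\<^bsub>Q\<^esub> (y \<oplus>\<^bsub>Q\<^esub> z)"
      by (simp add: X.M.a_assoc)
  next
    fix x y assume "x \<in> carrier Q" "y \<in> carrier Q"
    then have "x \<in> carrier X" "y \<in> carrier X" using R_sub by auto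
    then show "x \<oplus>\<^bsub>Q\<^esub> y = y \<oplus>\<^bsub>Q\<^esub> x"
      by (simp add: X.M.a_comm)
  qed (use R_sub R_zero R_add in auto)
  then have modQ: "module scalars Q"
  proof (rule moduleI[OF cring_scalars], goal_cases)
    case (2 a b x) then show ?case using R_sub X.smult_l_distr[of a b x] by auto
  next
    case (3 a x y) then show ?case using R_sub X.smult_r_distr[of a x y] by auto
  next
    case (4 a b x) then show ?case using R_sub X.smult_assoc1[of a b x] by auto
  next
    case (5 x) then show ?case using R_sub X.smult_one[of x] by auto
  qed (simp add: R_smult)
  interpret Q: module scalars Q by (rule modQ)
  have dist_Q0: "norm_dist Q0 q = norm_dist Q q"
    by (intro ext) (simp add: norm_dist_def Q_def a_minus_def a_inv_def m_inv_def Q0_def)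
  have vnQ: "vector_norm Q q"
    unfolding vector_norm_def using q_nonneg q_zero_imp q_zero q_add q_smult by auto
  interpret MQ: Metric_space R "norm_dist Q q"
    using Metric_space_norm_dist[OF modQ vnQ] by simp
  have Q_minus: "x \<ominus>\<^bsub>Q\<^esub> y = x \<ominus>\<^bsub>X\<^esub> y" if "x \<in> R" "y \<in> R" for x y
    using that R_sub Q.minus_conv_smult[of x y] X.minus_conv_smult[of x y] by (simp add: subset_iff)
  have dist_f: "norm_dist Q q (f w) (f v) \<le> norm_dist W n w v"
    if "w \<in> carrier W" "v \<in> carrier W" for w v
    using that q_le[of "w \<ominus>\<^bsub>W\<^esub> v"] by (simp add: norm_dist_def R_def Q_minus f_minus)
  have lift: "\<exists>v\<in>carrier W. f (w \<oplus>\<^bsub>W\<^esub> v) = y \<and> n v < c"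
    if w: "w \<in> carrier W" and y: "y \<in> R" and c: "norm_dist Q q (f w) y < c" for w y c
  proof -
    have fw: "f w \<in> R" using w by (simp add: R_def)
    have yX: "y \<in> carrier X" using y R_sub by blast
    have "norm_dist Q q y (f w) < c" using c MQ.commute by simp
    then have "q (y \<ominus>\<^bsub>X\<^esub> f w) < c"
      using y fw by (simp add: norm_dist_def Q_minus)
    moreover have "y \<ominus>\<^bsub>X\<^esub> f w \<in> R"
      using Q.M.minus_closed[of y "f w"] Q_minus[OF y fw] y fw by simp
    ultimately obtain v where v: "v \<in> carrier W" "f v = y \<ominus>\<^bsub>X\<^esub> f w" "n v < c"
      using q_attain by blast
    have "f (w \<oplus>\<^bsub>W\<^esub> v) = f w \<oplus>\<^bsub>X\<^esub> (y \<oplus>\<^bsub>X\<^esub> \<ominus>\<^bsub>X\<^esub> f w)"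
      using v w by (simp add: f_add a_minus_def)
    also have "\<dots> = y"
      using w yX X.M.a_comm[of y "\<ominus>\<^bsub>X\<^esub> f w"] by (simp add: X.M.r_neg2)
    finally show ?thesis using v by blast
  qed

  have "MQ.mcomplete"
    unfolding MQ.mcomplete_def
  proof (intro allI impI)
    fix \<sigma> assume cau: "MQ.MCauchy \<sigma>"
    then have \<sigma>R: "\<sigma> k \<in> R" for k by (auto simp: MQ.MCauchy_def)
    have "\<exists>N. \<forall>k k'. N \<le> k \<longrightarrow> N \<le> k' \<longrightarrow> norm_dist Q q (\<sigma> k) (\<sigma> k') < (1/2)^j" for j :: nat
      using cau unfolding MQ.MCauchy_def by (meson half_gt_zero_iff zero_less_one zero_less_power)
    then obtain N where N: "\<And>j k k'. N j \<le> k \<Longrightarrow> N j \<le> k' \<Longrightarrow>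
        norm_dist Q q (\<sigma> k) (\<sigma> k') < (1/2)^j" by metis
    define r where "r = rec_nat (N 0) (\<lambda>j m. max (Suc m) (N (Suc j)))"
    have r_Suc: "r (Suc j) = max (Suc (r j)) (N (Suc j))" for j by (simp add: r_def)
    have r_mono: "strict_mono r" by (rule strict_monoI_Suc) (simp add: r_Suc)
    have rN: "N j \<le> r j" for j by (cases j) (simp_all add: r_Suc, simp add: r_def)
    have r_dist: "norm_dist Q q (\<sigma> (r j)) (\<sigma> (r (Suc j))) < (1/2)^j" for j
      by (rule N) (use rN[of j] in \<open>auto simp: r_Suc\<close>)
    have "\<exists>w. (\<forall>j. w j \<in> carrier W \<and> f (w j) = \<sigma> (r j)) \<and>
        (\<forall>j. norm_dist W n (w j) (w (Suc j)) < (1/2)^j)"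
    proof -
      have "\<exists>w. \<forall>j. (w j \<in> carrier W \<and> f (w j) = \<sigma> (r j)) \<and>
          norm_dist W n (w j) (w (Suc j)) < (1/2)^j"
      proof (rule dependent_nat_choice)
        show "\<exists>w. w \<in> carrier W \<and> f w = \<sigma> (r 0)"
          using \<sigma>R[of "r 0"] by (auto simp: R_def)
      next
        fix w j assume w: "w \<in> carrier W \<and> f w = \<sigma> (r j)"
        then obtain v where "v \<in> carrier W" "f (w \<oplus>\<^bsub>W\<^esub> v) = \<sigma> (r (Suc j))" "n v < (1/2)^j"
          using lift[of w "\<sigma> (r (Suc j))" "(1/2)^j"] \<sigma>R r_dist[of j] by auto
        with w show "\<exists>v. (v \<in> carrier W \<and> f v = \<sigma> (r (Suc j))) \<and> norm_dist W n w v < (1/2)^j"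
          using dist_add[of w v] by (intro exI[of _ "w \<oplus>\<^bsub>W\<^esub> v"]) auto
      qed
      then show ?thesis by blast
    qed
    then obtain w where w: "\<And>j. w j \<in> carrier W" "\<And>j. f (w j) = \<sigma> (r j)"
      and w_dist: "\<And>j. norm_dist W n (w j) (w (Suc j)) < (1/2)^j" by blast
    have tail: "norm_dist W n (w j) (w (j + i)) \<le> 2 * (1/2)^j - 2 * (1/2)^(j + i)" for i j
    proof (induction i)
      case 0 then show ?case using w by simp
    next
      case (Suc i)
      have "norm_dist W n (w j) (w (j + Suc i)) \<le>
          norm_dist W n (w j) (w (j + i)) + norm_dist W n (w (j + i)) (w (j + Suc i))"
        using MW.triangle w by blast
      also have "\<dots> \<le> 2 * (1/2)^j - 2 * (1/2)^(j + i) + (1/2)^(j + i)"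
        using Suc.IH w_dist[of "j + i"] by simp
      finally show ?case by simp
    qed
    have "MW.MCauchy w"
      unfolding MW.MCauchy_def
    proof (intro conjI allI impI)
      show "range w \<subseteq> carrier W" using w by auto
      fix e :: real assume "e > 0"
      then obtain J where J: "(1/2)^J < e / 4"
        using real_arch_pow_inv[of "e/4" "1/2"] by auto
      have "norm_dist W n (w J) (w k) < e / 2" if "J \<le> k" for k
      proof -
        have "norm_dist W n (w J) (w k) \<le> 2 * (1/2)^J - 2 * (1/2)^k"
          using tail[of J "k - J"] that by simp
        also have "\<dots> < e / 2" using J zero_less_power[of "1/2::real" k] by linarith
        finally show ?thesis .
      qed
      note near = this
      have "norm_dist W n (w k) (w k') < e" if k: "J \<le> k" "J \<le> k'" for k k'
      proof -
        have "norm_dist W n (w k) (w k') \<le> norm_dist W n (w k) (w J) + norm_dist W n (w J) (w k')"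
          using MW.triangle w by blast
        then show ?thesis
          using near[OF k(1)] near[OF k(2)] MW.commute[of "w k" "w J"] by linarith
      qed
      then show "\<exists>N. \<forall>k k'. N \<le> k \<longrightarrow> N \<le> k' \<longrightarrow> norm_dist W n (w k) (w k') < e" by blast
    qed
    then obtain l where l: "limitin MW.mtopology w l sequentially"
      using complW unfolding MW.mcomplete_def by blast
    have "limitin MQ.mtopology (\<sigma> \<circ> r) (f l) sequentially"
      unfolding MQ.limitin_metric
    proof (intro conjI allI impI)
      have lW: "l \<in> carrier W" using l by (simp add: MW.limitin_metric)
      then show "f l \<in> R" by (simp add: R_def)
      fix e :: real assume "e > 0"
      then have "\<forall>\<^sub>F j in sequentially. w j \<in> carrier W \<and> norm_dist W n (w j) l < e"
        using l by (simp add: MW.limitin_metric)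
      then show "\<forall>\<^sub>F j in sequentially. (\<sigma> \<circ> r) j \<in> R \<and> norm_dist Q q ((\<sigma> \<circ> r) j) (f l) < e"
      proof (rule eventually_mono)
        fix j assume "w j \<in> carrier W \<and> norm_dist W n (w j) l < e"
        then show "(\<sigma> \<circ> r) j \<in> R \<and> norm_dist Q q ((\<sigma> \<circ> r) j) (f l) < e"
          using dist_f[of "w j" l] lW w(2)[of j] \<sigma>R by auto
      qed
    qed
    then show "\<exists>x. limitin MQ.mtopology \<sigma> x sequentially"
      using MQ.MCauchy_convergent_subsequence[OF cau r_mono] by blast
  qed
  then have "banach_space Q"
    unfolding banach_space_def using modQ vnQ dist_Q0 by auto
  moreover have "linear_map Q X id"
    using R_sub by (auto simp: linear_map_def)
  moreover have "closed_graph Q X id"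
    unfolding closed_graph_def closedin_def
  proof (intro conjI)
    let ?T = "topspace (prod_topology (topol Q) (topol X))"
    let ?G = "{(y, id y) |y. y \<in> carrier Q}"
    have T: "?T = R \<times> carrier X" by (simp add: dist_Q0 X.topspace_topol)
    show "?G \<subseteq> ?T" using R_sub unfolding T by auto
    show "openin (prod_topology (topol Q) (topol X)) (?T - ?G)"
      unfolding openin_prod_topology_alt
    proof (intro allI impI)
      fix y x assume "(y, x) \<in> ?T - ?G"
      then have y: "y \<in> R" and x: "x \<in> carrier X" and ne: "x \<noteq> y" unfolding T by auto
      obtain w where w: "w \<in> carrier W" "f w = y" using y by (auto simp: R_def)
      obtain r B where r: "r > 0" and B: "openin (topol X) B" "x \<in> B"
        and *: "\<And>v. v \<in> carrier W \<Longrightarrow> n v < r \<Longrightarrow> f (w \<oplus>\<^bsub>W\<^esub> v) \<notin> B"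
        using sep[of w x] w x ne by metis
      have "MQ.mball y r \<times> B \<subseteq> ?T - ?G"
      proof -
        have "z \<notin> B" if "z \<in> MQ.mball y r" for z
          using lift[of w z r] w that * by auto
        moreover have "B \<subseteq> carrier X" using B openin_subset X.topspace_topol by metis
        ultimately show ?thesis unfolding T by auto
      qed
      moreover have "openin (topol Q) (MQ.mball y r)" by (simp add: dist_Q0)
      moreover have "y \<in> MQ.mball y r" using y r by simp
      ultimately show "\<exists>U V. openin (topol Q) U \<and> openin (topol X) V \<and> y \<in> U \<and> x \<in> V \<and>
          U \<times> V \<subseteq> ?T - ?G"
        using B by blast
    qed
  qed
  ultimately have "continuous_map (topol Q) (topol X) id"
    using X unfolding bc_space_def by blast
  moreover have "continuous_map (topol W) (topol Q) f"
  proof -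
    have "continuous_map MW.mtopology MQ.mtopology f"
      unfolding MW.metric_continuous_map[OF MQ.Metric_space_axioms]
    proof (intro conjI ballI allI impI)
      show "f ` carrier W \<subseteq> R" by (simp add: R_def)
      fix w and e :: real assume "w \<in> carrier W" "e > 0"
      then show "\<exists>\<delta>>0. \<forall>v. v \<in> carrier W \<and> norm_dist W n w v < \<delta> \<longrightarrow>
          norm_dist Q q (f w) (f v) < e"
        using dist_f by (intro exI[of _ e]) (auto intro: le_less_trans)
    qed
    then show ?thesis by (simp add: topW dist_Q0)
  qed
  ultimately have "continuous_map (topol W) (topol X) (id \<circ> f)"
    using continuous_map_compose by blast
  then show ?thesis by simp
qed


section \<open>Function spaces, duals and preduals\<close>

text \<open>\<open>functions_on \<Omega>\<close> is the space of all scalar functions on \<open>\<Omega>\<close>; they are extended by \<open>0\<close> to the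
  ambient type so that equality is equality on \<open>\<Omega>\<close>.\<close>

definition functions_on :: "'a set \<Rightarrow> ('a \<Rightarrow> 'k::real_or_complex) set" where
  "functions_on \<Omega> = {f. \<forall>x. x \<notin> \<Omega> \<longrightarrow> f x = 0}"

definition function_space ::
    "('a \<Rightarrow> 'k::real_or_complex) set \<Rightarrow> ('a \<Rightarrow> 'k) topology \<Rightarrow> ('k, 'a \<Rightarrow> 'k) top_module" where
  "function_space V \<tau> =
     \<lparr>carrier = V, monoid.mult = undefined, one = undefined,
      zero = (\<lambda>_. 0), add = (\<lambda>f g x. f x + g x), smult = (\<lambda>c f x. c * f x), topol = \<tau>\<rparr>"

text \<open>On functions that vanish outside \<open>\<Omega>\<close>, pointwise convergence on the whole type is pointwise
  convergence on \<open>\<Omega>\<close>.\<close>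

definition pointwise_topology :: "('a \<Rightarrow> 'k::real_or_complex) set \<Rightarrow> ('a \<Rightarrow> 'k) topology" where
  "pointwise_topology V = subtopology (product_topology (\<lambda>_. euclidean) UNIV) V"

definition coarser :: "'v topology \<Rightarrow> 'v topology \<Rightarrow> bool" where
  "coarser \<tau>\<^sub>0 \<tau>\<^sub>1 \<longleftrightarrow> (\<forall>G. openin \<tau>\<^sub>0 G \<longrightarrow> openin \<tau>\<^sub>1 G)"

text \<open>The topology on \<open>H\<close> of uniform convergence on the members of \<open>\<S>\<close>.\<close>

definition uniform_topology ::
    "('v \<Rightarrow> 'k::real_or_complex) set \<Rightarrow> 'v set set \<Rightarrow> ('v \<Rightarrow> 'k) topology" where
  "uniform_topology H \<S> = topology (\<lambda>G. G \<subseteq> H \<and>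
     (\<forall>u\<in>G. \<exists>\<F> e. finite \<F> \<and> \<F> \<subseteq> \<S> \<and> 0 < e \<and>
        (\<forall>v\<in>H. (\<forall>x\<in>\<Union>\<F>. norm (v x - u x) < e) \<longrightarrow> v \<in> G)))"

lemma istopology_uniform:
  fixes H :: "('v \<Rightarrow> 'k::real_or_complex) set"
  shows "istopology (\<lambda>G. G \<subseteq> H \<and>
     (\<forall>u\<in>G. \<exists>\<F> e. finite \<F> \<and> \<F> \<subseteq> \<S> \<and> 0 < e \<and>
        (\<forall>v\<in>H. (\<forall>x\<in>\<Union>\<F>. norm (v x - u x) < e) \<longrightarrow> v \<in> G)))"
    (is "istopology ?P")
  unfolding istopology_def
proof (rule conjI; intro allI impI)
  fix G G' assume G: "?P G" and G': "?P G'"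
  show "?P (G \<inter> G')"
  proof (intro conjI ballI)
    show "G \<inter> G' \<subseteq> H" using G by blast
    fix u assume u: "u \<in> G \<inter> G'"
    obtain \<F> e where 1: "finite \<F>" "\<F> \<subseteq> \<S>" "0 < e"
        "\<forall>v\<in>H. (\<forall>x\<in>\<Union>\<F>. norm (v x - u x) < e) \<longrightarrow> v \<in> G"
      using G u by blast
    obtain \<F>' e' where 2: "finite \<F>'" "\<F>' \<subseteq> \<S>" "0 < e'"
        "\<forall>v\<in>H. (\<forall>x\<in>\<Union>\<F>'. norm (v x - u x) < e') \<longrightarrow> v \<in> G'"
      using G' u by blast
    show "\<exists>\<F> e. finite \<F> \<and> \<F> \<subseteq> \<S> \<and> 0 < e \<and>
        (\<forall>v\<in>H. (\<forall>x\<in>\<Union>\<F>. norm (v x - u x) < e) \<longrightarrow> v \<in> G \<inter> G')"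
    proof (rule exI[of _ "\<F> \<union> \<F>'"], rule exI[of _ "min e e'"], intro conjI ballI impI)
      fix v assume "v \<in> H" and v: "\<forall>x\<in>\<Union>(\<F> \<union> \<F>'). norm (v x - u x) < min e e'"
      then have "\<forall>x\<in>\<Union>\<F>. norm (v x - u x) < e" "\<forall>x\<in>\<Union>\<F>'. norm (v x - u x) < e'"
        by auto
      with 1(4) 2(4) \<open>v \<in> H\<close> show "v \<in> G \<inter> G'" by simp
    qed (use 1 2 in auto)
  qed
next
  fix \<K> assume \<K>: "\<forall>K\<in>\<K>. ?P K"
  show "?P (\<Union>\<K>)"
  proof (intro conjI ballI)
    show "\<Union>\<K> \<subseteq> H" using \<K> by blast
    fix u assume "u \<in> \<Union>\<K>"
    then obtain K where K: "K \<in> \<K>" "u \<in> K" by blast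
    have "?P K" using \<K> K(1) by (rule bspec)
    then obtain \<F> e where *: "finite \<F>" "\<F> \<subseteq> \<S>" "0 < e"
        "\<forall>v\<in>H. (\<forall>x\<in>\<Union>\<F>. norm (v x - u x) < e) \<longrightarrow> v \<in> K"
      using K(2) by meson
    show "\<exists>\<F> e. finite \<F> \<and> \<F> \<subseteq> \<S> \<and> 0 < e \<and>
        (\<forall>v\<in>H. (\<forall>x\<in>\<Union>\<F>. norm (v x - u x) < e) \<longrightarrow> v \<in> \<Union>\<K>)"
      by (rule exI[of _ \<F>], rule exI[of _ e], intro conjI ballI impI)
        (use * K(1) in \<open>simp_all, blast\<close>)
  qed
qed

definition linear_functional ::
    "('k::real_or_complex, 'v) top_module \<Rightarrow> ('v \<Rightarrow> 'k) \<Rightarrow> bool" where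
  "linear_functional X u \<longleftrightarrow> u \<in> functions_on (carrier X) \<and>
     (\<forall>x\<in>carrier X. \<forall>y\<in>carrier X. u (x \<oplus>\<^bsub>X\<^esub> y) = u x + u y) \<and>
     (\<forall>c. \<forall>x\<in>carrier X. u (c \<odot>\<^bsub>X\<^esub> x) = c * u x)"

definition dual :: "('k::real_or_complex, 'v) top_module \<Rightarrow> ('v \<Rightarrow> 'k) set" where
  "dual Y = {u. linear_functional Y u \<and> continuous_map (topol Y) euclidean u}"

definition strong_dual ::
    "('k::real_or_complex, 'v) top_module \<Rightarrow> ('k, 'v \<Rightarrow> 'k) top_module" where
  "strong_dual Y = function_space (dual Y) (uniform_topology (dual Y) {B. bounded_in Y B})"

definition predual ::
    "('k::real_or_complex, 'w) top_module \<Rightarrow> ('k, 'v) top_module \<Rightarrow> ('w \<Rightarrow> 'v \<Rightarrow> 'k) \<Rightarrow> bool" where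
  "predual X Y \<phi> \<longleftrightarrow> lc_hausdorff Y \<and> topological_isomorphism X (strong_dual Y) \<phi>"

definition has_unique_predual ::
    "('k::real_or_complex, 'v) top_module set \<Rightarrow> ('k, 'w) top_module \<Rightarrow> bool" where
  "has_unique_predual C X \<longleftrightarrow>
     (\<forall>Y\<in>C. \<forall>Z\<in>C. \<forall>\<phi> \<psi>. predual X Y \<phi> \<and> predual X Z \<psi> \<longrightarrow>
        (\<exists>f. topological_isomorphism Y Z f))"

text \<open>Linear functionals whose restrictions to the bounded subsets of \<open>X\<close> are continuous for \<open>\<tau>'\<close>,
  with the topology of uniform convergence on the bounded subsets of \<open>X\<close>.\<close>

definition bounded_continuous_dual ::
    "('k::real_or_complex, 'v) top_module \<Rightarrow> 'v topology \<Rightarrow> ('k, 'v \<Rightarrow> 'k) top_module" where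
  "bounded_continuous_dual X \<tau>' =
     (let H = {u. linear_functional X u \<and>
                  (\<forall>B. bounded_in X B \<longrightarrow> continuous_map (subtopology \<tau>' B) euclidean u)}
      in function_space H (uniform_topology H {B. bounded_in X B}))"

definition BBC :: "('k::real_or_complex, 'v) top_module \<Rightarrow> 'v topology \<Rightarrow> bool" where
  "BBC X \<tau>' \<longleftrightarrow>
     (\<forall>B. bounded_in X B \<longrightarrow>
        (\<exists>K. B \<subseteq> K \<and> absolutely_convex X K \<and> bounded_in X K \<and> compactin \<tau>' K))"

definition CNC :: "('k::real_or_complex, 'v) top_module \<Rightarrow> 'v topology \<Rightarrow> bool" where
  "CNC X \<tau>' \<longleftrightarrow>
     (\<forall>U. zero_nbhd X U \<longrightarrow>
        (\<exists>W. zero_nbhd X W \<and> W \<subseteq> U \<and> absolutely_convex X W \<and> closedin \<tau>' W))"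

end

theory Submission
  imports Defs
begin

text \<open>
  Write \<open>X\<close> for \<open>(\<F>(\<Omega>), \<tau>)\<close> and \<open>E\<close> for the space of linear functionals on \<open>X\<close> that are \<open>\<tau>'\<close>-continuous
  on bounded sets. Evaluation identifies \<open>X\<close> with \<open>E'\<^sub>b\<close>: a functional on \<open>E\<close> bounded by the supremum
  over a \<open>\<tau>'\<close>-compact absolutely convex set \<open>K\<close> is the evaluation at a point of \<open>K\<close>, and the topologies
  agree by the Hahn-Banach theorem for \<open>\<tau>'\<close> (CNC) and since \<open>X\<close> is bornological. So \<open>E\<close> is a predual
  in \<open>C\<close>, it contains all \<open>\<delta>\<^sub>x\<close>, and a unique predual \<open>Z\<close> inherits these through \<open>Z \<cong> E\<close>.

  Conversely let \<open>\<psi> : X \<rightarrow> Z'\<^sub>b\<close> be an isomorphism for which all \<open>\<delta>\<^sub>x\<close> come from points \<open>z\<^sub>x\<close> of \<open>Z\<close>.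
  These points span a dense subspace of \<open>Z\<close>, and \<open>Z\<close> is barrelled, so each \<open>\<psi>(\<cdot>)(z)\<close> is on bounded sets
  a uniform limit of combinations of the \<open>\<delta>\<^sub>x\<close> and hence lies in \<open>E\<close>. The resulting map \<open>Z \<rightarrow> E\<close> is an
  isomorphism onto its image, which is dense by the identification \<open>E' = X\<close> and closed as \<open>Z\<close> is
  complete. Thus every predual in \<open>C\<close> is isomorphic to \<open>E\<close>.
\<close>

section \<open>The scalar field\<close>

text \<open>Two transposed maps carry the argument: J sends a predual Z into E, \<psi> sends X into
  the dual of Z, and \<open>\<psi> x z = J z x\<close> on the carriers. Each direction builds one
  from the other and compares topologies by polarity: polars of 0-neighbourhoods are bounded, and
  polars of bounded sets are 0-neighbourhoods, in X because it is bornological and in Z because it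
  is barrelled. E itself is handled only as a module with a topology on it; what needs a locally
  convex space is done on a space isomorphic to E. The same device bridges types, since E consists
  of functionals while the members of C have carriers in a fixed type. The hypothesis on evaluations
  enters in a weaker form: those functionals \<psi>(.)(z) that lie in E separate the points of X.
  The scalar class covers the real and the complex case together, so real parts and conjugates are
  derived from the norm. Hahn-Banach is proved algebraically, for gauges of absorbing sets, and thus
  applies to Z, to \<tau>' and to E alike.\<close>

definition re_part :: "'k::real_or_complex \<Rightarrow> real" where
  "re_part z = ((norm (1 + z))\<^sup>2 - 1 - (norm z)\<^sup>2) / 2"

text \<open>Both \<open>re_part\<close>, read off from |1 + z|^2 = 1 + 2 Re z + |z|^2, and the
  conjugate |z|^2 / z avoid the choice of an imaginary unit. At z = 0 the convention
  \<open>inverse 0 = 0\<close> gives the value 0.\<close>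

definition conjugate :: "'k::real_or_complex \<Rightarrow> 'k" where
  "conjugate z = (norm z)\<^sup>2 *\<^sub>R inverse z"

lemma two_re_part: "2 * re_part z = (norm (1 + z))\<^sup>2 - 1 - (norm z)\<^sup>2"
  by (simp add: re_part_def)

lemma re_part_of_real [simp]: "re_part (of_real r) = r"
proof -
  have "norm (1 + of_real r :: 'a) = \<bar>1 + r\<bar>"
    by (metis norm_of_real of_real_1 of_real_add)
  then show ?thesis
    by (simp add: re_part_def power2_eq_square algebra_simps)
qed

text \<open>Additivity of \<open>re_part\<close> is not visible from its formula, so it is checked
  in coordinates. In the complex case the norm formula of the class, inserted into the expression
  for |1 + z|^2, returns the coordinate a.\<close>

lemma re_part_cases:
  obtains (real) "\<And>z::'k::real_or_complex. z = of_real (re_part z)"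
  | (complex) i :: "'k::real_or_complex" where "i * i = - 1" "\<And>a b. re_part (of_real a + of_real b * i) = a"
      "\<And>z::'k::real_or_complex. \<exists>b. z = of_real (re_part z) + of_real b * i"
proof -
  consider "\<forall>z::'k. \<exists>a. z = a *\<^sub>R 1"
    | i :: 'k where "i * i = - 1" "\<And>z. \<exists>a b. z = a *\<^sub>R 1 + b *\<^sub>R i"
        "\<And>a b. norm (a *\<^sub>R 1 + b *\<^sub>R i) = sqrt (a\<^sup>2 + b\<^sup>2)"
    using real_or_complex[where 'a='k] by metis
  then show ?thesis
  proof cases
    case 1
    then have "z = of_real (re_part z)" for z :: 'k
      by (metis of_real_def re_part_of_real)
    then show ?thesis by (rule real)
  next
    case 2
    have re: "re_part (of_real a + of_real b * i) = a" for a b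
    proof -
      have n: "norm (of_real a + of_real b * i) = sqrt (a\<^sup>2 + b\<^sup>2)" for a b
        using 2(3)[of a b] by (simp add: scaleR_conv_of_real)
      have "1 + (of_real a + of_real b * i) = of_real (1 + a) + of_real b * i"
        by simp
      then have "(norm (1 + (of_real a + of_real b * i)))\<^sup>2 = (1 + a)\<^sup>2 + b\<^sup>2"
        by (simp only: n) simp
      then show ?thesis
        unfolding re_part_def by (simp add: n power2_sum)
    qed
    show ?thesis
    proof (rule complex[OF 2(1) re])
      fix z :: 'k
      obtain a b where "z = of_real a + of_real b * i"
        using 2(2)[of z] by (auto simp: scaleR_conv_of_real)
      with re show "\<exists>b. z = of_real (re_part z) + of_real b * i"
        by metis
    qed
  qed
qed

lemma re_part_add: "re_part (y + z) = re_part y + re_part (z :: 'k::real_or_complex)"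
proof (cases rule: re_part_cases[where 'k='k])
  case real
  then show ?thesis by (metis of_real_add re_part_of_real)
next
  case (complex i)
  obtain a b where y: "y = of_real a + of_real b * i"
    using complex(3)[of y] by blast
  obtain c d where z: "z = of_real c + of_real d * i"
    using complex(3)[of z] by blast
  have "y + z = of_real (a + c) + of_real (b + d) * i"
    by (simp add: y z algebra_simps)
  then have "re_part (y + z) = a + c"
    by (simp only: complex(2))
  moreover have "re_part y = a" "re_part z = c"
    by (simp_all only: y z complex(2))
  ultimately show ?thesis by simp
qed

lemma re_part_of_real_mult:
  "re_part (of_real r * z) = r * re_part (z :: 'k::real_or_complex)"
proof (cases rule: re_part_cases[where 'k='k])
  case real
  then show ?thesis by (metis of_real_mult re_part_of_real)
next
  case (complex i)
  obtain a b where z: "z = of_real a + of_real b * i"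
    using complex(3)[of z] by blast
  have "of_real r * z = of_real (r * a) + of_real (r * b) * i"
    by (simp add: z algebra_simps)
  then have "re_part (of_real r * z) = r * a"
    by (simp only: complex(2))
  moreover have "re_part z = a"
    by (simp only: z complex(2))
  ultimately show ?thesis by simp
qed

lemma re_part_minus: "re_part (- z) = - re_part z"
  using re_part_of_real_mult[of "-1" z] by simp

lemma re_part_diff: "re_part (y - z) = re_part y - re_part z"
  using re_part_add[of y "- z"] by (simp add: re_part_minus)

lemma re_part_zero [simp]: "re_part 0 = 0"
  using re_part_of_real[of 0] by simp

lemma re_part_sum: "re_part (sum f A) = (\<Sum>x\<in>A. re_part (f x))"
  by (induction A rule: infinite_finite_induct) (simp_all add: re_part_add)

lemma re_part_le_norm: "re_part z \<le> norm z"
proof -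
  have "norm (1 + z) \<le> 1 + norm z" using norm_triangle_ineq[of 1 z] by simp
  then have "(norm (1 + z))\<^sup>2 \<le> (1 + norm z)\<^sup>2" by (intro power_mono) auto
  then show ?thesis by (simp add: re_part_def power2_eq_square algebra_simps)
qed

lemma conjugate_mult_self: "conjugate z * z = of_real ((norm z)\<^sup>2)"
  by (cases "z = 0") (simp_all add: conjugate_def scaleR_conv_of_real)

text \<open>The definition of \<open>re_part\<close> is the case y = 1. For other y \<noteq> 0
  factor out y, since |y + z| = |y| |1 + z/y|.\<close>

lemma norm_add_square:
  fixes y z :: "'k::real_or_complex"
  shows "(norm (y + z))\<^sup>2 = (norm y)\<^sup>2 + 2 * re_part (conjugate y * z) + (norm z)\<^sup>2"
proof (cases "y = 0")
  case False
  have "conjugate y * z = of_real ((norm y)\<^sup>2) * (z / y)"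
    by (simp add: conjugate_def scaleR_conv_of_real divide_inverse)
  then have "re_part (conjugate y * z) = (norm y)\<^sup>2 * re_part (z / y)"
    using re_part_of_real_mult by metis
  moreover have "norm (y + z) = norm y * norm (1 + z / y)"
    using False by (simp flip: norm_mult add: distrib_left)
  moreover have "(norm y)\<^sup>2 * (norm (z / y))\<^sup>2 = (norm z)\<^sup>2"
    using False by (simp add: norm_divide power_divide)
  moreover have "(norm (1 + z / y))\<^sup>2 = 1 + 2 * re_part (z / y) + (norm (z / y))\<^sup>2"
    using two_re_part[of "z / y"] by simp
  ultimately show ?thesis
    by (simp add: power_mult_distrib distrib_left)
qed (simp add: conjugate_def)

text \<open>Converts bounds on real parts over a balanced set into bounds on norms: multiplication
  by w stays in the set and makes the value equal to its modulus.\<close>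

lemma ex_rotation:
  obtains w :: "'k::real_or_complex" where "norm w = 1" "w * z = of_real (norm z)"
proof (cases "z = 0")
  case True
  then show ?thesis using that[of 1] by simp
next
  case False
  then show ?thesis using that[of "of_real (norm z) / z"] by (simp add: norm_divide)
qed


section \<open>The Hahn-Banach theorem\<close>

locale scalar_module = module scalars X
  for X :: "('k::real_or_complex, 'v) top_module" (structure)
begin

lemma smult_mem [simp, intro]: "x \<in> carrier X \<Longrightarrow> a \<odot> x \<in> carrier X"
  by simp

lemma add_smult: "x \<in> carrier X \<Longrightarrow> (a + b) \<odot> x = a \<odot> x \<oplus> b \<odot> x"
  using smult_l_distr[of a b x] by simp

lemma smult_add: "x \<in> carrier X \<Longrightarrow> y \<in> carrier X \<Longrightarrow> a \<odot> (x \<oplus> y) = a \<odot> x \<oplus> a \<odot> y"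
  using smult_r_distr[of a x y] by simp

lemma smult_smult [simp]: "x \<in> carrier X \<Longrightarrow> a \<odot> (b \<odot> x) = (a * b) \<odot> x"
  using smult_assoc1[of a b x] by simp

lemma one_smult [simp]: "x \<in> carrier X \<Longrightarrow> 1 \<odot> x = x"
  using smult_one[of x] by simp

lemma zero_smult [simp]: "x \<in> carrier X \<Longrightarrow> 0 \<odot> x = \<zero>"
  using smult_l_null[of x] by simp

lemma smult_zero [simp]: "a \<odot> \<zero> = \<zero>"
  using smult_r_null[of a] by simp

lemma uminus_conv_smult: "x \<in> carrier X \<Longrightarrow> \<ominus> x = (- 1) \<odot> x"
  using smult_l_minus[of 1 x] by simp

lemma minus_eq_add_smult: "x \<in> carrier X \<Longrightarrow> y \<in> carrier X \<Longrightarrow> x \<ominus> y = x \<oplus> (- 1) \<odot> y"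
  using minus_conv_smult[of x y] by simp

lemma add_minus_cancel [simp]:
  assumes "x \<in> carrier X" "y \<in> carrier X"
  shows "x \<oplus> (y \<ominus> x) = y"
proof -
  have "x \<oplus> (y \<ominus> x) = x \<oplus> (\<ominus> x \<oplus> y)"
    unfolding a_minus_def by (subst M.a_comm[of y]) (use assms in auto)
  then show ?thesis using assms by (simp add: M.r_neg2)
qed

lemma diff_eq_zero_iff [simp]:
  assumes "x \<in> carrier X" "y \<in> carrier X"
  shows "x \<ominus> y = \<zero> \<longleftrightarrow> x = y"
proof
  assume "x \<ominus> y = \<zero>"
  then show "x = y" using add_minus_cancel[of y x] assms by simp
qed (use assms in \<open>simp add: a_minus_def M.r_neg\<close>)

section \<open>Sublinear functionals and their minimal elements\<close>

definition sublinear :: "('v \<Rightarrow> real) \<Rightarrow> bool" where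
  "sublinear p \<longleftrightarrow> (\<forall>x\<in>carrier X. \<forall>y\<in>carrier X. p (x \<oplus> y) \<le> p x + p y) \<and>
     (\<forall>x\<in>carrier X. \<forall>t\<ge>0. p (of_real t \<odot> x) = t * p x)"

lemma sublinear_add: "sublinear p \<Longrightarrow> x \<in> carrier X \<Longrightarrow> y \<in> carrier X \<Longrightarrow> p (x \<oplus> y) \<le> p x + p y"
  by (simp add: sublinear_def)

lemma sublinear_smult: "sublinear p \<Longrightarrow> x \<in> carrier X \<Longrightarrow> 0 \<le> t \<Longrightarrow> p (of_real t \<odot> x) = t * p x"
  by (simp add: sublinear_def)

lemma sublinear_zero: "sublinear p \<Longrightarrow> p \<zero> = 0"
  using sublinear_smult[of p \<zero> 0] by simp

lemma sublinear_uminus: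
  assumes "sublinear p" "x \<in> carrier X"
  shows "- p (\<ominus> x) \<le> p x"
proof -
  have "p \<zero> \<le> p x + p (\<ominus> x)"
    using sublinear_add[OF assms M.a_inv_closed[OF assms(2)]] M.r_neg[OF assms(2)] by metis
  then show ?thesis using sublinear_zero[OF assms(1)] by linarith
qed

text \<open>A sublinear functional below p that is pushed down in the direction of -y: the parameter
  t = 1 at x = -y gives at most -p y. The value 0 off the carrier lets total functions be compared
  pointwise.\<close>

definition tilt :: "('v \<Rightarrow> real) \<Rightarrow> 'v \<Rightarrow> 'v \<Rightarrow> real" where
  "tilt p y x = (if x \<in> carrier X then INF t\<in>{0..}. p (x \<oplus> of_real t \<odot> y) - t * p y else 0)"

text \<open>The infimum is finite because t p(y) = p(ty) \<le> p(-x) + p(x + ty) bounds its terms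
  below by -p(-x). For subadditivity the parameters s and t of the two summands are added; for
  homogeneity t is replaced by t/r.\<close>

lemma
  assumes p: "sublinear p" and y: "y \<in> carrier X"
  shows tilt_le: "x \<in> carrier X \<Longrightarrow> 0 \<le> t \<Longrightarrow> tilt p y x \<le> p (x \<oplus> of_real t \<odot> y) - t * p y"
    and sublinear_tilt: "sublinear (tilt p y)"
proof -
  have bdd: "bdd_below ((\<lambda>t. p (x \<oplus> of_real t \<odot> y) - t * p y) ` {0..})" if x: "x \<in> carrier X" for x
  proof (rule bdd_belowI2)
    fix t :: real assume t: "t \<in> {0..}"
    have "\<ominus> x \<oplus> (x \<oplus> of_real t \<odot> y) = of_real t \<odot> y"
      using x y by (simp add: M.r_neg1)
    then have "p (of_real t \<odot> y) \<le> p (\<ominus> x) + p (x \<oplus> of_real t \<odot> y)"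
      using sublinear_add[OF p, of "\<ominus> x" "x \<oplus> of_real t \<odot> y"] x y by simp
    then show "- p (\<ominus> x) \<le> p (x \<oplus> of_real t \<odot> y) - t * p y"
      using sublinear_smult[OF p y] t by simp
  qed
  show le: "tilt p y x \<le> p (x \<oplus> of_real t \<odot> y) - t * p y" if "x \<in> carrier X" "0 \<le> t" for x t
    using that bdd[OF that(1)] unfolding tilt_def by (auto intro: cINF_lower)
  have ge: "c \<le> tilt p y x"
    if "x \<in> carrier X" "\<And>t. 0 \<le> t \<Longrightarrow> c \<le> p (x \<oplus> of_real t \<odot> y) - t * p y" for x c
    using that unfolding tilt_def by (auto intro: cINF_greatest)
  show "sublinear (tilt p y)"
    unfolding sublinear_def
  proof (intro conjI ballI allI impI)
    fix x z assume x: "x \<in> carrier X" and z: "z \<in> carrier X"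
    have *: "tilt p y (x \<oplus> z) \<le> (p (x \<oplus> of_real s \<odot> y) - s * p y) + (p (z \<oplus> of_real t \<odot> y) - t * p y)"
      if "0 \<le> s" "0 \<le> t" for s t
    proof -
      have "x \<oplus> z \<oplus> of_real (s + t) \<odot> y = (x \<oplus> of_real s \<odot> y) \<oplus> (z \<oplus> of_real t \<odot> y)"
        using x y z by (simp add: add_smult M.a_ac)
      then have "p (x \<oplus> z \<oplus> of_real (s + t) \<odot> y) \<le> p (x \<oplus> of_real s \<odot> y) + p (z \<oplus> of_real t \<odot> y)"
        using sublinear_add[OF p] x y z by simp
      then show ?thesis
        using le[of "x \<oplus> z" "s + t"] that x z by (simp add: algebra_simps)
    qed
    have "tilt p y (x \<oplus> z) - tilt p y z \<le> tilt p y x"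
    proof (rule ge[OF x])
      fix s :: real assume s: "0 \<le> s"
      have "tilt p y (x \<oplus> z) - (p (x \<oplus> of_real s \<odot> y) - s * p y) \<le> tilt p y z"
        by (rule ge[OF z]) (use *[OF s] in \<open>simp add: algebra_simps\<close>)
      then show "tilt p y (x \<oplus> z) - tilt p y z \<le> p (x \<oplus> of_real s \<odot> y) - s * p y"
        by simp
    qed
    then show "tilt p y (x \<oplus> z) \<le> tilt p y x + tilt p y z" by simp
  next
    fix x and r :: real assume x: "x \<in> carrier X" and r: "0 \<le> r"
    have scale: "r * tilt p y x \<le> tilt p y (of_real r \<odot> x)" if x: "x \<in> carrier X" and r: "0 < r" for r x
    proof (rule ge)
      fix t :: real assume t: "0 \<le> t"
      have "of_real r \<odot> x \<oplus> of_real t \<odot> y = of_real r \<odot> (x \<oplus> of_real (t / r) \<odot> y)"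
        using x y r by (simp add: smult_add)
      then have "p (of_real r \<odot> x \<oplus> of_real t \<odot> y) = r * p (x \<oplus> of_real (t / r) \<odot> y)"
        using sublinear_smult[OF p, of "x \<oplus> of_real (t / r) \<odot> y" r] x y r by simp
      moreover have "tilt p y x \<le> p (x \<oplus> of_real (t / r) \<odot> y) - t / r * p y"
        using le[of x "t / r"] x r t by simp
      then have "r * tilt p y x \<le> r * (p (x \<oplus> of_real (t / r) \<odot> y) - t / r * p y)"
        using r by (intro mult_left_mono) auto
      then have "r * tilt p y x \<le> r * p (x \<oplus> of_real (t / r) \<odot> y) - t * p y"
        using r by (simp add: algebra_simps)
      ultimately show "r * tilt p y x \<le> p (of_real r \<odot> x \<oplus> of_real t \<odot> y) - t * p y"
        by simp
    qed (use x in auto)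
    show "tilt p y (of_real r \<odot> x) = r * tilt p y x"
    proof (cases "r = 0")
      case True
      have "tilt p y \<zero> \<le> 0"
        using le[of \<zero> 0] sublinear_zero[OF p] y by simp
      moreover have "0 \<le> tilt p y \<zero>"
        by (rule ge) (use sublinear_smult[OF p y] y in auto)
      ultimately show ?thesis using True x by simp
    next
      case False
      then have "0 < r" using r by simp
      then have "inverse r * tilt p y (of_real r \<odot> x) \<le> tilt p y x"
        using scale[of "of_real r \<odot> x" "inverse r"] x by (simp flip: of_real_mult)
      then have "tilt p y (of_real r \<odot> x) \<le> r * tilt p y x"
        using \<open>0 < r\<close> by (simp add: field_simps)
      with scale[OF x \<open>0 < r\<close>] show ?thesis by simp
    qed
  qed
qed

text \<open>The tilt at y is a smaller sublinear functional, hence q itself, and t = 1 in its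
  infimum gives the missing inequality q x + q y \<le> q (x + y).\<close>

lemma minimal_sublinear_additive:
  assumes q: "sublinear q" and 0: "\<And>x. x \<notin> carrier X \<Longrightarrow> q x = 0"
    and minimal: "\<And>r. sublinear r \<Longrightarrow> (\<And>x. x \<notin> carrier X \<Longrightarrow> r x = 0) \<Longrightarrow> r \<le> q \<Longrightarrow> r = q"
    and x: "x \<in> carrier X" and y: "y \<in> carrier X"
  shows "q (x \<oplus> y) = q x + q y"
proof -
  have "tilt q y \<le> q"
    unfolding le_fun_def
  proof
    fix z show "tilt q y z \<le> q z"
      using tilt_le[OF q y, of z 0] 0[of z] y by (cases "z \<in> carrier X") (auto simp: tilt_def)
  qed
  then have "tilt q y = q"
    using sublinear_tilt[OF q y] by (intro minimal) (auto simp: tilt_def)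
  then have "q x \<le> q (x \<oplus> y) - q y"
    using tilt_le[OF q y x, of 1] y by simp
  with sublinear_add[OF q x y] show ?thesis by simp
qed

text \<open>A minimal sublinear functional is linear since it coincides with its tilts; applying the
  tilt at \<open>y\<close> to \<open>p\<close> itself first forces the value at \<open>y\<close>.\<close>

lemma ex_linear_le_sublinear:
  assumes p: "sublinear p" and y: "y \<in> carrier X"
  obtains f where "\<And>x z. x \<in> carrier X \<Longrightarrow> z \<in> carrier X \<Longrightarrow> f (x \<oplus> z) = f x + f z"
    "\<And>x t. x \<in> carrier X \<Longrightarrow> f (of_real t \<odot> x) = t * f x"
    "\<And>x. x \<in> carrier X \<Longrightarrow> f x \<le> p x" "p y \<le> f y"
proof -
  let ?p = "tilt p y"
  define S where "S = {q. sublinear q \<and> (\<forall>x. x \<notin> carrier X \<longrightarrow> q x = 0) \<and> q \<le> ?p}"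
  \<comment> \<open>The order is reversed, so Zorn's lemma yields a minimal element and chains need
    lower bounds.\<close>
  have "\<exists>q\<in>S. \<forall>r\<in>S. r \<le> q \<longrightarrow> r = q"
  proof (rule predicate_Zorn)
    show "partial_order_on S (relation_of (\<lambda>q r. r \<le> q) S)"
      by (rule partial_order_on_relation_ofI) auto
    fix C assume C: "C \<in> Chains (relation_of (\<lambda>q r. r \<le> q) S)"
    then have CS: "C \<subseteq> S" and chain: "\<And>q r. q \<in> C \<Longrightarrow> r \<in> C \<Longrightarrow> q \<le> r \<or> r \<le> q"
      by (auto simp: Chains_def relation_of_def)
    have p_S: "?p \<in> S"
      using sublinear_tilt[OF p y] by (auto simp: S_def tilt_def)
    show "\<exists>u\<in>S. \<forall>q\<in>C. u \<le> q"
    proof (cases "C = {}")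
      case True
      with p_S show ?thesis by auto
    next
      case False
      define u where "u x = (INF q\<in>C. q x)" for x
      have bdd: "bdd_below ((\<lambda>q. q x) ` C)" for x
      proof (cases "x \<in> carrier X")
        case True
        have "- ?p (\<ominus> x) \<le> q x" if "q \<in> C" for q
        proof -
          have q: "sublinear q" "q (\<ominus> x) \<le> ?p (\<ominus> x)"
            using that CS by (auto simp: S_def le_fun_def)
          with sublinear_uminus[OF q(1) True] show ?thesis by simp
        qed
        then show ?thesis by (rule bdd_belowI2)
      next
        case x: False
        have "0 \<le> q x" if "q \<in> C" for q
          using that CS x by (force simp: S_def)
        then show ?thesis by (rule bdd_belowI2)
      qed
      have le: "u x \<le> q x" if "q \<in> C" for q x
        unfolding u_def using that bdd by (intro cINF_lower)
      have ge: "c \<le> u x" if "\<And>q. q \<in> C \<Longrightarrow> c \<le> q x" for c x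
        unfolding u_def using that False by (intro cINF_greatest)
      have sub: "sublinear q" if "q \<in> C" for q
        using that CS by (auto simp: S_def)
      have "sublinear u"
        unfolding sublinear_def
      proof (intro conjI ballI allI impI)
        fix x z assume x: "x \<in> carrier X" and z: "z \<in> carrier X"
        \<comment> \<open>q and r are comparable, and the smaller of the two, applied to x + z,
          stays below q x + r z.\<close>
        have *: "u (x \<oplus> z) \<le> q x + r z" if qr: "q \<in> C" "r \<in> C" for q r
        proof -
          have "u (x \<oplus> z) \<le> q (x \<oplus> z)" "u (x \<oplus> z) \<le> r (x \<oplus> z)" using le qr by auto
          moreover have "q (x \<oplus> z) \<le> q x + q z" "r (x \<oplus> z) \<le> r x + r z"
            using sublinear_add[OF sub] x z qr by auto
          moreover have "q z \<le> r z \<or> r x \<le> q x"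
            using chain[OF qr] by (auto simp: le_fun_def)
          ultimately show ?thesis by linarith
        qed
        have "u (x \<oplus> z) - u z \<le> u x"
        proof (rule ge)
          fix q assume q: "q \<in> C"
          have "u (x \<oplus> z) - q x \<le> u z"
            by (rule ge) (use *[OF q] in \<open>simp add: algebra_simps\<close>)
          then show "u (x \<oplus> z) - u z \<le> q x" by simp
        qed
        then show "u (x \<oplus> z) \<le> u x + u z" by simp
      next
        fix x and t :: real assume x: "x \<in> carrier X" and t: "0 \<le> t"
        have scale: "t * u x \<le> u (of_real t \<odot> x)" if "x \<in> carrier X" "0 \<le> t" for t x
        proof (rule ge)
          fix q assume "q \<in> C"
          then show "t * u x \<le> q (of_real t \<odot> x)"
            using le[of q x] sublinear_smult[OF sub, of q x t] that by (simp add: mult_left_mono)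
        qed
        show "u (of_real t \<odot> x) = t * u x"
        proof (cases "t = 0")
          case True
          obtain q where "q \<in> C" using False by blast
          then have "u \<zero> \<le> 0" using le[of q \<zero>] sublinear_zero[OF sub[of q]] by simp
          moreover have "0 \<le> u \<zero>"
            by (rule ge) (metis sublinear_zero[OF sub] order_refl)
          ultimately show ?thesis using True x by simp
        next
          case t0: False
          then have "0 < t" using t by simp
          then have "inverse t * u (of_real t \<odot> x) \<le> u x"
            using scale[of "of_real t \<odot> x" "inverse t"] x by (simp flip: of_real_mult)
          then have "u (of_real t \<odot> x) \<le> t * u x"
            using \<open>0 < t\<close> by (simp add: field_simps)
          with scale[OF x t] show ?thesis by simp
        qed
      qed
      moreover have "u x = 0" if "x \<notin> carrier X" for x
      proof -
        have "q x = 0" if "q \<in> C" for q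
          using that CS \<open>x \<notin> carrier X\<close> by (auto simp: S_def)
        then have "(INF q\<in>C. q x) = (INF q\<in>C. 0)" by (intro INF_cong) auto
        then show ?thesis using False by (simp add: u_def)
      qed
      moreover have "u \<le> ?p"
      proof -
        obtain q where "q \<in> C" using False by blast
        then have "u \<le> q" "q \<le> ?p" using le CS by (auto simp: le_fun_def S_def)
        then show ?thesis by (rule order_trans)
      qed
      ultimately have "u \<in> S" by (simp add: S_def)
      with le show ?thesis by (auto simp: le_fun_def)
    qed
  qed
  then obtain f where f: "sublinear f" "\<And>x. x \<notin> carrier X \<Longrightarrow> f x = 0" "f \<le> ?p"
    and minimal: "\<And>r. r \<in> S \<Longrightarrow> r \<le> f \<Longrightarrow> r = f"
    by (auto simp: S_def)
  have add: "f (x \<oplus> z) = f x + f z" if "x \<in> carrier X" "z \<in> carrier X" for x z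
    using f that by (intro minimal_sublinear_additive minimal) (auto simp: S_def)
  have neg: "f (\<ominus> x) = - f x" if "x \<in> carrier X" for x
    using add[of x "\<ominus> x"] sublinear_zero[OF f(1)] that by (simp add: M.r_neg)
  show ?thesis
  proof
    show "f (x \<oplus> z) = f x + f z" if "x \<in> carrier X" "z \<in> carrier X" for x z
      using add that .
    show "f (of_real t \<odot> x) = t * f x" if x: "x \<in> carrier X" for x t
    proof (cases "0 \<le> t")
      case False
      have "of_real t \<odot> x = \<ominus> (of_real (- t) \<odot> x)"
        using x by (simp add: uminus_conv_smult)
      then show ?thesis
        using neg[of "of_real (- t) \<odot> x"] sublinear_smult[OF f(1) x, of "- t"] x False by simp
    qed (use sublinear_smult[OF f(1) x] in simp)
    have le: "f x \<le> ?p x" for x using f(3) by (simp add: le_fun_def)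
    show "f x \<le> p x" if "x \<in> carrier X" for x
      using le[of x] tilt_le[OF p y that, of 0] that y by simp
    \<comment> \<open>This is why the minimisation starts below the tilt: f (-y) \<le> -p y forces f
      y up to p y.\<close>
    have "f (\<ominus> y) \<le> p (\<ominus> y \<oplus> y) - p y"
      using le[of "\<ominus> y"] tilt_le[OF p y, of "\<ominus> y" 1] y by simp
    then show "p y \<le> f y"
      using neg[OF y] sublinear_zero[OF p] y by (simp add: M.l_neg)
  qed
qed

section \<open>Absolutely convex sets and Minkowski functionals\<close>

lemma absolutely_convex_smult:
  assumes "absolutely_convex X A" "x \<in> A" "norm c \<le> 1"
  shows "c \<odot> x \<in> A"
proof -
  have "c \<odot> x \<oplus> 0 \<odot> x \<in> A"
    using assms unfolding absolutely_convex_def by (metis add.right_neutral norm_zero)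
  moreover have "x \<in> carrier X" using assms unfolding absolutely_convex_def by blast
  ultimately show ?thesis by simp
qed

lemma absolutely_convex_add:
  assumes "absolutely_convex X A" "x \<in> A" "y \<in> A" "norm a + norm b \<le> 1"
  shows "a \<odot> x \<oplus> b \<odot> y \<in> A"
  using assms unfolding absolutely_convex_def by blast

definition gauge_set :: "'v set \<Rightarrow> 'v \<Rightarrow> real set" where
  "gauge_set A x = {t. 0 < t \<and> of_real (inverse t) \<odot> x \<in> A}"

definition gauge_fun :: "'v set \<Rightarrow> 'v \<Rightarrow> real" where
  "gauge_fun A x = Inf (gauge_set A x)"

context
  fixes A
  assumes A: "absolutely_convex X A"
    and absorbing: "\<And>x. x \<in> carrier X \<Longrightarrow> \<exists>t>0. of_real t \<odot> x \<in> A"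
begin

lemma gauge_set_nonempty: "x \<in> carrier X \<Longrightarrow> gauge_set A x \<noteq> {}"
  using absorbing[of x] unfolding gauge_set_def
  by (metis (mono_tags, lifting) empty_Collect_eq inverse_inverse_eq inverse_positive_iff_positive)

lemma gauge_fun_le: "t \<in> gauge_set A x \<Longrightarrow> gauge_fun A x \<le> t"
  unfolding gauge_fun_def
  by (rule cInf_lower) (auto simp: gauge_set_def intro: bdd_belowI[of _ 0])

lemma gauge_fun_nonneg: "x \<in> carrier X \<Longrightarrow> 0 \<le> gauge_fun A x"
  unfolding gauge_fun_def
  by (rule cInf_greatest[OF gauge_set_nonempty]) (auto simp: gauge_set_def)

text \<open>The admissible t form an up-set because A is balanced; the infimum itself need not be
  admissible, hence the strict inequality.\<close>

lemma gauge_fun_less: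
  assumes "x \<in> carrier X" "gauge_fun A x < t"
  shows "t \<in> gauge_set A x"
proof -
  obtain s where s: "s \<in> gauge_set A x" "s < t"
    using cInf_lessD[OF gauge_set_nonempty] assms unfolding gauge_fun_def by blast
  then have "0 < s" by (simp add: gauge_set_def)
  have "norm (of_real (s / t) :: 'k) \<le> 1"
    unfolding norm_of_real using s(2) \<open>0 < s\<close> by simp
  then have "of_real (s / t) \<odot> (of_real (inverse s) \<odot> x) \<in> A"
    by (rule absolutely_convex_smult[OF A, rotated]) (use s(1) in \<open>simp add: gauge_set_def\<close>)
  then show ?thesis
    using s(2) \<open>0 < s\<close> assms(1) by (simp add: gauge_set_def inverse_eq_divide)
qed

lemma sublinear_gauge_fun: "sublinear (gauge_fun A)"
  unfolding sublinear_def
proof (intro conjI ballI allI impI)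
  fix x y assume x: "x \<in> carrier X" and y: "y \<in> carrier X"
  show "gauge_fun A (x \<oplus> y) \<le> gauge_fun A x + gauge_fun A y"
  proof (rule field_le_epsilon)
    fix e :: real assume "0 < e"
    define s t where "s = gauge_fun A x + e / 2" and "t = gauge_fun A y + e / 2"
    have s: "s \<in> gauge_set A x" "0 < s" and t: "t \<in> gauge_set A y" "0 < t"
      using gauge_fun_less[OF x, of s] gauge_fun_less[OF y, of t] \<open>0 < e\<close>
      by (auto simp: s_def t_def gauge_set_def)
    \<comment> \<open>(x + y)/(s + t) is the convex combination of x/s and y/t with weights s/(s +
      t) and t/(s + t).\<close>
    have "of_real (s / (s + t)) \<odot> (of_real (inverse s) \<odot> x) \<oplus>
        of_real (t / (s + t)) \<odot> (of_real (inverse t) \<odot> y) \<in> A"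
    proof (rule absolutely_convex_add[OF A])
      show "norm (of_real (s / (s + t)) :: 'k) + norm (of_real (t / (s + t)) :: 'k) \<le> 1"
        unfolding norm_of_real using s(2) t(2) by (simp flip: add_divide_distrib)
    qed (use s t in \<open>auto simp: gauge_set_def\<close>)
    also have "of_real (s / (s + t)) \<odot> (of_real (inverse s) \<odot> x) \<oplus>
        of_real (t / (s + t)) \<odot> (of_real (inverse t) \<odot> y) = of_real (inverse (s + t)) \<odot> (x \<oplus> y)"
      using x y s(2) t(2) by (simp add: smult_add inverse_eq_divide)
    finally have "s + t \<in> gauge_set A (x \<oplus> y)"
      using s(2) t(2) by (simp add: gauge_set_def)
    then have "gauge_fun A (x \<oplus> y) \<le> s + t" by (rule gauge_fun_le)
    then show "gauge_fun A (x \<oplus> y) \<le> gauge_fun A x + gauge_fun A y + e"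
      by (simp add: s_def t_def)
  qed
next
  fix x and r :: real assume x: "x \<in> carrier X" and "0 \<le> r"
  have le: "gauge_fun A (of_real r \<odot> x) \<le> r * gauge_fun A x" if x: "x \<in> carrier X" and "0 < r" for x r
  proof (rule field_le_epsilon)
    fix e :: real assume "0 < e"
    define s where "s = gauge_fun A x + e / r"
    have s: "s \<in> gauge_set A x"
      using gauge_fun_less[OF x, of s] \<open>0 < e\<close> \<open>0 < r\<close> by (simp add: s_def)
    have "of_real (inverse (r * s)) * of_real r = (of_real (inverse s) :: 'k)"
      using \<open>0 < r\<close> by simp
    then have "of_real (inverse (r * s)) \<odot> (of_real r \<odot> x) = of_real (inverse s) \<odot> x"
      using x by (simp only: smult_smult)
    with s have "r * s \<in> gauge_set A (of_real r \<odot> x)"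
      using \<open>0 < r\<close> by (simp add: gauge_set_def del: of_real_inverse of_real_mult smult_smult)
    then have "gauge_fun A (of_real r \<odot> x) \<le> r * s" by (rule gauge_fun_le)
    then show "gauge_fun A (of_real r \<odot> x) \<le> r * gauge_fun A x + e"
      using \<open>0 < r\<close> by (simp add: s_def distrib_left)
  qed
  show "gauge_fun A (of_real r \<odot> x) = r * gauge_fun A x"
  proof (cases "r = 0")
    case True
    obtain t :: real where "of_real t \<odot> x \<in> A" using absorbing[OF x] by blast
    then have "0 \<odot> (of_real t \<odot> x) \<in> A" by (rule absolutely_convex_smult[OF A]) simp
    then have "\<zero> \<in> A" using x by simp
    then have "gauge_fun A \<zero> \<le> e" if "0 < e" for e
      using gauge_fun_le[of e \<zero>] that by (simp add: gauge_set_def)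
    then have "gauge_fun A \<zero> \<le> 0" by (meson field_le_epsilon add_0 le_cases linorder_not_le dense)
    with gauge_fun_nonneg[of \<zero>] True x show ?thesis by simp
  next
    case False
    then have "0 < r" using \<open>0 \<le> r\<close> by simp
    then have "gauge_fun A x \<le> inverse r * gauge_fun A (of_real r \<odot> x)"
      using le[of "of_real r \<odot> x" "inverse r"] x by (simp flip: of_real_mult)
    then have "r * gauge_fun A x \<le> gauge_fun A (of_real r \<odot> x)"
      using \<open>0 < r\<close> by (simp add: field_simps)
    with le[OF x \<open>0 < r\<close>] show ?thesis by simp
  qed
qed

end

lemma linear_functional_of_real_linear:
  assumes add: "\<And>x z. x \<in> carrier X \<Longrightarrow> z \<in> carrier X \<Longrightarrow> f (x \<oplus> z) = f x + f z"
    and scale: "\<And>x t. x \<in> carrier X \<Longrightarrow> f (of_real t \<odot> x) = t * f x"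
  obtains F where "linear_functional X F" "\<And>x. x \<in> carrier X \<Longrightarrow> re_part (F x) = f x"
proof (cases rule: re_part_cases[where 'k='k])
  case real
  define F where "F x = (if x \<in> carrier X then of_real (f x) else 0 :: 'k)" for x
  have smult: "F (c \<odot> x) = c * F x" if "x \<in> carrier X" for c x
  proof -
    have "f (of_real (re_part c) \<odot> x) = re_part c * f x"
      by (rule scale[OF that])
    then have "of_real (f (c \<odot> x)) = of_real (re_part c) * (of_real (f x) :: 'k)"
      using real[of c] by simp
    then show ?thesis using real[of c] that by (simp add: F_def)
  qed
  show ?thesis
    by (rule that[of F]) (use smult in \<open>auto simp: linear_functional_def functions_on_def F_def add\<close>)
next
  case (complex i)
  \<comment> \<open>F x = f x - i f(i x), the only linear functional with real part f.\<close>
  define F where "F x = (if x \<in> carrier X then of_real (f x) + of_real (- f (i \<odot> x)) * i else 0)" for x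
  have "F (c \<odot> x) = c * F x" if x: "x \<in> carrier X" for c x
  proof -
    obtain a b where c: "c = of_real a + of_real b * i" using complex(3)[of c] by blast
    have "c \<odot> x = of_real a \<odot> x \<oplus> of_real b \<odot> (i \<odot> x)"
      using x by (simp add: c add_smult)
    then have 1: "f (c \<odot> x) = a * f x + b * f (i \<odot> x)"
      using x by (simp only: add scale smult_mem)
    have ii: "i * (i * y) = - y" for y
      by (metis complex(1) mult.assoc mult_minus1)
    have "i \<odot> (c \<odot> x) = (i * c) \<odot> x"
      using x by simp
    also have "i * c = of_real a * i + of_real (- b)"
      by (simp add: c ii algebra_simps)
    also have "\<dots> \<odot> x = of_real a \<odot> (i \<odot> x) \<oplus> of_real (- b) \<odot> x"
      using x by (simp add: add_smult[symmetric])
    finally have 2: "f (i \<odot> (c \<odot> x)) = a * f (i \<odot> x) + (- b) * f x"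
      using x by (simp only: add scale smult_mem)
    have "of_real (a * f x + b * f (i \<odot> x)) + of_real (- (a * f (i \<odot> x) + (- b) * f x)) * i
        = c * (of_real (f x) + of_real (- f (i \<odot> x)) * i)"
      by (simp add: c ii algebra_simps)
    then show ?thesis
      unfolding F_def using x 1 2 by simp
  qed
  moreover have "F (x \<oplus> z) = F x + F z" if "x \<in> carrier X" "z \<in> carrier X" for x z
    using that by (simp add: F_def add smult_add algebra_simps)
  ultimately have "linear_functional X F"
    by (auto simp: linear_functional_def functions_on_def F_def)
  moreover have "re_part (F x) = f x" if "x \<in> carrier X" for x
    unfolding F_def using that by (simp only: if_True complex(2))
  ultimately show ?thesis by (rule that)
qed

text \<open>The gauge of A is at most 1 on A and at least 1 at y, and a real linear functional below
  the gauge that attains it at y is the real part of F. The gauge at y may be exactly 1, hence two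
  weak inequalities.\<close>

theorem hahn_banach:
  assumes A: "absolutely_convex X A"
    and absorbing: "\<And>x. x \<in> carrier X \<Longrightarrow> \<exists>t>0. of_real t \<odot> x \<in> A"
    and y: "y \<in> carrier X" "y \<notin> A"
  obtains F where "linear_functional X F" "\<And>x. x \<in> A \<Longrightarrow> norm (F x) \<le> 1" "1 \<le> norm (F y)"
proof -
  note gauge = A absorbing
  obtain f where f: "\<And>x z. x \<in> carrier X \<Longrightarrow> z \<in> carrier X \<Longrightarrow> f (x \<oplus> z) = f x + f z"
    "\<And>x t. x \<in> carrier X \<Longrightarrow> f (of_real t \<odot> x) = t * f x"
    and le: "\<And>x. x \<in> carrier X \<Longrightarrow> f x \<le> gauge_fun A x" and ge: "gauge_fun A y \<le> f y"
    using ex_linear_le_sublinear[OF sublinear_gauge_fun[OF gauge] y(1)] by blast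
  obtain F where F: "linear_functional X F" and re: "\<And>x. x \<in> carrier X \<Longrightarrow> re_part (F x) = f x"
    using linear_functional_of_real_linear[OF f] by blast
  show ?thesis
  proof
    show "linear_functional X F" by fact
    show "norm (F x) \<le> 1" if x: "x \<in> A" for x
    proof -
      \<comment> \<open>Rotating x inside the balanced set A turns the bound on the real part into a
        bound on the norm.\<close>
      obtain w where w: "norm w = 1" "w * F x = of_real (norm (F x))" by (rule ex_rotation)
      have xX: "x \<in> carrier X" using x A unfolding absolutely_convex_def by blast
      then have "F (w \<odot> x) = of_real (norm (F x))"
        using F w(2) by (simp add: linear_functional_def)
      then have "norm (F x) = f (w \<odot> x)"
        using re[of "w \<odot> x"] xX by simp
      also have "\<dots> \<le> gauge_fun A (w \<odot> x)" using le xX by simp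
      also have "\<dots> \<le> 1"
        using absolutely_convex_smult[OF A x, of w] w(1) xX
        by (intro gauge_fun_le[OF gauge]) (auto simp: gauge_set_def)
      finally show ?thesis .
    qed
    have "1 \<le> gauge_fun A y"
    proof (rule ccontr)
      assume "\<not> ?thesis"
      then have "1 \<in> gauge_set A y"
        using gauge_fun_less[OF gauge y(1), of 1] by simp
      then show False using y by (simp add: gauge_set_def)
    qed
    also have "\<dots> \<le> re_part (F y)" using ge re y(1) by simp
    also have "\<dots> \<le> norm (F y)" by (rule re_part_le_norm)
    finally show "1 \<le> norm (F y)" .
  qed
qed

end

section \<open>Sums of absolutely convex sets and functionals vanishing on a subspace\<close>

context scalar_module
begin

lemma absolutely_convex_subset: "absolutely_convex X A \<Longrightarrow> A \<subseteq> carrier X"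
  by (simp add: absolutely_convex_def)

lemma absolutely_convex_zero:
  assumes "absolutely_convex X A" "A \<noteq> {}"
  shows "\<zero> \<in> A"
proof -
  obtain x where x: "x \<in> A" using assms(2) by blast
  then have "0 \<odot> x \<in> A" by (intro absolutely_convex_smult[OF assms(1)]) auto
  moreover have "x \<in> carrier X" using absolutely_convex_subset[OF assms(1)] x by blast
  ultimately show ?thesis by simp
qed

lemma absolutely_convex_scale:
  assumes "absolutely_convex X A" "x \<in> carrier X" "of_real t \<odot> x \<in> A" "0 \<le> s" "s \<le> t" "0 < t"
  shows "of_real s \<odot> x \<in> A"
proof -
  have "norm (of_real (s / t) :: 'k) \<le> 1"
    unfolding norm_of_real using assms(4-6) by simp
  with assms(1,3) have "of_real (s / t) \<odot> (of_real t \<odot> x) \<in> A"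
    by (rule absolutely_convex_smult)
  moreover have "of_real (s / t) * of_real t = (of_real s :: 'k)"
    using assms(6) by simp
  ultimately show ?thesis using assms(2) by (simp only: smult_smult)
qed

definition set_sum :: "'v set \<Rightarrow> 'v set \<Rightarrow> 'v set" where
  "set_sum A B = {x \<oplus> y |x y. x \<in> A \<and> y \<in> B}"

lemma absolutely_convex_set_sum:
  assumes A: "absolutely_convex X A" and B: "absolutely_convex X B"
  shows "absolutely_convex X (set_sum A B)"
  unfolding absolutely_convex_def
proof (intro conjI ballI allI impI)
  have AX: "A \<subseteq> carrier X" and BX: "B \<subseteq> carrier X"
    using A B by (auto dest: absolutely_convex_subset)
  then show "set_sum A B \<subseteq> carrier X" by (auto simp: set_sum_def)
  fix v w and a b :: 'k assume v: "v \<in> set_sum A B" and w: "w \<in> set_sum A B"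
    and ab: "norm a + norm b \<le> 1"
  obtain x y where x: "x \<in> A" "y \<in> B" "v = x \<oplus> y" using v by (auto simp: set_sum_def)
  obtain x' y' where x': "x' \<in> A" "y' \<in> B" "w = x' \<oplus> y'" using w by (auto simp: set_sum_def)
  have "a \<odot> v \<oplus> b \<odot> w = (a \<odot> x \<oplus> b \<odot> x') \<oplus> (a \<odot> y \<oplus> b \<odot> y')"
    using x x' AX BX by (simp add: smult_add M.a_ac subset_iff)
  then show "a \<odot> v \<oplus> b \<odot> w \<in> set_sum A B"
    using absolutely_convex_add[OF A x(1) x'(1) ab] absolutely_convex_add[OF B x(2) x'(2) ab]
    by (auto simp: set_sum_def)
qed

lemma set_sum_left: "A \<subseteq> carrier X \<Longrightarrow> \<zero> \<in> B \<Longrightarrow> A \<subseteq> set_sum A B"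
  unfolding set_sum_def by (smt (verit) M.r_zero mem_Collect_eq subset_iff)

lemma set_sum_right: "B \<subseteq> carrier X \<Longrightarrow> \<zero> \<in> A \<Longrightarrow> B \<subseteq> set_sum A B"
  unfolding set_sum_def by (smt (verit) M.l_zero mem_Collect_eq subset_iff)

lemma linear_functional_add:
  "linear_functional X u \<Longrightarrow> x \<in> carrier X \<Longrightarrow> y \<in> carrier X \<Longrightarrow> u (x \<oplus> y) = u x + u y"
  by (simp add: linear_functional_def)

lemma linear_functional_smult:
  "linear_functional X u \<Longrightarrow> x \<in> carrier X \<Longrightarrow> u (c \<odot> x) = c * u x"
  by (simp add: linear_functional_def)

lemma linear_functional_diff:
  "linear_functional X u \<Longrightarrow> x \<in> carrier X \<Longrightarrow> y \<in> carrier X \<Longrightarrow> u (x \<ominus> y) = u x - u y"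
  by (simp add: minus_eq_add_smult linear_functional_add linear_functional_smult)

lemma linear_functional_zero: "linear_functional X u \<Longrightarrow> u \<zero> = 0"
  using linear_functional_smult[of u \<zero> 0] by simp

text \<open>Hahn-Banach for the absolutely convex set D + A; a functional that is bounded on a
  subspace vanishes there. With A a basic 0-neighbourhood this becomes the density criterion of the
  uniqueness proof.\<close>

lemma hahn_banach_subspace:
  assumes D: "D \<subseteq> carrier X" "\<zero> \<in> D" "\<And>x y. x \<in> D \<Longrightarrow> y \<in> D \<Longrightarrow> x \<oplus> y \<in> D"
      "\<And>c x. x \<in> D \<Longrightarrow> c \<odot> x \<in> D"
    and A: "absolutely_convex X A"
    and absorbing: "\<And>x. x \<in> carrier X \<Longrightarrow> \<exists>t>0. of_real t \<odot> x \<in> A"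
    and y: "y \<in> carrier X" "y \<notin> set_sum D A"
  obtains F where "linear_functional X F" "\<And>x. x \<in> A \<Longrightarrow> norm (F x) \<le> 1"
    "\<And>x. x \<in> D \<Longrightarrow> F x = 0" "1 \<le> norm (F y)"
proof -
  have AX: "A \<subseteq> carrier X" by (rule absolutely_convex_subset[OF A])
  have "\<zero> \<in> A" using absolutely_convex_zero[OF A] absorbing[of \<zero>] by blast
  have "absolutely_convex X D" using D by (auto simp: absolutely_convex_def)
  then have sum: "absolutely_convex X (set_sum D A)"
    using A by (rule absolutely_convex_set_sum)
  have abs: "\<exists>t>0. of_real t \<odot> x \<in> set_sum D A" if "x \<in> carrier X" for x
    using absorbing[OF that] set_sum_right[OF AX D(2)] by blast
  obtain F where F: "linear_functional X F" "\<And>x. x \<in> set_sum D A \<Longrightarrow> norm (F x) \<le> 1" "1 \<le> norm (F y)"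
    using hahn_banach[OF sum abs y] by blast
  show ?thesis
  proof
    show "linear_functional X F" "1 \<le> norm (F y)" by fact+
    show "norm (F x) \<le> 1" if "x \<in> A" for x
      using F(2) that set_sum_right[OF AX D(2)] by blast
    show "F x = 0" if x: "x \<in> D" for x
    proof (rule ccontr)
      assume "F x \<noteq> 0"
      define c where "c = 2 / F x"
      have "c \<odot> x \<in> set_sum D A"
        using D(4)[OF x] set_sum_left[OF D(1) \<open>\<zero> \<in> A\<close>] by blast
      then have "norm (F (c \<odot> x)) \<le> 1" by (rule F(2))
      moreover have "F (c \<odot> x) = 2"
        using linear_functional_smult[OF F(1), of x c] x D(1) \<open>F x \<noteq> 0\<close> by (auto simp: c_def)
      ultimately show False by simp
    qed
  qed
qed

end


section \<open>Neighbourhoods, bounded sets and continuous functionals\<close>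

sublocale lc_hausdorff \<subseteq> scalar_module X ..

lemma zero_nbhdI:
  "openin (topol X) G \<Longrightarrow> \<zero>\<^bsub>X\<^esub> \<in> G \<Longrightarrow> G \<subseteq> U \<Longrightarrow> U \<subseteq> carrier X \<Longrightarrow> zero_nbhd X U"
  unfolding zero_nbhd_def by blast

lemma zero_nbhd_mono: "zero_nbhd X U \<Longrightarrow> U \<subseteq> W \<Longrightarrow> W \<subseteq> carrier X \<Longrightarrow> zero_nbhd X W"
  unfolding zero_nbhd_def by blast

lemma zero_nbhd_zero: "zero_nbhd X U \<Longrightarrow> \<zero>\<^bsub>X\<^esub> \<in> U"
  unfolding zero_nbhd_def by blast

lemma zero_nbhd_subset: "zero_nbhd X U \<Longrightarrow> U \<subseteq> carrier X"
  unfolding zero_nbhd_def by blast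

context lc_hausdorff
begin

lemma continuous_map_translation:
  assumes "x \<in> carrier X"
  shows "continuous_map (topol X) (topol X) (\<lambda>y. x \<oplus> y)"
proof -
  have "continuous_map (topol X) (prod_topology (topol X) (topol X)) (\<lambda>y. (x, y))"
    using assms by (simp add: continuous_map_pairedI topspace_topol)
  from continuous_map_compose[OF this continuous_add] show ?thesis by (simp add: o_def)
qed

lemma continuous_map_smult_left: "continuous_map (topol X) (topol X) (\<lambda>x. c \<odot> x)"
proof -
  have "continuous_map (topol X) (prod_topology euclidean (topol X)) (\<lambda>x. (c, x))"
    by (simp add: continuous_map_pairedI)
  from continuous_map_compose[OF this continuous_smult] show ?thesis by (simp add: o_def)
qed

lemma continuous_map_smult_right:
  assumes "x \<in> carrier X"
  shows "continuous_map euclidean (topol X) (\<lambda>c. c \<odot> x)"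
proof -
  have "continuous_map euclidean (prod_topology euclidean (topol X)) (\<lambda>c. (c, x))"
    using assms by (simp add: continuous_map_pairedI topspace_topol)
  from continuous_map_compose[OF this continuous_smult] show ?thesis by (simp add: o_def)
qed

text \<open>Translations by x and by -x are continuous, so the topology is determined by its
  0-neighbourhoods. This allows isomorphisms to be tested at 0.\<close>

lemma openin_iff:
  "openin (topol X) G \<longleftrightarrow> G \<subseteq> carrier X \<and> (\<forall>x\<in>G. \<exists>U. zero_nbhd X U \<and> (\<forall>u\<in>U. x \<oplus> u \<in> G))"
proof (intro iffI conjI ballI)
  assume G: "openin (topol X) G"
  then show GX: "G \<subseteq> carrier X" using openin_subset topspace_topol by metis
  fix x assume x: "x \<in> G"
  let ?U = "{u \<in> topspace (topol X). x \<oplus> u \<in> G}"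
  have "openin (topol X) ?U"
    using x GX by (intro openin_continuous_map_preimage[OF continuous_map_translation G]) auto
  moreover have "\<zero> \<in> ?U" using x GX by (auto simp: topspace_topol)
  ultimately have "zero_nbhd X ?U"
    by (rule zero_nbhdI) (auto simp: topspace_topol)
  then show "\<exists>U. zero_nbhd X U \<and> (\<forall>u\<in>U. x \<oplus> u \<in> G)" by blast
next
  assume *: "G \<subseteq> carrier X \<and> (\<forall>x\<in>G. \<exists>U. zero_nbhd X U \<and> (\<forall>u\<in>U. x \<oplus> u \<in> G))"
  show "openin (topol X) G"
    unfolding openin_subopen[of _ G]
  proof
    fix x assume x: "x \<in> G"
    then have xX: "x \<in> carrier X" using * by blast
    obtain U P where U: "\<forall>u\<in>U. x \<oplus> u \<in> G" and P: "openin (topol X) P" "\<zero> \<in> P" "P \<subseteq> U"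
      using * x unfolding zero_nbhd_def by meson
    let ?T = "{y \<in> topspace (topol X). \<ominus> x \<oplus> y \<in> P}"
    have "openin (topol X) ?T"
      using xX by (intro openin_continuous_map_preimage[OF continuous_map_translation P(1)]) auto
    moreover have "x \<in> ?T" using xX P(2) by (simp add: topspace_topol M.l_neg)
    moreover have "?T \<subseteq> G"
    proof
      fix y assume y: "y \<in> ?T"
      then have "x \<oplus> (\<ominus> x \<oplus> y) \<in> G" using U P(3) by auto
      then show "y \<in> G" using y xX by (simp add: topspace_topol M.r_neg2)
    qed
    ultimately show "\<exists>T. openin (topol X) T \<and> x \<in> T \<and> T \<subseteq> G" by blast
  qed
qed

lemma zero_nbhd_scale:
  assumes "zero_nbhd X U"
  shows "zero_nbhd X {x \<in> carrier X. c \<odot> x \<in> U}"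
proof -
  obtain G where G: "openin (topol X) G" "\<zero> \<in> G" "G \<subseteq> U" using assms by (auto simp: zero_nbhd_def)
  have "openin (topol X) {x \<in> topspace (topol X). c \<odot> x \<in> G}"
    by (rule openin_continuous_map_preimage[OF continuous_map_smult_left G(1)])
  then show ?thesis
    by (rule zero_nbhdI) (use G(2,3) in \<open>auto simp: topspace_topol\<close>)
qed

lemma zero_nbhd_absorbing:
  assumes U: "zero_nbhd X U" and x: "x \<in> carrier X"
  shows "\<exists>t>0. of_real t \<odot> x \<in> U"
proof -
  obtain G where G: "openin (topol X) G" "\<zero> \<in> G" "G \<subseteq> U" using U by (auto simp: zero_nbhd_def)
  have "openin euclidean {c \<in> topspace euclidean. c \<odot> x \<in> G}"
    by (rule openin_continuous_map_preimage[OF continuous_map_smult_right[OF x] G(1)])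
  then have "open {c. c \<odot> x \<in> G}" by simp
  moreover have "0 \<in> {c. c \<odot> x \<in> G}" using G(2) x by simp
  ultimately obtain e where e: "0 < e" "ball 0 e \<subseteq> {c. c \<odot> x \<in> G}"
    by (meson open_contains_ball)
  then have "of_real (e / 2) \<in> ball (0 :: 'k) e"
    unfolding mem_ball dist_norm diff_0 norm_minus_cancel norm_of_real by simp
  then have "of_real (e / 2) \<odot> x \<in> U" using e(2) G(3) by blast
  moreover have "0 < e / 2" using e(1) by simp
  ultimately show ?thesis by blast
qed

text \<open>\<open>absorbs\<close> quantifies over all scalars of large norm. For an absolutely
  convex U one positive real factor t suffices: x/c = (1/(c t)) (t x), and |1/(c t)| \<le> 1 once
  |c| \<ge> 1/t.\<close>

lemma absorbs_iff:
  assumes U: "absolutely_convex X U" and B: "B \<subseteq> carrier X"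
  shows "absorbs X U B \<longleftrightarrow> (\<exists>t>0. \<forall>x\<in>B. of_real t \<odot> x \<in> U)"
proof
  assume "absorbs X U B"
  then obtain r where r: "0 < r" and *: "\<And>c. r \<le> norm c \<Longrightarrow> B \<subseteq> (\<lambda>x. c \<odot> x) ` U"
    unfolding absorbs_def by blast
  have "B \<subseteq> (\<lambda>x. of_real r \<odot> x) ` U" by (rule *) (use r in simp)
  moreover have "of_real (inverse r) \<odot> (of_real r \<odot> u) = u" if "u \<in> U" for u
  proof -
    have "of_real (inverse r) * of_real r = (1 :: 'k)" using r by simp
    moreover have "u \<in> carrier X" using that absolutely_convex_subset[OF U] by blast
    ultimately show ?thesis by (simp only: smult_smult one_smult)
  qed
  ultimately have "\<forall>x\<in>B. of_real (inverse r) \<odot> x \<in> U" by auto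
  with r show "\<exists>t>0. \<forall>x\<in>B. of_real t \<odot> x \<in> U"
    by (metis inverse_positive_iff_positive)
next
  assume "\<exists>t>0. \<forall>x\<in>B. of_real t \<odot> x \<in> U"
  then obtain t where t: "0 < t" "\<And>x. x \<in> B \<Longrightarrow> of_real t \<odot> x \<in> U" by blast
  show "absorbs X U B"
    unfolding absorbs_def
  proof (intro exI conjI allI impI subsetI)
    show "0 < inverse t" using t by simp
    fix c :: 'k and x assume c: "inverse t \<le> norm c" and x: "x \<in> B"
    have xX: "x \<in> carrier X" using x B by blast
    have "0 < norm c" using c t(1) by (meson inverse_positive_iff_positive less_le_trans)
    then have c0: "c \<noteq> 0" by simp
    have "norm (inverse c * of_real (inverse t)) \<le> 1"
      unfolding norm_mult norm_inverse norm_of_real using c \<open>0 < norm c\<close> t(1)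
      by (simp add: field_simps)
    then have "(inverse c * of_real (inverse t)) \<odot> (of_real t \<odot> x) \<in> U"
      by (rule absolutely_convex_smult[OF U t(2)[OF x]])
    moreover have "inverse c * of_real (inverse t) * of_real t = inverse c"
      using t(1) by simp
    ultimately have "inverse c \<odot> x \<in> U" using xX by (simp only: smult_smult)
    moreover have "x = c \<odot> (inverse c \<odot> x)" using c0 xX by simp
    ultimately show "x \<in> (\<lambda>x. c \<odot> x) ` U" by blast
  qed
qed

lemma bounded_in_iff:
  "bounded_in X B \<longleftrightarrow> B \<subseteq> carrier X \<and>
     (\<forall>U. zero_nbhd X U \<and> absolutely_convex X U \<longrightarrow> (\<exists>t>0. \<forall>x\<in>B. of_real t \<odot> x \<in> U))"
proof (intro iffI conjI allI impI)
  assume B: "bounded_in X B"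
  then show "B \<subseteq> carrier X" by (simp add: bounded_in_def)
  then show "\<exists>t>0. \<forall>x\<in>B. of_real t \<odot> x \<in> U" if "zero_nbhd X U \<and> absolutely_convex X U" for U
    using absorbs_iff that B unfolding bounded_in_def by blast
next
  assume *: "B \<subseteq> carrier X \<and>
     (\<forall>U. zero_nbhd X U \<and> absolutely_convex X U \<longrightarrow> (\<exists>t>0. \<forall>x\<in>B. of_real t \<odot> x \<in> U))"
  show "bounded_in X B"
    unfolding bounded_in_def
  proof (intro conjI allI impI)
    show "B \<subseteq> carrier X" using * by blast
    fix U assume "zero_nbhd X U"
    then obtain W where W: "zero_nbhd X W" "absolutely_convex X W" "W \<subseteq> U"
      using locally_convex by blast
    with * have "absorbs X W B" using absorbs_iff by blast
    then show "absorbs X U B" using W(3) unfolding absorbs_def by blast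
  qed
qed

lemma bounded_in_subset: "bounded_in X B \<Longrightarrow> B \<subseteq> carrier X"
  by (simp add: bounded_in_def)

lemma bounded_in_empty [simp]: "bounded_in X {}"
  unfolding bounded_in_iff by (auto intro: exI[of _ 1])

lemma bounded_in_singleton: "x \<in> carrier X \<Longrightarrow> bounded_in X {x}"
  unfolding bounded_in_iff using zero_nbhd_absorbing by auto

lemma bounded_in_Un:
  assumes A: "bounded_in X A" and B: "bounded_in X B"
  shows "bounded_in X (A \<union> B)"
  unfolding bounded_in_iff
proof (intro conjI allI impI)
  show AB: "A \<union> B \<subseteq> carrier X" using A B by (simp add: bounded_in_def)
  fix U assume U: "zero_nbhd X U \<and> absolutely_convex X U"
  obtain s where s: "0 < s" "\<forall>x\<in>A. of_real s \<odot> x \<in> U"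
    using A U unfolding bounded_in_iff by blast
  obtain t where t: "0 < t" "\<forall>x\<in>B. of_real t \<odot> x \<in> U"
    using B U unfolding bounded_in_iff by blast
  have "of_real (min s t) \<odot> x \<in> U" if "x \<in> A \<union> B" for x
    using that AB s t U by (auto intro: absolutely_convex_scale)
  then show "\<exists>r>0. \<forall>x\<in>A \<union> B. of_real r \<odot> x \<in> U"
    using s(1) t(1) by (intro exI[of _ "min s t"]) auto
qed

lemma dualI_bounded:
  assumes u: "linear_functional X u" and W: "zero_nbhd X W" "\<And>x. x \<in> W \<Longrightarrow> norm (u x) \<le> 1"
  shows "u \<in> dual X"
proof -
  have "continuous_map (topol X) euclidean u"
    unfolding continuous_map_def
  proof (intro conjI allI impI)
    fix G :: "'k set" assume "openin euclidean G"
    then have G: "open G" by simp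
    show "openin (topol X) {x \<in> topspace (topol X). u x \<in> G}"
      unfolding openin_iff
    proof (intro conjI ballI)
      fix x assume "x \<in> {x \<in> topspace (topol X). u x \<in> G}"
      then have x: "x \<in> carrier X" "u x \<in> G" by (auto simp: topspace_topol)
      then obtain e where e: "0 < e" "ball (u x) e \<subseteq> G" using G open_contains_ball by metis
      \<comment> \<open>The factor 2 / e gives |u y| \<le> e/2, which is strictly below e.\<close>
      let ?U = "{y \<in> carrier X. of_real (2 / e) \<odot> y \<in> W}"
      have "x \<oplus> y \<in> {x \<in> topspace (topol X). u x \<in> G}" if "y \<in> ?U" for y
      proof -
        have "norm (of_real (2 / e) * u y) \<le> 1"
          using that W(2)[of "of_real (2 / e) \<odot> y"] linear_functional_smult[OF u, of y] by auto
        then have "2 / e * norm (u y) \<le> 1"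
          unfolding norm_mult norm_of_real using e(1) by simp
        then have "norm (u y) < e" using e(1) by (simp add: field_simps)
        then have "u (x \<oplus> y) \<in> ball (u x) e"
          using that x by (simp add: linear_functional_add[OF u] dist_norm)
        then show ?thesis using that x e(2) by (auto simp: topspace_topol)
      qed
      moreover have "zero_nbhd X ?U" by (rule zero_nbhd_scale[OF W(1)])
      ultimately show "\<exists>U. zero_nbhd X U \<and> (\<forall>y\<in>U. x \<oplus> y \<in> {x \<in> topspace (topol X). u x \<in> G})"
        by blast
    qed (auto simp: topspace_topol)
  qed auto
  with u show ?thesis by (simp add: dual_def)
qed

lemma zero_nbhd_dual:
  assumes "u \<in> dual X" "0 < e"
  shows "zero_nbhd X {x \<in> carrier X. norm (u x) < e}"
proof -
  have "openin (topol X) {x \<in> topspace (topol X). u x \<in> ball 0 e}"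
    using assms by (intro openin_continuous_map_preimage[of _ euclidean]) (auto simp: dual_def)
  then show ?thesis
    by (rule zero_nbhdI)
      (use assms linear_functional_zero[of u] in \<open>auto simp: dual_def topspace_topol\<close>)
qed

lemma hahn_banach_nbhd:
  assumes W: "zero_nbhd X W" "absolutely_convex X W" and y: "y \<in> carrier X" "y \<notin> W"
  obtains F where "F \<in> dual X" "\<And>x. x \<in> W \<Longrightarrow> norm (F x) \<le> 1" "1 \<le> norm (F y)"
  using hahn_banach[OF W(2) zero_nbhd_absorbing[OF W(1)] y] dualI_bounded[OF _ W(1)] by metis

lemma dual_separates:
  assumes y: "y \<in> carrier X" "y \<noteq> \<zero>"
  obtains F where "F \<in> dual X" "F y \<noteq> 0"
proof -
  obtain G where G: "openin (topol X) G" "\<zero> \<in> G" "y \<notin> G"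
    using Hausdorff y unfolding Hausdorff_space_def topspace_topol
    by (metis M.zero_closed disjnt_iff)
  then have "zero_nbhd X G"
    using openin_subset[OF G(1)] by (auto intro: zero_nbhdI simp: topspace_topol)
  then obtain W where W: "zero_nbhd X W" "absolutely_convex X W" "W \<subseteq> G"
    using locally_convex by blast
  with G(3) have "y \<notin> W" by blast
  from hahn_banach_nbhd[OF W(1,2) y(1) this] that show ?thesis
    by (metis norm_zero not_one_le_zero)
qed

text \<open>Choose W with y + W disjoint from A. Since -W = W, the thickened set A + W still misses
  y, and it is an absolutely convex 0-neighbourhood. The use is for \<tau>', in which the
  neighbourhoods from (CNC) are closed.\<close>

lemma hahn_banach_closed:
  assumes A: "absolutely_convex X A" "closedin (topol X) A" "A \<noteq> {}"
    and y: "y \<in> carrier X" "y \<notin> A"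
  obtains F where "F \<in> dual X" "\<And>x. x \<in> A \<Longrightarrow> norm (F x) \<le> 1" "1 \<le> norm (F y)"
proof -
  have AX: "A \<subseteq> carrier X" by (rule absolutely_convex_subset[OF A(1)])
  have "openin (topol X) (carrier X - A)"
    using A(2) by (simp add: closedin_def topspace_topol)
  then obtain U where U: "zero_nbhd X U" "\<And>u. u \<in> U \<Longrightarrow> y \<oplus> u \<notin> A"
    using y unfolding openin_iff by blast
  obtain W where W: "zero_nbhd X W" "absolutely_convex X W" "W \<subseteq> U"
    using locally_convex[OF U(1)] by blast
  have WX: "W \<subseteq> carrier X" by (rule zero_nbhd_subset[OF W(1)])
  have "y \<notin> set_sum A W"
  proof
    assume "y \<in> set_sum A W"
    then obtain a w where a: "a \<in> A" and w: "w \<in> W" and y_eq: "y = a \<oplus> w"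
      by (auto simp: set_sum_def)
    have "(- 1) \<odot> w \<in> W" by (rule absolutely_convex_smult[OF W(2) w]) simp
    then have "y \<oplus> (- 1) \<odot> w \<notin> A" using U(2) W(3) by blast
    moreover have "y \<oplus> (- 1) \<odot> w = a"
    proof -
      have "a \<in> carrier X" "w \<in> carrier X" using a w AX WX by auto
      then show ?thesis
        by (simp add: y_eq M.a_assoc M.r_neg flip: uminus_conv_smult)
    qed
    ultimately show False using a by simp
  qed
  moreover have "zero_nbhd X (set_sum A W)"
    using W(1) set_sum_right[OF WX absolutely_convex_zero[OF A(1,3)]]
      absolutely_convex_subset[OF absolutely_convex_set_sum[OF A(1) W(2)]]
    by (rule zero_nbhd_mono)
  ultimately obtain F where "F \<in> dual X" "\<And>x. x \<in> set_sum A W \<Longrightarrow> norm (F x) \<le> 1" "1 \<le> norm (F y)"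
    using hahn_banach_nbhd absolutely_convex_set_sum[OF A(1) W(2)] y(1) by metis
  with that set_sum_left[OF AX zero_nbhd_zero[OF W(1)]] show ?thesis by blast
qed

end


section \<open>Uniform convergence on a directed family of sets\<close>

lemma function_space_simps [simp]:
  "carrier (function_space H T) = H" "topol (function_space H T) = T"
  "\<zero>\<^bsub>function_space H T\<^esub> = (\<lambda>_. 0)" "f \<oplus>\<^bsub>function_space H T\<^esub> g = (\<lambda>x. f x + g x)"
  "c \<odot>\<^bsub>function_space H T\<^esub> f = (\<lambda>x. c * f x)"
  by (simp_all add: function_space_def)

lemma openin_uniform_topology:
  "openin (uniform_topology H \<S>) G \<longleftrightarrow> G \<subseteq> H \<and>
     (\<forall>u\<in>G. \<exists>\<F> e. finite \<F> \<and> \<F> \<subseteq> \<S> \<and> 0 < e \<and>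
        (\<forall>v\<in>H. (\<forall>x\<in>\<Union>\<F>. norm (v x - u x) < e) \<longrightarrow> v \<in> G))"
  unfolding uniform_topology_def by (subst topology_inverse'[OF istopology_uniform]) simp

text \<open>With finite unions available, a basic neighbourhood of \<open>uniform_topology\<close>
  is given by a single set; \<open>{}\<close> accounts for the empty finite family.\<close>

definition directed_family :: "'v set set \<Rightarrow> bool" where
  "directed_family \<S> \<longleftrightarrow> {} \<in> \<S> \<and> (\<forall>A\<in>\<S>. \<forall>B\<in>\<S>. A \<union> B \<in> \<S>)"

lemma directed_family_Union:
  assumes "directed_family \<S>" "finite \<F>" "\<F> \<subseteq> \<S>"
  shows "\<Union>\<F> \<in> \<S>"
  using assms(2,3) by (induction \<F> rule: finite_induct) (use assms(1) in \<open>auto simp: directed_family_def\<close>)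

lemma (in lc_hausdorff) directed_family_bounded: "directed_family {B. bounded_in X B}"
  by (simp add: directed_family_def bounded_in_Un)

lemma openin_uniform_directed:
  assumes "directed_family \<S>"
  shows "openin (uniform_topology H \<S>) G \<longleftrightarrow> G \<subseteq> H \<and>
     (\<forall>u\<in>G. \<exists>B\<in>\<S>. \<exists>e>0. \<forall>v\<in>H. (\<forall>x\<in>B. norm (v x - u x) < e) \<longrightarrow> v \<in> G)"
proof -
  have "(\<exists>\<F> e. finite \<F> \<and> \<F> \<subseteq> \<S> \<and> 0 < e \<and> (\<forall>v\<in>H. (\<forall>x\<in>\<Union>\<F>. norm (v x - u x) < e) \<longrightarrow> v \<in> G))
     \<longleftrightarrow> (\<exists>B\<in>\<S>. \<exists>e>0. \<forall>v\<in>H. (\<forall>x\<in>B. norm (v x - u x) < e) \<longrightarrow> v \<in> G)" (is "?l \<longleftrightarrow> ?r") for u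
  proof
    assume ?l
    then show ?r using directed_family_Union[OF assms] by blast
  next
    assume ?r
    then obtain B e where "B \<in> \<S>" "0 < e" "\<forall>v\<in>H. (\<forall>x\<in>B. norm (v x - u x) < e) \<longrightarrow> v \<in> G" by blast
    then show ?l by (intro exI[of _ "{B}"] exI[of _ e]) simp
  qed
  then show ?thesis unfolding openin_uniform_topology by simp
qed

lemma topspace_uniform_directed:
  assumes "directed_family \<S>"
  shows "topspace (uniform_topology H \<S>) = H"
proof (rule subset_antisym)
  have "{} \<in> \<S>" using assms by (simp add: directed_family_def)
  then have "openin (uniform_topology H \<S>) H"
    unfolding openin_uniform_directed[OF assms] by (auto intro!: bexI[of _ "{}"] exI[of _ 1])
  then show "H \<subseteq> topspace (uniform_topology H \<S>)" by (rule openin_subset)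
  have "openin (uniform_topology H \<S>) (topspace (uniform_topology H \<S>))" by simp
  then show "topspace (uniform_topology H \<S>) \<subseteq> H"
    unfolding openin_uniform_directed[OF assms] by blast
qed

lemma uniform_ball_interior:
  assumes dir: "directed_family \<S>" and B: "B \<in> \<S>" and u: "u \<in> H" and "0 < e"
  obtains G where "openin (uniform_topology H \<S>) G" "u \<in> G"
    "\<And>v x. v \<in> G \<Longrightarrow> x \<in> B \<Longrightarrow> norm (v x - u x) < e"
proof
  \<comment> \<open>The set where |w x - u x| < e on B need not be open, because the differences may
    approach e over an infinite B. A uniform bound s < e leaves room for a perturbation.\<close>
  let ?G = "{w \<in> H. \<exists>s<e. \<forall>x\<in>B. norm (w x - u x) \<le> s}"
  show "openin (uniform_topology H \<S>) ?G"
    unfolding openin_uniform_directed[OF dir]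
  proof (intro conjI ballI)
    fix w assume "w \<in> ?G"
    then obtain s where s: "s < e" "\<forall>x\<in>B. norm (w x - u x) \<le> s" by blast
    have "v \<in> ?G" if v: "v \<in> H" "\<forall>x\<in>B. norm (v x - w x) < (e - s) / 2" for v
    proof -
      have "norm (v x - u x) \<le> (e + s) / 2" if "x \<in> B" for x
      proof -
        have "norm (v x - u x) \<le> norm (v x - w x) + norm (w x - u x)"
          using norm_triangle_ineq[of "v x - w x" "w x - u x"] by simp
        moreover have "norm (v x - w x) < (e - s) / 2" "norm (w x - u x) \<le> s"
          using v(2) s(2) that by auto
        ultimately show ?thesis by (simp add: field_simps)
      qed
      moreover have "(e + s) / 2 < e" using s(1) by simp
      ultimately show ?thesis using v(1) by blast
    qed
    moreover have "0 < (e - s) / 2" using s(1) by simp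
    ultimately show "\<exists>B\<in>\<S>. \<exists>d>0. \<forall>v\<in>H. (\<forall>x\<in>B. norm (v x - w x) < d) \<longrightarrow> v \<in> ?G"
      using B by blast
  qed blast
  show "u \<in> ?G" using u \<open>0 < e\<close> by auto
  show "norm (v x - u x) < e" if "v \<in> ?G" "x \<in> B" for v x
    using that by (auto intro: le_less_trans)
qed

lemma linear_map_function_space:
  "linear_map X (function_space H T) \<phi> \<longleftrightarrow> \<phi> \<in> carrier X \<rightarrow> H \<and>
     (\<forall>x\<in>carrier X. \<forall>y\<in>carrier X. \<forall>b. \<phi> (x \<oplus>\<^bsub>X\<^esub> y) b = \<phi> x b + \<phi> y b) \<and>
     (\<forall>c. \<forall>x\<in>carrier X. \<forall>b. \<phi> (c \<odot>\<^bsub>X\<^esub> x) b = c * \<phi> x b)"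
  by (simp add: linear_map_def fun_eq_iff)

text \<open>Translation moves both descriptions of openness to 0. Isomorphisms onto strong duals and
  onto E can thus be treated without first showing that these are locally convex spaces.\<close>

lemma (in lc_hausdorff) topological_isomorphism_uniform_iff:
  assumes dir: "directed_family \<S>"
  shows "topological_isomorphism X (function_space H (uniform_topology H \<S>)) \<phi> \<longleftrightarrow>
     linear_map X (function_space H (uniform_topology H \<S>)) \<phi> \<and> bij_betw \<phi> (carrier X) H \<and>
     (\<forall>U. U \<subseteq> carrier X \<longrightarrow>
        (zero_nbhd X U \<longleftrightarrow> (\<exists>B\<in>\<S>. \<exists>e>0. {x \<in> carrier X. \<forall>b\<in>B. norm (\<phi> x b) < e} \<subseteq> U)))"
    (is "_ \<longleftrightarrow> ?lin \<and> ?bij \<and> ?nbhd")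
proof (intro iffI conjI; (elim conjE)?)
  let ?T = "uniform_topology H \<S>"
  assume iso: "topological_isomorphism X (function_space H ?T) \<phi>"
  then show lin: ?lin by (simp add: topological_isomorphism_def)
  have hom: "homeomorphic_map (topol X) ?T \<phi>"
    using iso by (simp add: topological_isomorphism_def)
  have inj: "inj_on \<phi> (carrier X)" and cont: "continuous_map (topol X) ?T \<phi>"
    and op: "open_map (topol X) ?T \<phi>" and img: "\<phi> ` carrier X = H"
    using hom by (auto simp: homeomorphic_eq_everything_map topspace_topol topspace_uniform_directed[OF dir])
  show ?bij using inj img by (simp add: bij_betw_def)
  have \<phi>0: "\<phi> \<zero> b = 0" for b
  proof -
    have "\<phi> (0 \<odot> \<zero>) b = 0 * \<phi> \<zero> b"
      using lin unfolding linear_map_function_space by blast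
    then show ?thesis by simp
  qed
  show ?nbhd
  proof (intro allI impI iffI)
    fix U assume "zero_nbhd X U"
    then obtain G where G: "openin (topol X) G" "\<zero> \<in> G" "G \<subseteq> U" by (auto simp: zero_nbhd_def)
    have GX: "G \<subseteq> carrier X" using openin_subset[OF G(1)] by (simp add: topspace_topol)
    have "openin ?T (\<phi> ` G)" using op G(1) by (simp add: open_map_def)
    then obtain B e where B: "B \<in> \<S>" "0 < e"
      and *: "\<forall>v\<in>H. (\<forall>x\<in>B. norm (v x - \<phi> \<zero> x) < e) \<longrightarrow> v \<in> \<phi> ` G"
      unfolding openin_uniform_directed[OF dir] using G(2) by blast
    have "x \<in> U" if x: "x \<in> carrier X" "\<forall>b\<in>B. norm (\<phi> x b) < e" for x
    proof -
      have "\<phi> x \<in> H" using img x(1) by blast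
      then have "\<phi> x \<in> \<phi> ` G" using * x(2) by (simp add: \<phi>0)
      then show "x \<in> U" using inj x(1) GX G(3) by (auto dest: inj_onD)
    qed
    then have "{x \<in> carrier X. \<forall>b\<in>B. norm (\<phi> x b) < e} \<subseteq> U" by blast
    with B show "\<exists>B\<in>\<S>. \<exists>e>0. {x \<in> carrier X. \<forall>b\<in>B. norm (\<phi> x b) < e} \<subseteq> U" by blast
  next
    fix U assume U: "U \<subseteq> carrier X"
      and "\<exists>B\<in>\<S>. \<exists>e>0. {x \<in> carrier X. \<forall>b\<in>B. norm (\<phi> x b) < e} \<subseteq> U"
    then obtain B e where B: "B \<in> \<S>" "0 < e" "{x \<in> carrier X. \<forall>b\<in>B. norm (\<phi> x b) < e} \<subseteq> U" by blast
    have "\<phi> \<zero> \<in> H" using img by blast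
    then obtain G where G: "openin ?T G" "\<phi> \<zero> \<in> G"
        "\<And>v x. v \<in> G \<Longrightarrow> x \<in> B \<Longrightarrow> norm (v x - \<phi> \<zero> x) < e"
      using uniform_ball_interior[OF dir B(1) _ B(2)] by blast
    have "openin (topol X) {x \<in> topspace (topol X). \<phi> x \<in> G}"
      by (rule openin_continuous_map_preimage[OF cont G(1)])
    moreover have "{x \<in> topspace (topol X). \<phi> x \<in> G} \<subseteq> U"
    proof
      fix x assume "x \<in> {x \<in> topspace (topol X). \<phi> x \<in> G}"
      then have "x \<in> carrier X" "\<forall>b\<in>B. norm (\<phi> x b) < e"
        using G(3)[of "\<phi> x"] by (auto simp: topspace_topol \<phi>0)
      then show "x \<in> U" using B(3) by blast
    qed
    ultimately show "zero_nbhd X U"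
      using U G(2) by (intro zero_nbhdI) (auto simp: topspace_topol)
  qed
next
  let ?T = "uniform_topology H \<S>"
  assume lin: ?lin and bij: ?bij and nbhd: ?nbhd
  have add: "\<phi> (x \<oplus> y) b = \<phi> x b + \<phi> y b" if "x \<in> carrier X" "y \<in> carrier X" for x y b
    using lin that unfolding linear_map_function_space by blast
  have minus: "\<phi> (x \<ominus> y) b = \<phi> x b - \<phi> y b" if "x \<in> carrier X" "y \<in> carrier X" for x y b
  proof -
    have "\<phi> ((- 1) \<odot> y) b = - \<phi> y b"
      using lin that(2) unfolding linear_map_function_space by simp
    then show ?thesis using that add by (simp add: minus_eq_add_smult)
  qed
  have open_iff: "openin (topol X) G \<longleftrightarrow> openin ?T (\<phi> ` G)" if G: "G \<subseteq> carrier X" for G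
  proof -
    have eq: "(\<exists>U. zero_nbhd X U \<and> (\<forall>u\<in>U. x \<oplus> u \<in> G)) \<longleftrightarrow>
        (\<exists>B\<in>\<S>. \<exists>e>0. \<forall>v\<in>H. (\<forall>b\<in>B. norm (v b - \<phi> x b) < e) \<longrightarrow> v \<in> \<phi> ` G)"
      (is "?l \<longleftrightarrow> ?r") if "x \<in> G" for x
    proof
      have x: "x \<in> carrier X" using that G by blast
      {
        assume ?l
        then obtain U where U: "zero_nbhd X U" "\<forall>u\<in>U. x \<oplus> u \<in> G" by blast
        then obtain B e where B: "B \<in> \<S>" "0 < e" "{x \<in> carrier X. \<forall>b\<in>B. norm (\<phi> x b) < e} \<subseteq> U"
          using nbhd zero_nbhd_subset[OF U(1)] by blast
        have "v \<in> \<phi> ` G" if v: "v \<in> H" "\<forall>b\<in>B. norm (v b - \<phi> x b) < e" for v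
        proof -
          obtain y where y: "y \<in> carrier X" "v = \<phi> y" using bij v(1) by (auto simp: bij_betw_def)
          have "y \<ominus> x \<in> U" using B(3) v(2) x y minus by auto
          then have "x \<oplus> (y \<ominus> x) \<in> G" using U(2) by blast
          then show ?thesis using x y by simp
        qed
        with B(1,2) show ?r by blast
      next
        assume ?r
        then obtain B e where B: "B \<in> \<S>" "0 < e"
          and *: "\<forall>v\<in>H. (\<forall>b\<in>B. norm (v b - \<phi> x b) < e) \<longrightarrow> v \<in> \<phi> ` G" by blast
        let ?U = "{y \<in> carrier X. \<forall>b\<in>B. norm (\<phi> y b) < e}"
        have "x \<oplus> y \<in> G" if y: "y \<in> ?U" for y
        proof -
          have "\<phi> (x \<oplus> y) \<in> \<phi> ` G"
            using * x y bij add by (auto simp: bij_betw_def)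
          then show ?thesis
            using bij x y G by (auto simp: bij_betw_def dest!: inj_onD)
        qed
        moreover have "zero_nbhd X ?U"
        proof (rule nbhd[rule_format, THEN iffD2])
          show "\<exists>A\<in>\<S>. \<exists>d>0. {x \<in> carrier X. \<forall>b\<in>A. norm (\<phi> x b) < d} \<subseteq> ?U"
            using B(1,2) by (intro bexI[of _ B] exI[of _ e]) auto
        qed blast
        ultimately show ?l by blast
      }
    qed
    have "\<phi> ` G \<subseteq> H" using G bij by (auto simp: bij_betw_def)
    then show ?thesis
      unfolding openin_iff openin_uniform_directed[OF dir] using eq G by simp
  qed
  have "homeomorphic_map (topol X) ?T \<phi>"
    unfolding homeomorphic_map_def quotient_map_def topspace_topol topspace_uniform_directed[OF dir]
  proof (intro conjI allI impI)
    show "\<phi> ` carrier X = H" "inj_on \<phi> (carrier X)" using bij by (auto simp: bij_betw_def)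
    fix U assume U: "U \<subseteq> H"
    then have "\<phi> ` {x \<in> carrier X. \<phi> x \<in> U} = U" using bij by (auto simp: bij_betw_def)
    then show "openin (topol X) {x \<in> carrier X. \<phi> x \<in> U} = openin ?T U"
      using open_iff[of "{x \<in> carrier X. \<phi> x \<in> U}"] by auto
  qed
  with lin show "topological_isomorphism X (function_space H ?T) \<phi>"
    by (simp add: topological_isomorphism_def)
qed

section \<open>Isomorphisms\<close>

lemma topological_isomorphism_compose:
  assumes f: "topological_isomorphism X Y f" and g: "topological_isomorphism Y Z g"
  shows "topological_isomorphism X Z (g \<circ> f)"
  using assms homeomorphic_map_compose[of "topol X" "topol Y" f "topol Z" g]
  by (auto simp: topological_isomorphism_def linear_map_def Pi_iff)

text \<open>Asks only that the topologies live on the carriers, since it is applied with E as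
  domain, which is available only as a \<open>scalar_module\<close>.\<close>

lemma (in scalar_module) topological_isomorphism_inverse:
  assumes f: "topological_isomorphism X Y f"
    and X: "topspace (topol X) = carrier X" and Y: "topspace (topol Y) = carrier Y"
  obtains g where "topological_isomorphism Y X g"
    "\<And>x. x \<in> carrier X \<Longrightarrow> g (f x) = x" "\<And>y. y \<in> carrier Y \<Longrightarrow> f (g y) = y"
proof -
  have lin: "linear_map X Y f" and "homeomorphic_map (topol X) (topol Y) f"
    using f by (simp_all add: topological_isomorphism_def)
  then obtain g where g: "homeomorphic_maps (topol X) (topol Y) f g"
    unfolding homeomorphic_map_maps by blast
  then have gf: "g (f x) = x" if "x \<in> carrier X" for x
    using that by (simp add: homeomorphic_maps_def X)
  have fg: "f (g y) = y" if "y \<in> carrier Y" for y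
    using g that Y by (simp add: homeomorphic_maps_def)
  have gX: "g y \<in> carrier X" if "y \<in> carrier Y" for y
    using g that Y by (auto simp: homeomorphic_maps_def continuous_map_def X)
  have "homeomorphic_map (topol Y) (topol X) g"
    using g by (meson homeomorphic_map_maps homeomorphic_maps_sym)
  moreover have "linear_map Y X g"
    unfolding linear_map_def
  proof (intro conjI ballI allI)
    show "g \<in> carrier Y \<rightarrow> carrier X" using gX by blast
    fix y assume y: "y \<in> carrier Y"
    show "g (y \<oplus>\<^bsub>Y\<^esub> z) = g y \<oplus> g z" if z: "z \<in> carrier Y" for z
    proof -
      have "f (g y \<oplus> g z) = y \<oplus>\<^bsub>Y\<^esub> z" using lin gX y z fg by (simp add: linear_map_def)
      then show ?thesis using gf[of "g y \<oplus> g z"] gX y z by simp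
    qed
    show "g (c \<odot>\<^bsub>Y\<^esub> y) = c \<odot> g y" for c
    proof -
      have "f (c \<odot> g y) = c \<odot>\<^bsub>Y\<^esub> y" using lin gX y fg by (simp add: linear_map_def)
      then show ?thesis using gf[of "c \<odot> g y"] gX y by simp
    qed
  qed
  ultimately show ?thesis
    using that[of g] gf fg by (simp add: topological_isomorphism_def)
qed


section \<open>Representing functionals by points of a compact set\<close>

lemma scalar_module_function_space:
  fixes H :: "('v \<Rightarrow> 'k::real_or_complex) set"
  assumes zero: "(\<lambda>_. 0) \<in> H" and add: "\<And>u v. u \<in> H \<Longrightarrow> v \<in> H \<Longrightarrow> (\<lambda>x. u x + v x) \<in> H"
    and smult: "\<And>c u. u \<in> H \<Longrightarrow> (\<lambda>x. c * u x) \<in> H"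
  shows "scalar_module (function_space H T)"
proof -
  have "abelian_group (function_space H T)"
  proof (rule abelian_groupI)
    fix u assume "u \<in> carrier (function_space H T)"
    then have "(\<lambda>x. - 1 * u x) \<in> H" by (intro smult) simp
    then show "\<exists>v\<in>carrier (function_space H T). v \<oplus>\<^bsub>function_space H T\<^esub> u = \<zero>\<^bsub>function_space H T\<^esub>"
      by (intro bexI[of _ "\<lambda>x. - 1 * u x"]) simp_all
  qed (use zero add in \<open>simp_all add: add_ac\<close>)
  then have "module scalars (function_space H T)"
    by (intro moduleI cring_scalars) (use smult in \<open>simp_all add: algebra_simps\<close>)
  then show ?thesis by (simp add: scalar_module_def)
qed

lemma function_space_sum:
  assumes zero: "(\<lambda>_. 0) \<in> H" and add: "\<And>u v. u \<in> H \<Longrightarrow> v \<in> H \<Longrightarrow> (\<lambda>x. u x + v x) \<in> H"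
    and smult: "\<And>c u. u \<in> H \<Longrightarrow> (\<lambda>x. c * u x) \<in> H"
    and \<Phi>: "linear_functional (function_space H T) \<Phi>"
    and F: "finite F" "F \<subseteq> H"
  shows "(\<lambda>x. \<Sum>u\<in>F. c u * u x) \<in> H \<and> \<Phi> (\<lambda>x. \<Sum>u\<in>F. c u * u x) = (\<Sum>u\<in>F. c u * \<Phi> u)"
  using F
proof (induction F rule: finite_induct)
  case empty
  have "\<Phi> (\<lambda>x. c * u x) = c * \<Phi> u" if "u \<in> H" for c u
    using \<Phi> that by (simp add: linear_functional_def)
  from this[OF zero, of 0] show ?case using zero by simp
next
  case (insert v F)
  then have v: "(\<lambda>x. c v * v x) \<in> H" and F: "(\<lambda>x. \<Sum>u\<in>F. c u * u x) \<in> H"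
    using smult by auto
  have "\<Phi> (\<lambda>x. c v * v x + (\<Sum>u\<in>F. c u * u x)) = \<Phi> (\<lambda>x. c v * v x) + \<Phi> (\<lambda>x. \<Sum>u\<in>F. c u * u x)"
    using \<Phi> v F by (simp add: linear_functional_def)
  also have "\<Phi> (\<lambda>x. c v * v x) = c v * \<Phi> v"
    using \<Phi> insert.prems by (simp add: linear_functional_def)
  finally show ?case
    using insert add[OF v F] by simp
qed

text \<open>Let t tend to 0. The range stops at 1 because t will be the weight of a convex
  combination.\<close>

lemma nonpos_of_le_mult:
  fixes a b :: real
  assumes "\<And>t. 0 < t \<Longrightarrow> t \<le> 1 \<Longrightarrow> a \<le> t * b" "0 \<le> b"
  shows "a \<le> 0"
proof (rule ccontr)
  assume "\<not> ?thesis"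
  then have a: "0 < a" by simp
  define t where "t = min 1 (a / (2 * (b + 1)))"
  have "0 < t" "t \<le> 1" using a assms(2) by (auto simp: t_def)
  then have "a \<le> t * b" by (rule assms(1))
  also have "\<dots> \<le> a / (2 * (b + 1)) * b"
    using assms(2) by (intro mult_right_mono) (auto simp: t_def)
  also have "\<dots> < a" using a assms(2) by (simp add: field_simps add_nonneg_pos)
  finally show False by simp
qed

context scalar_module
begin

text \<open>By compactness it suffices to interpolate \<open>\<Phi>\<close> on finitely many \<open>u\<close>. A point of \<open>K\<close> minimising
  \<open>\<Sum>u. \<bar>\<Phi> u - u x\<bar>\<^sup>2\<close> does: otherwise the first order condition at the minimiser yields a combination
  of these \<open>u\<close> on which \<open>\<Phi>\<close> exceeds the supremum over \<open>K\<close>.\<close>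

lemma compact_representation:
  fixes H :: "('v \<Rightarrow> 'k) set"
  assumes K: "absolutely_convex X K" "K \<noteq> {}" "compactin T K"
    and zero: "(\<lambda>_. 0) \<in> H" and add: "\<And>u v. u \<in> H \<Longrightarrow> v \<in> H \<Longrightarrow> (\<lambda>x. u x + v x) \<in> H"
    and smult: "\<And>c u. u \<in> H \<Longrightarrow> (\<lambda>x. c * u x) \<in> H"
    and lin: "\<And>u. u \<in> H \<Longrightarrow> linear_functional X u"
    and cont: "\<And>u. u \<in> H \<Longrightarrow> continuous_map (subtopology T K) euclidean u"
    and \<Phi>: "linear_functional (function_space H T') \<Phi>"
    and bound: "\<And>u. u \<in> H \<Longrightarrow> (\<And>x. x \<in> K \<Longrightarrow> norm (u x) \<le> 1) \<Longrightarrow> norm (\<Phi> u) \<le> 1"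
  obtains k where "k \<in> K" "\<And>u. u \<in> H \<Longrightarrow> \<Phi> u = u k"
proof -
  let ?T = "subtopology T K"
  have KX: "K \<subseteq> carrier X" by (rule absolutely_convex_subset[OF K(1)])
  have topK: "topspace ?T = K" using compactin_subset_topspace[OF K(3)] by auto
  have compact: "compact_space ?T" using K(3) by (simp add: compactin_subspace)
  have finite_case: "\<exists>x\<in>K. \<forall>u\<in>F. \<Phi> u = u x" if F: "finite F" "F \<subseteq> H" for F
  proof -
    define g where "g x = (\<Sum>u\<in>F. (norm (\<Phi> u - u x))\<^sup>2)" for x
    have "continuous_map ?T euclidean g"
      unfolding g_def
    proof (rule continuous_map_sum[OF F(1)])
      fix u assume "u \<in> F"
      then have "continuous_map ?T euclidean u" using F(2) cont by blast
      moreover have "continuous_map euclidean euclidean (\<lambda>z. (norm (\<Phi> u - z))\<^sup>2)"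
        by (auto intro!: continuous_intros)
      ultimately show "continuous_map ?T euclidean (\<lambda>x. (norm (\<Phi> u - u x))\<^sup>2)"
        using continuous_map_compose[of ?T euclidean u euclidean "\<lambda>z. (norm (\<Phi> u - z))\<^sup>2"]
        by (simp add: o_def)
    qed
    then have "compactin euclidean (g ` K)"
      by (intro image_compactin[of ?T]) (simp_all add: compactin_subtopology K(3))
    then have "compact (g ` K)" by simp
    then have "\<exists>s\<in>g ` K. \<forall>t\<in>g ` K. s \<le> t"
      by (rule compact_attains_inf) (use K(2) in simp)
    then obtain x where x: "x \<in> K" and min: "\<And>y. y \<in> K \<Longrightarrow> g x \<le> g y"
      by blast
    \<comment> \<open>Up to the factor -2, the derivative of g at x in direction y - x is Re (w y -
      w x). So the minimiser x of g maximises Re w over K.\<close>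
    define w where "w = (\<lambda>y. \<Sum>u\<in>F. conjugate (\<Phi> u - u x) * u y)"
    have wH: "w \<in> H" and \<Phi>w: "\<Phi> w = (\<Sum>u\<in>F. conjugate (\<Phi> u - u x) * \<Phi> u)"
      unfolding w_def
      using function_space_sum[OF zero add smult \<Phi> F, of "\<lambda>u. conjugate (\<Phi> u - u x)"] by blast+
    have le: "re_part (w y) \<le> re_part (w x)" if y: "y \<in> K" for y
    proof -
      \<comment> \<open>The coefficient of t^2 in g along the segment from x to y.\<close>
      define b where "b = (\<Sum>u\<in>F. (norm (u x - u y))\<^sup>2)"
      have "2 * (re_part (w y) - re_part (w x)) \<le> t * b" if t: "0 < t" "t \<le> 1" for t
      proof -
        define z where "z = of_real (1 - t) \<odot> x \<oplus> of_real t \<odot> y"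
        have zK: "z \<in> K"
          unfolding z_def
        proof (rule absolutely_convex_add[OF K(1) x y])
          show "norm (of_real (1 - t) :: 'k) + norm (of_real t :: 'k) \<le> 1"
            unfolding norm_of_real using t by simp
        qed
        have uz: "\<Phi> u - u z = (\<Phi> u - u x) + of_real t * (u x - u y)" if "u \<in> F" for u
        proof -
          have "linear_functional X u" using lin F(2) that by blast
          then have "u z = of_real (1 - t) * u x + of_real t * u y"
            unfolding z_def using KX x y by (simp add: linear_functional_add linear_functional_smult subset_iff)
          then show ?thesis by (simp add: algebra_simps)
        qed
        have "(norm (\<Phi> u - u z))\<^sup>2 = (norm (\<Phi> u - u x))\<^sup>2
            + 2 * t * (re_part (conjugate (\<Phi> u - u x) * u x) - re_part (conjugate (\<Phi> u - u x) * u y))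
            + t\<^sup>2 * (norm (u x - u y))\<^sup>2" if "u \<in> F" for u
        proof -
          let ?c = "conjugate (\<Phi> u - u x)"
          have "re_part (?c * (of_real t * (u x - u y))) = re_part (of_real t * (?c * u x - ?c * u y))"
            by (simp add: algebra_simps)
          also have "\<dots> = t * (re_part (?c * u x) - re_part (?c * u y))"
            by (simp only: re_part_of_real_mult re_part_diff)
          finally show ?thesis
            unfolding uz[OF that] norm_add_square by (simp add: norm_mult power_mult_distrib)
        qed
        then have "g z = g x + 2 * t * (re_part (w x) - re_part (w y)) + t\<^sup>2 * b"
          unfolding g_def b_def w_def
          by (simp add: re_part_sum sum.distrib sum_subtractf flip: sum_distrib_left)
        moreover have "g x \<le> g z" using min zK by blast
        ultimately have "t * (2 * (re_part (w y) - re_part (w x))) \<le> t * (t * b)"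
          by (simp add: algebra_simps power2_eq_square)
        then show ?thesis using t(1) by simp
      qed
      moreover have "0 \<le> b" unfolding b_def by (simp add: sum_nonneg)
      ultimately have "2 * (re_part (w y) - re_part (w x)) \<le> 0"
        by (rule nonpos_of_le_mult)
      then show ?thesis by simp
    qed
    have w_le: "norm (w y) \<le> re_part (w x)" if y: "y \<in> K" for y
    proof -
      obtain c where c: "norm c = 1" "c * w y = of_real (norm (w y))" by (rule ex_rotation)
      have "c \<odot> y \<in> K" by (rule absolutely_convex_smult[OF K(1) y]) (simp add: c)
      moreover have "w (c \<odot> y) = of_real (norm (w y))"
        using linear_functional_smult[OF lin[OF wH], of y c] KX y c(2) by auto
      ultimately show ?thesis using le by (metis re_part_of_real)
    qed
    have "norm (\<Phi> w) \<le> re_part (w x)"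
    proof (rule field_le_epsilon)
      fix e :: real assume "0 < e"
      \<comment> \<open>Adding e keeps s positive even if w vanishes on K, so that w / s can be
        inserted into the bound on \<Phi>.\<close>
      define s where "s = re_part (w x) + e"
      have s: "0 < s" using w_le[OF x] \<open>0 < e\<close> unfolding s_def by (smt (verit) norm_ge_zero)
      have "norm (\<Phi> (\<lambda>y. of_real (1 / s) * w y)) \<le> 1"
      proof (rule bound[OF smult[OF wH]])
        fix y assume "y \<in> K"
        then have "norm (w y) \<le> s" using w_le[of y] \<open>0 < e\<close> by (simp add: s_def)
        then show "norm (of_real (1 / s) * w y) \<le> 1"
          unfolding norm_mult norm_of_real using s by (simp add: field_simps)
      qed
      moreover have "\<Phi> (\<lambda>y. of_real (1 / s) * w y) = of_real (1 / s) * \<Phi> w"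
        using \<Phi> wH unfolding linear_functional_def function_space_simps by blast
      ultimately have "1 / s * norm (\<Phi> w) \<le> 1"
        using s by (simp add: norm_mult norm_divide)
      then show "norm (\<Phi> w) \<le> re_part (w x) + e" using s by (simp add: field_simps s_def)
    qed
    then have "re_part (\<Phi> w - w x) \<le> 0"
      using re_part_le_norm[of "\<Phi> w"] by (simp add: re_part_diff)
    \<comment> \<open>The conjugates in w were chosen for this: the difference is the sum of squares
      g x, which is therefore 0.\<close>
    moreover have "\<Phi> w - w x = (\<Sum>u\<in>F. of_real ((norm (\<Phi> u - u x))\<^sup>2))"
      unfolding \<Phi>w unfolding w_def by (simp only: sum_subtractf[symmetric] right_diff_distrib[symmetric] conjugate_mult_self)
    ultimately have "(\<Sum>u\<in>F. (norm (\<Phi> u - u x))\<^sup>2) \<le> 0"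
      by (simp only: re_part_sum re_part_of_real)
    then have "(\<Sum>u\<in>F. (norm (\<Phi> u - u x))\<^sup>2) = 0"
      by (intro antisym sum_nonneg) auto
    then have "\<forall>u\<in>F. \<Phi> u = u x"
      using F(1) by (simp add: sum_nonneg_eq_0_iff)
    with x show ?thesis by blast
  qed
  define A where "A u = {x \<in> K. u x = \<Phi> u}" for u
  \<comment> \<open>Finite intersection property: the sets \<open>A u\<close> are closed in the
    compact K, and finitely many of them meet by the finite case.\<close>
  have "K \<inter> \<Inter>(A ` H) \<noteq> {}"
  proof -
    have "closedin ?T C" if "C \<in> A ` H" for C
    proof -
      obtain u where u: "u \<in> H" "C = A u"
        using \<open>C \<in> A ` H\<close> by blast
      have "A u = {x \<in> topspace ?T. u x \<in> {\<Phi> u}}"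
        unfolding topK by (simp add: A_def)
      then show ?thesis
        using closedin_continuous_map_preimage[OF cont[OF u(1)], of "{\<Phi> u}"] by (simp add: u(2))
    qed
    moreover have "K \<inter> \<Inter>\<F> \<noteq> {}" if \<F>: "finite \<F>" "\<F> \<subseteq> A ` H" for \<F>
    proof -
      obtain F where F: "finite F" "F \<subseteq> H" "\<F> = A ` F"
        using finite_subset_image[OF \<F>] by blast
      then show ?thesis using finite_case[OF F(1,2)] by (auto simp: A_def)
    qed
    moreover have "compactin ?T K" by (simp add: compactin_subtopology K(3))
    ultimately show ?thesis
      using compactin_fip[THEN iffD1, THEN conjunct2, rule_format, of ?T K "A ` H"] by blast
  qed
  then obtain k where "k \<in> K" "\<And>u. u \<in> H \<Longrightarrow> k \<in> A u" by blast
  then show ?thesis using that[of k] by (simp add: A_def)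
qed

end

lemma continuous_map_uniform_approx:
  fixes f :: "'a \<Rightarrow> 'b::real_normed_vector"
  assumes "\<And>e. 0 < e \<Longrightarrow> \<exists>g. continuous_map T euclidean g \<and> (\<forall>x\<in>topspace T. norm (f x - g x) < e)"
  shows "continuous_map T euclidean f"
proof -
  have "\<exists>g. \<forall>n. continuous_map T euclidean (g n) \<and> (\<forall>x\<in>topspace T. norm (f x - g n x) < 1 / real (Suc n))"
    by (rule choice) (use assms in simp)
  then obtain g where g: "\<And>n. continuous_map T euclidean (g n)"
    "\<And>n x. x \<in> topspace T \<Longrightarrow> norm (f x - g n x) < 1 / real (Suc n)" by blast
  have "continuous_map T Met_TC.mtopology f"
  proof (rule Met_TC.continuous_map_uniform_limit)
    show "\<forall>\<^sub>F n in sequentially. continuous_map T Met_TC.mtopology (g n)" using g(1) by simp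
    fix e :: real assume "0 < e"
    then obtain N where N: "1 / real (Suc N) < e" using nat_approx_posE by blast
    show "\<forall>\<^sub>F n in sequentially. \<forall>x\<in>topspace T. f x \<in> UNIV \<and> dist (g n x) (f x) < e"
      unfolding eventually_sequentially
    proof (intro exI[of _ N] allI impI ballI conjI)
      fix n x assume "N \<le> n" "x \<in> topspace T"
      then have "dist (g n x) (f x) < 1 / real (Suc n)" using g(2) by (simp add: dist_norm norm_minus_commute)
      also have "\<dots> \<le> 1 / real (Suc N)" using \<open>N \<le> n\<close> by (simp add: frac_le)
      finally show "dist (g n x) (f x) < e" using N by simp
    qed simp
  qed simp
  then show ?thesis by simp
qed

context scalar_module
begin

text \<open>The value of u at a combination is at most the larger of |u x| and |u y|, which gives
  the closed and the strict version at once.\<close>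

lemma absolutely_convex_polar:
  assumes "\<And>u. u \<in> M \<Longrightarrow> linear_functional X u"
  shows "absolutely_convex X {x \<in> carrier X. \<forall>u\<in>M. norm (u x) \<le> r}"
    and "absolutely_convex X {x \<in> carrier X. \<forall>u\<in>M. norm (u x) < r}"
proof -
  have *: "norm (u (a \<odot> x \<oplus> b \<odot> y)) \<le> max (norm (u x)) (norm (u y))"
    if "u \<in> M" "x \<in> carrier X" "y \<in> carrier X" "norm a + norm b \<le> 1" for u x y a b
  proof -
    let ?m = "max (norm (u x)) (norm (u y))"
    have "norm (u (a \<odot> x \<oplus> b \<odot> y)) \<le> norm a * norm (u x) + norm b * norm (u y)"
      using assms[OF that(1)] that(2,3) norm_triangle_ineq[of "a * u x" "b * u y"]
      by (simp add: linear_functional_add linear_functional_smult norm_mult)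
    also have "\<dots> \<le> norm a * ?m + norm b * ?m"
      by (intro add_mono mult_left_mono) auto
    also have "\<dots> = (norm a + norm b) * ?m" by (simp add: distrib_right)
    also have "\<dots> \<le> 1 * ?m" by (intro mult_right_mono that(4)) (simp add: le_max_iff_disj)
    finally show ?thesis by simp
  qed
  show "absolutely_convex X {x \<in> carrier X. \<forall>u\<in>M. norm (u x) \<le> r}"
    unfolding absolutely_convex_def by (auto intro!: order_trans[OF *])
  show "absolutely_convex X {x \<in> carrier X. \<forall>u\<in>M. norm (u x) < r}"
    unfolding absolutely_convex_def by (auto intro!: le_less_trans[OF *])
qed

end

lemma (in lc_hausdorff) bounded_in_scale:
  assumes "bounded_in X B" "zero_nbhd X U"
  shows "\<exists>t>0. \<forall>x\<in>B. of_real t \<odot> x \<in> U"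
proof -
  obtain W where W: "zero_nbhd X W" "absolutely_convex X W" "W \<subseteq> U"
    using locally_convex[OF assms(2)] by blast
  then obtain t where "0 < t" "\<forall>x\<in>B. of_real t \<odot> x \<in> W"
    using assms(1) unfolding bounded_in_iff by blast
  with W(3) show ?thesis by blast
qed


section \<open>The predual given by a weaker topology\<close>

text \<open>X and T share carrier and operations, hence also linear functionals and absolutely
  convex sets; T supplies Hahn-Banach for \<tau>'. Points of \<Omega> appear only in the final
  theorem.\<close>

locale compact_predual = lc_hausdorff X + T: lc_hausdorff "X\<lparr>topol := \<tau>'\<rparr>"
  for X :: "('k::real_or_complex, 'v) top_module" (structure) and \<tau>' +
  assumes bornological: "bornological X" and BBC: "BBC X \<tau>'" and CNC: "CNC X \<tau>'"
begin

lemma topspace_weak: "topspace \<tau>' = carrier X"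
  using T.topspace_topol by simp

definition bdual :: "('v \<Rightarrow> 'k) set" where
  "bdual = {u. linear_functional X u \<and>
     (\<forall>B. bounded_in X B \<longrightarrow> continuous_map (subtopology \<tau>' B) euclidean u)}"

lemma bounded_continuous_dual_eq:
  "bounded_continuous_dual X \<tau>' =
     function_space bdual (uniform_topology bdual {B. bounded_in X B})"
  by (simp add: bounded_continuous_dual_def bdual_def Let_def)

lemma bdual_linear: "u \<in> bdual \<Longrightarrow> linear_functional X u"
  by (simp add: bdual_def)

text \<open>Brings the functionals that Hahn-Banach yields for \<tau>' into E; so E separates the
  points of X and its polars recover the absolutely convex \<tau>'-closed sets.\<close>

lemma dual_weak_subset: "dual (X\<lparr>topol := \<tau>'\<rparr>) \<subseteq> bdual"
  by (auto simp: dual_def bdual_def linear_functional_def continuous_map_from_subtopology)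

lemma linear_functional_weak [simp]: "linear_functional (X\<lparr>topol := \<tau>'\<rparr>) u \<longleftrightarrow> linear_functional X u"
  by (simp add: linear_functional_def)

lemma absolutely_convex_weak [simp]: "absolutely_convex (X\<lparr>topol := \<tau>'\<rparr>) A \<longleftrightarrow> absolutely_convex X A"
  by (simp add: absolutely_convex_def)

lemma bdual_zero: "(\<lambda>_. 0) \<in> bdual"
  by (simp add: bdual_def linear_functional_def functions_on_def)

lemma bdual_add:
  assumes "u \<in> bdual" "v \<in> bdual"
  shows "(\<lambda>x. u x + v x) \<in> bdual"
  using assms by (auto simp: bdual_def linear_functional_def functions_on_def algebra_simps
      intro: continuous_map_add)

lemma bdual_smult:
  assumes "u \<in> bdual"
  shows "(\<lambda>x. c * u x) \<in> bdual"
proof -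
  have "continuous_map euclidean euclidean (\<lambda>z::'k. c * z)"
    by (auto intro!: continuous_intros)
  then have "continuous_map T euclidean (\<lambda>x. c * u x)" if "continuous_map T euclidean u" for T
    using continuous_map_compose[OF that, of euclidean "\<lambda>z. c * z"] by (simp add: o_def)
  then show ?thesis
    using assms by (auto simp: bdual_def linear_functional_def functions_on_def algebra_simps)
qed

text \<open>(BBC) places B in a \<tau>'-compact bounded set, on which u is continuous. Hence the
  sets of u with |u| < e on B are absorbing in E.\<close>

lemma bdual_bounded:
  assumes u: "u \<in> bdual" and B: "bounded_in X B"
  shows "\<exists>r>0. \<forall>x\<in>B. norm (u x) \<le> r"
proof -
  obtain K where K: "B \<subseteq> K" "bounded_in X K" "compactin \<tau>' K"
    using BBC B unfolding BBC_def by blast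
  have "compactin (subtopology \<tau>' K) K" using K(3) by (simp add: compactin_subtopology)
  then have "compactin euclidean (u ` K)"
    by (rule image_compactin) (use u K(2) in \<open>simp add: bdual_def\<close>)
  then have "bounded (u ` K)" by (simp add: compact_imp_bounded)
  then obtain r where "0 < r" "\<forall>x\<in>u ` K. norm x \<le> r" unfolding bounded_pos by blast
  with K(1) show ?thesis by blast
qed

text \<open>(BBC) enlarges B to a compact K. If |u| \<le> 1 on K and |c| = e/2, then |c u| \<le> e/2
  < e on B, so c \<Phi> satisfies the bound in \<open>compact_representation\<close>; the point k
  obtained there, divided by c, represents \<Phi>.\<close>

lemma bdual_representation:
  assumes \<Phi>: "linear_functional (function_space bdual S) \<Phi>"
    and B: "bounded_in X B" and "0 < e"
    and bound: "\<And>u. u \<in> bdual \<Longrightarrow> (\<And>x. x \<in> B \<Longrightarrow> norm (u x) < e) \<Longrightarrow> norm (\<Phi> u) \<le> 1"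
  obtains x where "x \<in> carrier X" "\<And>u. u \<in> bdual \<Longrightarrow> \<Phi> u = u x"
proof -
  \<comment> \<open>Inserting \<zero> keeps K nonempty when B is empty.\<close>
  have "bounded_in X (insert \<zero> B)"
    using bounded_in_Un[OF bounded_in_singleton[of \<zero>] B] by simp
  then obtain K where K: "insert \<zero> B \<subseteq> K" "absolutely_convex X K" "bounded_in X K" "compactin \<tau>' K"
    using BBC unfolding BBC_def by blast
  define c :: 'k where "c = of_real (e / 2)"
  have c: "c \<noteq> 0" "norm c = e / 2" using \<open>0 < e\<close> unfolding c_def norm_of_real by simp_all
  have hom: "\<Phi> (\<lambda>x. a * u x) = a * \<Phi> u" if "u \<in> bdual" for a u
    using \<Phi> that by (simp add: linear_functional_def)
  have add: "\<Phi> (\<lambda>x. u x + v x) = \<Phi> u + \<Phi> v" if "u \<in> bdual" "v \<in> bdual" for u v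
    using \<Phi> that by (simp add: linear_functional_def)
  have ext: "\<Phi> u = 0" if "u \<notin> bdual" for u
    using \<Phi> that by (simp add: linear_functional_def functions_on_def)
  obtain k where k: "k \<in> K" "\<And>u. u \<in> bdual \<Longrightarrow> c * \<Phi> u = u k"
  proof (rule compact_representation[OF K(2) _ K(4) bdual_zero bdual_add bdual_smult bdual_linear])
    show "K \<noteq> {}" using K(1) by blast
    show "continuous_map (subtopology \<tau>' K) euclidean u" if "u \<in> bdual" for u
      using that K(3) by (simp add: bdual_def)
    show "linear_functional (function_space bdual S) (\<lambda>u. c * \<Phi> u)"
      by (auto simp: linear_functional_def functions_on_def hom add ext algebra_simps)
    fix u assume u: "u \<in> bdual" and le: "\<And>x. x \<in> K \<Longrightarrow> norm (u x) \<le> 1"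
    have "norm (\<Phi> (\<lambda>x. c * u x)) \<le> 1"
    proof (rule bound[OF bdual_smult[OF u]])
      fix x assume "x \<in> B"
      then have "norm (u x) \<le> 1" using K(1) le by blast
      then have "norm c * norm (u x) \<le> norm c * 1" by (intro mult_left_mono) auto
      also have "norm c * 1 < e" using c(2) \<open>0 < e\<close> by simp
      finally show "norm (c * u x) < e" by (simp add: norm_mult)
    qed
    then show "norm (c * \<Phi> u) \<le> 1" using hom[OF u] by simp
  qed (use that in blast)+
  have kX: "k \<in> carrier X" using k(1) absolutely_convex_subset[OF K(2)] by blast
  show ?thesis
  proof (rule that[of "inverse c \<odot> k"])
    show "inverse c \<odot> k \<in> carrier X" using kX by simp
    show "\<Phi> u = u (inverse c \<odot> k)" if u: "u \<in> bdual" for u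
    proof -
      have "\<Phi> u = inverse c * (c * \<Phi> u)" using c(1) by simp
      also have "\<dots> = u (inverse c \<odot> k)"
        unfolding k(2)[OF u] linear_functional_smult[OF bdual_linear[OF u] kX] ..
      finally show ?thesis .
    qed
  qed
qed

text \<open>Every Z isomorphic to E becomes a predual of X, with \<psi> the transpose of J, cut off
  outside the carrier because members of \<open>dual Z\<close> vanish there. Injectivity is
  separation by \<tau>'-continuous functionals, surjectivity is
  \<open>bdual_representation\<close>.\<close>

lemma strong_dual_isomorphism:
  fixes Z :: "('k, 'w) top_module"
  assumes Z: "lc_hausdorff Z" and J: "topological_isomorphism Z (bounded_continuous_dual X \<tau>') J"
  defines "\<psi> \<equiv> \<lambda>x z. if z \<in> carrier Z then J z x else 0"
  shows "topological_isomorphism X (strong_dual Z) \<psi>"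
proof -
  interpret Z: lc_hausdorff Z by (rule Z)
  note J' = Z.topological_isomorphism_uniform_iff[OF directed_family_bounded, THEN iffD1,
      OF J[unfolded bounded_continuous_dual_eq]]
  have bij: "bij_betw J (carrier Z) bdual" using J' by blast
  have Znbhd: "zero_nbhd Z U \<longleftrightarrow>
      (\<exists>B e. bounded_in X B \<and> 0 < e \<and> {z \<in> carrier Z. \<forall>b\<in>B. norm (J z b) < e} \<subseteq> U)"
    if "U \<subseteq> carrier Z" for U
    using J' that by auto
  have J_add: "J (y \<oplus>\<^bsub>Z\<^esub> z) x = J y x + J z x" if "y \<in> carrier Z" "z \<in> carrier Z" for y z x
    using J' that by (simp add: linear_map_function_space)
  have J_smult: "J (c \<odot>\<^bsub>Z\<^esub> z) x = c * J z x" if "z \<in> carrier Z" for c z x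
    using J' that by (simp add: linear_map_function_space)
  have J_bdual: "J z \<in> bdual" if "z \<in> carrier Z" for z
    using bij that by (auto simp: bij_betw_def)
  have J_lin: "linear_functional X (J z)" if "z \<in> carrier Z" for z
    using J_bdual[OF that] by (rule bdual_linear)
  have J_surj: "\<exists>z\<in>carrier Z. J z = u" if "u \<in> bdual" for u
    using that unfolding bij_betw_imp_surj_on[OF bij, symmetric] by blast
  have \<psi>_dual: "\<psi> x \<in> dual Z" if x: "x \<in> carrier X" for x
  proof (rule Z.dualI_bounded)
    show "linear_functional Z (\<psi> x)"
      by (simp add: linear_functional_def functions_on_def \<psi>_def J_add J_smult)
    show "zero_nbhd Z {z \<in> carrier Z. norm (J z x) < 1}"
    proof (rule Znbhd[THEN iffD2])
      show "\<exists>B e. bounded_in X B \<and> 0 < e \<and>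
          {z \<in> carrier Z. \<forall>b\<in>B. norm (J z b) < e} \<subseteq> {z \<in> carrier Z. norm (J z x) < 1}"
        by (intro exI[of _ "{x}"] exI[of _ 1]) (simp add: bounded_in_singleton x)
    qed blast
    show "norm (\<psi> x z) \<le> 1" if "z \<in> {z \<in> carrier Z. norm (J z x) < 1}" for z
      using that by (simp add: \<psi>_def)
  qed
  have inj: "inj_on \<psi> (carrier X)"
  proof (rule inj_onI)
    fix x y assume x: "x \<in> carrier X" and y: "y \<in> carrier X" and eq: "\<psi> x = \<psi> y"
    show "x = y"
    proof (rule ccontr)
      assume "x \<noteq> y"
      then have "x \<ominus> y \<noteq> \<zero>" using x y by simp
      moreover have "x \<ominus> y \<in> carrier X" using x y by simp
      ultimately obtain F where F: "F \<in> dual (X\<lparr>topol := \<tau>'\<rparr>)" "F (x \<ominus> y) \<noteq> 0"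
        using T.dual_separates[of "x \<ominus> y"] by auto
      obtain z where z: "z \<in> carrier Z" "J z = F" using J_surj F(1) dual_weak_subset by blast
      then have "F x = F y" using fun_cong[OF eq, of z] by (simp add: \<psi>_def)
      moreover have "linear_functional X F" using J_lin z by blast
      ultimately show False using F(2) x y by (simp add: linear_functional_diff)
    qed
  qed
  have surj: "\<exists>x\<in>carrier X. \<psi> x = \<Phi>" if \<Phi>: "\<Phi> \<in> dual Z" for \<Phi>
  proof -
    have lin: "linear_functional Z \<Phi>" using \<Phi> by (simp add: dual_def)
    define g where "g = inv_into (carrier Z) J"
    have gJ: "g (J z) = z" if "z \<in> carrier Z" for z
      using bij that by (simp add: g_def bij_betw_def)
    \<comment> \<open>\<Phi> transported to E along the inverse of J.\<close>
    define \<Psi> where "\<Psi> u = (if u \<in> bdual then \<Phi> (g u) else 0)" for u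
    have \<Psi>J: "\<Psi> (J z) = \<Phi> z" if "z \<in> carrier Z" for z
      using J_bdual[OF that] gJ[OF that] by (simp add: \<Psi>_def)
    have \<Psi>_lin: "linear_functional (function_space bdual \<tau>0) \<Psi>" for \<tau>0
      unfolding linear_functional_def function_space_simps
    proof (intro conjI ballI allI)
      show "\<Psi> \<in> functions_on bdual" by (simp add: functions_on_def \<Psi>_def)
      fix u assume u: "u \<in> bdual"
      then obtain y where y: "y \<in> carrier Z" "u = J y" using J_surj by blast
      show "\<Psi> (\<lambda>x. u x + v x) = \<Psi> u + \<Psi> v" if v: "v \<in> bdual" for v
      proof -
        obtain z where z: "z \<in> carrier Z" "v = J z" using J_surj[OF v] by blast
        have "J (y \<oplus>\<^bsub>Z\<^esub> z) = (\<lambda>x. u x + v x)" using y z J_add by auto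
        then show ?thesis
          using \<Psi>J[of "y \<oplus>\<^bsub>Z\<^esub> z"] \<Psi>J y z Z.linear_functional_add[OF lin] by simp
      qed
      show "\<Psi> (\<lambda>x. c * u x) = c * \<Psi> u" for c
      proof -
        have "J (c \<odot>\<^bsub>Z\<^esub> y) = (\<lambda>x. c * u x)" using y J_smult by auto
        then show ?thesis
          using \<Psi>J[of "c \<odot>\<^bsub>Z\<^esub> y"] \<Psi>J y Z.linear_functional_smult[OF lin] by simp
      qed
    qed
    have "zero_nbhd Z {z \<in> carrier Z. norm (\<Phi> z) < 1}"
      by (rule Z.zero_nbhd_dual[OF \<Phi>]) simp
    then obtain B e where B: "bounded_in X B" "0 < e"
      "{z \<in> carrier Z. \<forall>b\<in>B. norm (J z b) < e} \<subseteq> {z \<in> carrier Z. norm (\<Phi> z) < 1}"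
      using Znbhd[of "{z \<in> carrier Z. norm (\<Phi> z) < 1}"] by blast
    have "norm (\<Psi> u) \<le> 1" if u: "u \<in> bdual" and lt: "\<And>x. x \<in> B \<Longrightarrow> norm (u x) < e" for u
    proof -
      obtain z where z: "z \<in> carrier Z" "u = J z" using J_surj[OF u] by blast
      then have "norm (\<Phi> z) < 1" using B(3) lt by blast
      then show ?thesis using \<Psi>J z by simp
    qed
    then obtain x where x: "x \<in> carrier X" "\<And>u. u \<in> bdual \<Longrightarrow> \<Psi> u = u x"
      using bdual_representation[OF \<Psi>_lin B(1,2)] by blast
    have "\<psi> x z = \<Phi> z" for z
    proof (cases "z \<in> carrier Z")
      case True
      then show ?thesis using x(2)[OF J_bdual[OF True]] \<Psi>J by (simp add: \<psi>_def)
    next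
      case False
      then show ?thesis using lin by (simp add: \<psi>_def linear_functional_def functions_on_def)
    qed
    then show ?thesis using x(1) by blast
  qed
  have "zero_nbhd X U \<longleftrightarrow> (\<exists>M\<in>{M. bounded_in Z M}. \<exists>e>0. {x \<in> carrier X. \<forall>z\<in>M. norm (\<psi> x z) < e} \<subseteq> U)"
    if U: "U \<subseteq> carrier X" for U
  proof
    assume "zero_nbhd X U"
    then obtain W where W: "zero_nbhd X W" "W \<subseteq> U" "absolutely_convex X W" "closedin \<tau>' W"
      using CNC unfolding CNC_def by blast
    \<comment> \<open>The polar of W in Z. It is bounded because W absorbs every bounded set B of
      X.\<close>
    define M where "M = {z \<in> carrier Z. \<forall>w\<in>W. norm (J z w) \<le> 1}"
    have "bounded_in Z M"
      unfolding Z.bounded_in_iff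
    proof (intro conjI allI impI)
      show "M \<subseteq> carrier Z" by (auto simp: M_def)
      fix Q assume Q: "zero_nbhd Z Q \<and> absolutely_convex Z Q"
      then obtain B e where B: "bounded_in X B" "0 < e" "{z \<in> carrier Z. \<forall>b\<in>B. norm (J z b) < e} \<subseteq> Q"
        using Znbhd[of Q] zero_nbhd_subset[of Z Q] by blast
      obtain t where t: "0 < t" "\<forall>x\<in>B. of_real t \<odot> x \<in> W"
        using bounded_in_scale[OF B(1) W(1)] by blast
      \<comment> \<open>t moves B into W, so t |J z b| \<le> 1 for z in the polar; e / 2 in place of
        e makes the inequality strict.\<close>
      have "of_real (t * e / 2) \<odot>\<^bsub>Z\<^esub> z \<in> Q" if z: "z \<in> M" for z
      proof -
        have zZ: "z \<in> carrier Z" using z by (simp add: M_def)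
        have "norm (J (of_real (t * e / 2) \<odot>\<^bsub>Z\<^esub> z) b) < e" if b: "b \<in> B" for b
        proof -
          have bX: "b \<in> carrier X" using b bounded_in_subset[OF B(1)] by blast
          have "norm (J z (of_real t \<odot> b)) \<le> 1" using z t(2) b by (simp add: M_def)
          then have "norm (of_real t * J z b) \<le> 1"
            using linear_functional_smult[OF J_lin[OF zZ] bX] by simp
          then have "t * norm (J z b) \<le> 1"
            unfolding norm_mult norm_of_real using t(1) by simp
          then have "(e / 2) * (t * norm (J z b)) \<le> (e / 2) * 1"
            using B(2) by (intro mult_left_mono) auto
          then have "t * e / 2 * norm (J z b) < e" using B(2) by (simp add: algebra_simps)
          then show ?thesis
            unfolding J_smult[OF zZ] norm_mult norm_of_real using t(1) B(2) by simp
        qed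
        then show ?thesis using B(3) zZ by blast
      qed
      then show "\<exists>t>0. \<forall>z\<in>M. of_real t \<odot>\<^bsub>Z\<^esub> z \<in> Q"
        using t(1) B(2) by (intro exI[of _ "t * e / 2"]) simp
    qed
    \<comment> \<open>Bipolar argument: W is \<tau>'-closed, so a point outside W is detected by a
      \<tau>'-continuous functional, and this is J z for some z in M.\<close>
    moreover have "x \<in> W" if x: "x \<in> carrier X" "\<forall>z\<in>M. norm (\<psi> x z) < 1" for x
    proof (rule ccontr)
      assume "x \<notin> W"
      moreover have "W \<noteq> {}" using zero_nbhd_zero[OF W(1)] by blast
      ultimately obtain F where F: "F \<in> dual (X\<lparr>topol := \<tau>'\<rparr>)" "\<And>x. x \<in> W \<Longrightarrow> norm (F x) \<le> 1"
          "1 \<le> norm (F x)"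
        using T.hahn_banach_closed[of W x] W(3,4) x(1) by auto
      obtain z where z: "z \<in> carrier Z" "J z = F" using J_surj F(1) dual_weak_subset by blast
      then have "z \<in> M" using F(2) by (simp add: M_def)
      then have "norm (\<psi> x z) < 1" using x(2) by blast
      then show False using z F(3) by (simp add: \<psi>_def)
    qed
    ultimately show "\<exists>M\<in>{M. bounded_in Z M}. \<exists>e>0. {x \<in> carrier X. \<forall>z\<in>M. norm (\<psi> x z) < e} \<subseteq> U"
      using W(2) by (intro bexI[of _ M] exI[of _ 1]) auto
  next
    assume "\<exists>M\<in>{M. bounded_in Z M}. \<exists>e>0. {x \<in> carrier X. \<forall>z\<in>M. norm (\<psi> x z) < e} \<subseteq> U"
    then obtain M e where M: "bounded_in Z M" "0 < e" "{x \<in> carrier X. \<forall>z\<in>M. norm (\<psi> x z) < e} \<subseteq> U"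
      by blast
    have MZ: "M \<subseteq> carrier Z" by (rule Z.bounded_in_subset[OF M(1)])
    \<comment> \<open>As X is bornological, it is enough that this polar absorbs each bounded B.
      Boundedness of M gives a factor t for z, which bilinearity moves over to b.\<close>
    let ?W = "{x \<in> carrier X. \<forall>u\<in>J ` M. norm (u x) < e}"
    have ac: "absolutely_convex X ?W"
      by (rule absolutely_convex_polar) (use J_lin MZ in blast)
    have "absorbs X ?W B" if B: "bounded_in X B" for B
    proof -
      have "zero_nbhd Z {z \<in> carrier Z. \<forall>b\<in>B. norm (J z b) < e}"
        by (rule Znbhd[THEN iffD2]) (use B M(2) in blast)+
      then obtain t where t: "0 < t" "\<forall>z\<in>M. of_real t \<odot>\<^bsub>Z\<^esub> z \<in> {z \<in> carrier Z. \<forall>b\<in>B. norm (J z b) < e}"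
        using Z.bounded_in_scale[OF M(1)] by blast
      have "of_real t \<odot> b \<in> ?W" if b: "b \<in> B" for b
      proof -
        have bX: "b \<in> carrier X" using b bounded_in_subset[OF B] by blast
        have "norm (J z (of_real t \<odot> b)) < e" if z: "z \<in> M" for z
        proof -
          have zZ: "z \<in> carrier Z" using z MZ by blast
          have "norm (J (of_real t \<odot>\<^bsub>Z\<^esub> z) b) < e" using t(2) z b by blast
          then show ?thesis
            using J_smult[OF zZ] linear_functional_smult[OF J_lin[OF zZ] bX] by simp
        qed
        then show ?thesis using bX by simp
      qed
      then show ?thesis
        using absorbs_iff[OF ac bounded_in_subset[OF B]] t(1) by blast
    qed
    then have "zero_nbhd X ?W" using bornological ac unfolding bornological_def by blast
    moreover have "?W \<subseteq> U"
    proof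
      fix x assume x: "x \<in> ?W"
      then have "\<forall>z\<in>M. norm (\<psi> x z) < e" using MZ by (auto simp: \<psi>_def)
      then show "x \<in> U" using x M(3) by blast
    qed
    ultimately show "zero_nbhd X U" using U by (rule zero_nbhd_mono)
  qed
  moreover have "linear_map X (strong_dual Z) \<psi>"
    unfolding strong_dual_def linear_map_function_space
  proof (intro conjI ballI allI)
    show "\<psi> \<in> carrier X \<rightarrow> dual Z" using \<psi>_dual by blast
    fix x z assume x: "x \<in> carrier X"
    show "\<psi> (x \<oplus> y) z = \<psi> x z + \<psi> y z" if "y \<in> carrier X" for y
      using x that linear_functional_add[OF J_lin] by (simp add: \<psi>_def)
    show "\<psi> (c \<odot> x) z = c * \<psi> x z" for c
      using x linear_functional_smult[OF J_lin] by (simp add: \<psi>_def)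
  qed
  moreover have "bij_betw \<psi> (carrier X) (dual Z)"
    unfolding bij_betw_def using inj \<psi>_dual surj by blast
  ultimately show ?thesis
    unfolding strong_dual_def topological_isomorphism_uniform_iff[OF Z.directed_family_bounded]
    by blast
qed

end

section \<open>Uniqueness\<close>

context compact_predual
begin

text \<open>Surjectivity is Grothendieck's completeness theorem in disguise: a functional on \<open>bdual\<close>
  vanishing on \<open>J ` carrier Z\<close> is the evaluation at some \<open>x\<close> with \<open>\<psi> x = 0\<close>, so the image is
  dense, and an approximating filter is Cauchy in \<open>Z\<close>.\<close>

lemma separating_predual_isomorphism:
  fixes Z :: "('k, 'w) top_module"
  assumes Z: "lc_hausdorff Z" and complete: "complete_in Z" and barrelled: "barrelled Z"
    and \<psi>: "topological_isomorphism X (strong_dual Z) \<psi>"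
  defines "J \<equiv> \<lambda>z x. if x \<in> carrier X then \<psi> x z else 0"
  assumes separating: "\<And>x. x \<in> carrier X \<Longrightarrow> (\<And>z. z \<in> carrier Z \<Longrightarrow> J z \<in> bdual \<Longrightarrow> \<psi> x z = 0) \<Longrightarrow> x = \<zero>"
  shows "topological_isomorphism Z (bounded_continuous_dual X \<tau>') J"
proof -
  interpret Z: lc_hausdorff Z by (rule Z)
  note \<psi>' = topological_isomorphism_uniform_iff[OF Z.directed_family_bounded, THEN iffD1,
      OF \<psi>[unfolded strong_dual_def]]
  have bij: "bij_betw \<psi> (carrier X) (dual Z)" using \<psi>' by blast
  have Xnbhd: "zero_nbhd X U \<longleftrightarrow>
      (\<exists>M e. bounded_in Z M \<and> 0 < e \<and> {x \<in> carrier X. \<forall>z\<in>M. norm (\<psi> x z) < e} \<subseteq> U)"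
    if "U \<subseteq> carrier X" for U
    using \<psi>' that by auto
  have \<psi>_add: "\<psi> (x \<oplus> y) z = \<psi> x z + \<psi> y z" if "x \<in> carrier X" "y \<in> carrier X" for x y z
    using \<psi>' that by (simp add: linear_map_function_space)
  have \<psi>_smult: "\<psi> (c \<odot> x) z = c * \<psi> x z" if "x \<in> carrier X" for c x z
    using \<psi>' that by (simp add: linear_map_function_space)
  have \<psi>_dual: "\<psi> x \<in> dual Z" if "x \<in> carrier X" for x
    using bij that by (auto simp: bij_betw_def)
  have \<psi>_lin: "linear_functional Z (\<psi> x)" if "x \<in> carrier X" for x
    using \<psi>_dual[OF that] by (simp add: dual_def)
  have \<psi>_surj: "\<exists>x\<in>carrier X. \<psi> x = F" if "F \<in> dual Z" for F
    using that unfolding bij_betw_imp_surj_on[OF bij, symmetric] by blast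
  have \<psi>_zero: "\<psi> \<zero> z = 0" for z
    using \<psi>_smult[of \<zero> 0 z] by simp
  have J: "J z x = \<psi> x z" if "x \<in> carrier X" for x z
    using that by (simp add: J_def)
  have J_lin: "linear_functional X (J z)" for z
    by (simp add: linear_functional_def functions_on_def J_def \<psi>_add \<psi>_smult)
  have J_add: "J (y \<oplus>\<^bsub>Z\<^esub> z) x = J y x + J z x" if "y \<in> carrier Z" "z \<in> carrier Z" for y z x
    using that Z.linear_functional_add[OF \<psi>_lin] by (simp add: J_def)
  have J_smult: "J (c \<odot>\<^bsub>Z\<^esub> z) x = c * J z x" if "z \<in> carrier Z" for c z x
    using that Z.linear_functional_smult[OF \<psi>_lin] by (simp add: J_def)

  \<comment> \<open>The polar of B is a barrel: it is an intersection of closed preimages, and it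
    absorbs z because x \<mapsto> \<psi> x z is continuous on X, hence bounded on B.\<close>
  have polar_nbhd: "zero_nbhd Z {z \<in> carrier Z. \<forall>x\<in>B. norm (J z x) \<le> 1}" (is "zero_nbhd Z ?U")
    if B: "bounded_in X B" for B
  proof -
    have BX: "B \<subseteq> carrier X" by (rule bounded_in_subset[OF B])
    have U: "?U = {z \<in> carrier Z. \<forall>u\<in>\<psi> ` B. norm (u z) \<le> 1}"
      using BX J by (simp add: subset_iff cong: ball_cong)
    have ac: "absolutely_convex Z ?U"
      unfolding U by (rule Z.absolutely_convex_polar) (use \<psi>_lin BX in blast)
    have "closedin (topol Z) ?U"
    \<comment> \<open>An intersection over an empty B would be the whole type instead of the carrier
      of Z.\<close>
    proof (cases "B = {}")
      case True
      then show ?thesis using closedin_topspace[of "topol Z"] by (simp add: Z.topspace_topol)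
    next
      case False
      have "closedin (topol Z) {z \<in> topspace (topol Z). \<psi> x z \<in> cball 0 1}" if "x \<in> B" for x
        using \<psi>_dual[of x] that BX
        by (intro closedin_continuous_map_preimage[of _ euclidean]) (auto simp: dual_def)
      then have "closedin (topol Z) (\<Inter>x\<in>B. {z \<in> topspace (topol Z). \<psi> x z \<in> cball 0 1})"
        using False by blast
      also have "(\<Inter>x\<in>B. {z \<in> topspace (topol Z). \<psi> x z \<in> cball 0 1}) = ?U"
        unfolding U using False by (auto simp: Z.topspace_topol)
      finally show ?thesis .
    qed
    moreover have "absorbs Z ?U {z}" if z: "z \<in> carrier Z" for z
    proof -
      have "zero_nbhd X {x \<in> carrier X. norm (\<psi> x z) < 1}"
      proof (rule Xnbhd[THEN iffD2])
        show "\<exists>M e. bounded_in Z M \<and> 0 < e \<and>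
            {x \<in> carrier X. \<forall>z\<in>M. norm (\<psi> x z) < e} \<subseteq> {x \<in> carrier X. norm (\<psi> x z) < 1}"
          by (intro exI[of _ "{z}"] exI[of _ 1]) (simp add: Z.bounded_in_singleton z)
      qed blast
      then obtain t where t: "0 < t" "\<forall>x\<in>B. of_real t \<odot> x \<in> {x \<in> carrier X. norm (\<psi> x z) < 1}"
        using bounded_in_scale[OF B] by blast
      have "norm (J (of_real t \<odot>\<^bsub>Z\<^esub> z) x) \<le> 1" if "x \<in> B" for x
      proof -
        have "x \<in> carrier X" using that BX by blast
        moreover have "norm (\<psi> (of_real t \<odot> x) z) < 1" using t(2) that by blast
        ultimately show ?thesis using J_smult[OF z] \<psi>_smult J by simp
      qed
      then have "of_real t \<odot>\<^bsub>Z\<^esub> z \<in> ?U" using z by simp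
      then show ?thesis using Z.absorbs_iff[OF ac, of "{z}"] z t(1) by blast
    qed
    ultimately show ?thesis
      using barrelled ac unfolding barrelled_def barrel_def by blast
  qed
  have ball_nbhd: "zero_nbhd Z {z \<in> carrier Z. \<forall>x\<in>B. norm (J z x) < e}"
    if B: "bounded_in X B" and e: "0 < e" for B e
  proof -
    have "zero_nbhd Z {z \<in> carrier Z. of_real (2 / e) \<odot>\<^bsub>Z\<^esub> z \<in> {z \<in> carrier Z. \<forall>x\<in>B. norm (J z x) \<le> 1}}"
      by (rule Z.zero_nbhd_scale[OF polar_nbhd[OF B]])
    moreover have "norm (J z x) < e" if "z \<in> carrier Z" "norm (J (of_real (2 / e) \<odot>\<^bsub>Z\<^esub> z) x) \<le> 1" for z x
    proof -
      have "2 / e * norm (J z x) \<le> 1"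
        using that(2) e unfolding J_smult[OF that(1)] norm_mult norm_of_real by simp
      then have "norm (J z x) \<le> e / 2" using e by (simp add: field_simps)
      also have "e / 2 < e" using e by simp
      finally show ?thesis .
    qed
    ultimately show ?thesis
      by (elim zero_nbhd_mono) auto
  qed
  \<comment> \<open>Z carries the topology of uniform convergence on bounded subsets of X. One
    implication is barrelledness, through \<open>ball_nbhd\<close>; the other takes the polar of W
    for B and recovers W by Hahn-Banach.\<close>
  have Znbhd: "zero_nbhd Z U \<longleftrightarrow>
      (\<exists>B\<in>{B. bounded_in X B}. \<exists>e>0. {z \<in> carrier Z. \<forall>x\<in>B. norm (J z x) < e} \<subseteq> U)"
    if U: "U \<subseteq> carrier Z" for U
  proof
    assume "zero_nbhd Z U"
    then obtain W where W: "zero_nbhd Z W" "absolutely_convex Z W" "W \<subseteq> U"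
      using Z.locally_convex by blast
    define B where "B = {x \<in> carrier X. \<forall>w\<in>W. norm (\<psi> x w) \<le> 1}"
    have "bounded_in X B"
      unfolding bounded_in_iff
    proof (intro conjI allI impI)
      show "B \<subseteq> carrier X" by (auto simp: B_def)
      fix Q assume Q: "zero_nbhd X Q \<and> absolutely_convex X Q"
      then obtain M e where M: "bounded_in Z M" "0 < e" "{x \<in> carrier X. \<forall>z\<in>M. norm (\<psi> x z) < e} \<subseteq> Q"
        using Xnbhd[of Q] zero_nbhd_subset[of X Q] by blast
      obtain t where t: "0 < t" "\<forall>z\<in>M. of_real t \<odot>\<^bsub>Z\<^esub> z \<in> W"
        using Z.bounded_in_scale[OF M(1) W(1)] by blast
      have "of_real (t * e / 2) \<odot> x \<in> Q" if x: "x \<in> B" for x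
      proof -
        have xX: "x \<in> carrier X" using x by (simp add: B_def)
        have "norm (\<psi> (of_real (t * e / 2) \<odot> x) z) < e" if z: "z \<in> M" for z
        proof -
          have zZ: "z \<in> carrier Z" using z Z.bounded_in_subset[OF M(1)] by blast
          have "norm (\<psi> x (of_real t \<odot>\<^bsub>Z\<^esub> z)) \<le> 1" using x t(2) z by (simp add: B_def)
          then have "norm (of_real t * \<psi> x z) \<le> 1"
            using Z.linear_functional_smult[OF \<psi>_lin[OF xX] zZ] by simp
          then have "t * norm (\<psi> x z) \<le> 1"
            unfolding norm_mult norm_of_real using t(1) by simp
          then have "(e / 2) * (t * norm (\<psi> x z)) \<le> (e / 2) * 1"
            using M(2) by (intro mult_left_mono) auto
          then have "t * e / 2 * norm (\<psi> x z) < e" using M(2) by (simp add: algebra_simps)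
          then show ?thesis
            unfolding \<psi>_smult[OF xX] norm_mult norm_of_real using t(1) M(2) by simp
        qed
        then show ?thesis using M(3) xX by blast
      qed
      then show "\<exists>t>0. \<forall>x\<in>B. of_real t \<odot> x \<in> Q"
        using t(1) M(2) by (intro exI[of _ "t * e / 2"]) simp
    qed
    moreover have "z \<in> W" if z: "z \<in> carrier Z" "\<forall>x\<in>B. norm (J z x) < 1" for z
    proof (rule ccontr)
      assume "z \<notin> W"
      then obtain F where F: "F \<in> dual Z" "\<And>w. w \<in> W \<Longrightarrow> norm (F w) \<le> 1" "1 \<le> norm (F z)"
        using Z.hahn_banach_nbhd[OF W(1,2) z(1)] by blast
      obtain x where x: "x \<in> carrier X" "\<psi> x = F" using \<psi>_surj F(1) by blast
      then have "x \<in> B" using F(2) by (simp add: B_def)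
      then have "norm (J z x) < 1" using z(2) by blast
      then show False using x F(3) J by simp
    qed
    ultimately show "\<exists>B\<in>{B. bounded_in X B}. \<exists>e>0. {z \<in> carrier Z. \<forall>x\<in>B. norm (J z x) < e} \<subseteq> U"
      using W(3) by (intro bexI[of _ B] exI[of _ 1]) auto
  next
    assume "\<exists>B\<in>{B. bounded_in X B}. \<exists>e>0. {z \<in> carrier Z. \<forall>x\<in>B. norm (J z x) < e} \<subseteq> U"
    then obtain B e where "bounded_in X B" "0 < e" "{z \<in> carrier Z. \<forall>x\<in>B. norm (J z x) < e} \<subseteq> U" by blast
    then show "zero_nbhd Z U" using zero_nbhd_mono[OF ball_nbhd _ U] by blast
  qed

  define D where "D = {z \<in> carrier Z. J z \<in> bdual}"
  have D: "D \<subseteq> carrier Z" "\<zero>\<^bsub>Z\<^esub> \<in> D" "\<And>y z. y \<in> D \<Longrightarrow> z \<in> D \<Longrightarrow> y \<oplus>\<^bsub>Z\<^esub> z \<in> D"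
    "\<And>c z. z \<in> D \<Longrightarrow> c \<odot>\<^bsub>Z\<^esub> z \<in> D"
  proof -
    show "D \<subseteq> carrier Z" by (auto simp: D_def)
    have "J \<zero>\<^bsub>Z\<^esub> = (\<lambda>_. 0)"
      using Z.linear_functional_zero[OF \<psi>_lin] by (auto simp: J_def)
    then show "\<zero>\<^bsub>Z\<^esub> \<in> D" using bdual_zero by (simp add: D_def)
    show "y \<oplus>\<^bsub>Z\<^esub> z \<in> D" if yz: "y \<in> D" "z \<in> D" for y z
    proof -
      have "J (y \<oplus>\<^bsub>Z\<^esub> z) = (\<lambda>x. J y x + J z x)" using yz J_add by (auto simp: D_def)
      then show ?thesis using yz bdual_add by (simp add: D_def)
    qed
    show "c \<odot>\<^bsub>Z\<^esub> z \<in> D" if z: "z \<in> D" for c z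
    proof -
      have "J (c \<odot>\<^bsub>Z\<^esub> z) = (\<lambda>x. c * J z x)" using z J_smult by (auto simp: D_def)
      then show ?thesis using z bdual_smult by (simp add: D_def)
    qed
  qed
  \<comment> \<open>A continuous functional on Z that vanishes on D is some \<open>\<psi> x\<close>,
    and \<open>separating\<close> then says x = 0.\<close>
  have dense: "z \<in> Z.set_sum D W"
    if W: "zero_nbhd Z W" "absolutely_convex Z W" and z: "z \<in> carrier Z" for z W
  proof (rule ccontr)
    assume "z \<notin> Z.set_sum D W"
    then obtain F where F: "linear_functional Z F" "\<And>w. w \<in> W \<Longrightarrow> norm (F w) \<le> 1"
      "\<And>d. d \<in> D \<Longrightarrow> F d = 0" "1 \<le> norm (F z)"
      using Z.hahn_banach_subspace[OF D W(2) Z.zero_nbhd_absorbing[OF W(1)] z] by blast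
    then have "F \<in> dual Z" using Z.dualI_bounded[OF F(1) W(1)] by blast
    then obtain x where x: "x \<in> carrier X" "\<psi> x = F" using \<psi>_surj by blast
    have "x = \<zero>" by (rule separating[OF x(1)]) (use x(2) F(3) in \<open>simp add: D_def\<close>)
    then have "F z = 0" using x(2) \<psi>_zero by auto
    then show False using F(4) by simp
  qed
  \<comment> \<open>Approximating z by elements of D with error below e on B exhibits J z as a
    uniform limit on B of \<tau>'-continuous functions.\<close>
  have J_bdual: "J z \<in> bdual" if z: "z \<in> carrier Z" for z
    unfolding bdual_def
  proof (intro CollectI conjI allI impI)
    show "linear_functional X (J z)" by (rule J_lin)
    fix B assume B: "bounded_in X B"
    have BX: "B \<subseteq> carrier X" by (rule bounded_in_subset[OF B])
    have topB: "topspace (subtopology \<tau>' B) = B" using BX topspace_weak by auto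
    show "continuous_map (subtopology \<tau>' B) euclidean (J z)"
    proof (rule continuous_map_uniform_approx)
      fix e :: real assume e: "0 < e"
      let ?W = "{z \<in> carrier Z. \<forall>x\<in>B. norm (J z x) < e}"
      have W: "?W = {z \<in> carrier Z. \<forall>u\<in>\<psi> ` B. norm (u z) < e}"
        using BX J by (simp add: subset_iff cong: ball_cong)
      have "absolutely_convex Z ?W"
        unfolding W by (rule Z.absolutely_convex_polar) (use \<psi>_lin BX in blast)
      then have "z \<in> Z.set_sum D ?W" by (rule dense[OF ball_nbhd[OF B e] _ z])
      then obtain d w where d: "d \<in> D" "w \<in> ?W" "z = d \<oplus>\<^bsub>Z\<^esub> w" by (auto simp: Z.set_sum_def)
      then have "J z x - J d x = J w x" for x using J_add[of d w x] D(1) by auto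
      then have "\<forall>x\<in>B. norm (J z x - J d x) < e" using d(2) by simp
      moreover have "continuous_map (subtopology \<tau>' B) euclidean (J d)"
        using d(1) B by (simp add: D_def bdual_def)
      ultimately show "\<exists>g. continuous_map (subtopology \<tau>' B) euclidean g \<and>
          (\<forall>x\<in>topspace (subtopology \<tau>' B). norm (J z x - g x) < e)"
        unfolding topB by blast
    qed
  qed

  have inj: "inj_on J (carrier Z)"
  proof (rule inj_onI)
    fix y z assume y: "y \<in> carrier Z" and z: "z \<in> carrier Z" and eq: "J y = J z"
    show "y = z"
    proof (rule ccontr)
      assume "y \<noteq> z"
      then have "y \<ominus>\<^bsub>Z\<^esub> z \<noteq> \<zero>\<^bsub>Z\<^esub>" "y \<ominus>\<^bsub>Z\<^esub> z \<in> carrier Z" using y z by simp_all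
      then obtain F where F: "F \<in> dual Z" "F (y \<ominus>\<^bsub>Z\<^esub> z) \<noteq> 0"
        using Z.dual_separates[of "y \<ominus>\<^bsub>Z\<^esub> z"] by blast
      obtain x where x: "x \<in> carrier X" "\<psi> x = F" using \<psi>_surj F(1) by blast
      then have "F y = F z" using fun_cong[OF eq, of x] J by simp
      moreover have "linear_functional Z F" using \<psi>_lin x by blast
      ultimately show False using F(2) y z by (simp add: Z.linear_functional_diff)
    qed
  qed

  have approx: "\<exists>z\<in>carrier Z. \<forall>x\<in>B. norm (u x - J z x) < e"
    if u: "u \<in> bdual" and B: "bounded_in X B" and e: "0 < e" for u B e
  proof -
    \<comment> \<open>The topology is left \<open>undefined\<close>: only the algebraic Hahn-Banach
      theorem is applied, with \<open>?A\<close> in the place of a 0-neighbourhood.\<close>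
    let ?E = "function_space bdual undefined"
    interpret E: scalar_module ?E
      by (rule scalar_module_function_space) (use bdual_zero bdual_add bdual_smult in blast)+
    let ?A = "{v \<in> bdual. \<forall>x\<in>B. norm (v x) < e}"
    have eval: "linear_functional ?E (\<lambda>v. if v \<in> bdual then v x else 0)" for x
      by (simp add: linear_functional_def functions_on_def bdual_add bdual_smult)
    have A: "?A = {v \<in> carrier ?E. \<forall>\<Phi>\<in>(\<lambda>x v. if v \<in> bdual then v x else 0) ` B. norm (\<Phi> v) < e}"
      by auto
    have acA: "absolutely_convex ?E ?A"
      unfolding A by (rule E.absolutely_convex_polar) (use eval in blast)
    have absorbing: "\<exists>t>0. of_real t \<odot>\<^bsub>?E\<^esub> v \<in> ?A" if "v \<in> carrier ?E" for v
    proof -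
      have v: "v \<in> bdual" using that by simp
      obtain r where r: "0 < r" "\<forall>x\<in>B. norm (v x) \<le> r" using bdual_bounded[OF v B] by blast
      have "norm (of_real (e / (2 * r)) * v x) < e" if "x \<in> B" for x
      proof -
        have "e / (2 * r) * norm (v x) \<le> e / (2 * r) * r"
          using r that e by (intro mult_left_mono) auto
        also have "\<dots> < e" using r(1) e by simp
        finally show ?thesis unfolding norm_mult norm_of_real using r(1) e by simp
      qed
      then have "of_real (e / (2 * r)) \<odot>\<^bsub>?E\<^esub> v \<in> ?A"
        unfolding function_space_simps using bdual_smult[OF v] by blast
      moreover have "0 < e / (2 * r)" using e r(1) by simp
      ultimately show ?thesis by blast
    qed
    have "u \<in> E.set_sum (J ` carrier Z) ?A"
    proof (rule ccontr)
      assume notin: "u \<notin> E.set_sum (J ` carrier Z) ?A"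
      have sub: "J ` carrier Z \<subseteq> carrier ?E" using J_bdual by auto
      have zero: "\<zero>\<^bsub>?E\<^esub> \<in> J ` carrier Z"
      proof -
        have "J \<zero>\<^bsub>Z\<^esub> = (\<lambda>_. 0)"
          using Z.linear_functional_zero[OF \<psi>_lin] by (auto simp: J_def)
        moreover have "J \<zero>\<^bsub>Z\<^esub> \<in> J ` carrier Z" by (rule imageI) simp
        ultimately show ?thesis by simp
      qed
      have add: "v \<oplus>\<^bsub>?E\<^esub> w \<in> J ` carrier Z" if vw: "v \<in> J ` carrier Z" "w \<in> J ` carrier Z" for v w
      proof -
        obtain y z where yz: "y \<in> carrier Z" "v = J y" "z \<in> carrier Z" "w = J z" using vw by blast
        then have "J (y \<oplus>\<^bsub>Z\<^esub> z) = v \<oplus>\<^bsub>?E\<^esub> w" using J_add by auto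
        moreover have "J (y \<oplus>\<^bsub>Z\<^esub> z) \<in> J ` carrier Z" by (rule imageI) (use yz in simp)
        ultimately show ?thesis by simp
      qed
      have smult: "c \<odot>\<^bsub>?E\<^esub> v \<in> J ` carrier Z" if v: "v \<in> J ` carrier Z" for c v
      proof -
        obtain z where z: "z \<in> carrier Z" "v = J z" using v by blast
        then have "J (c \<odot>\<^bsub>Z\<^esub> z) = c \<odot>\<^bsub>?E\<^esub> v" using J_smult by auto
        moreover have "J (c \<odot>\<^bsub>Z\<^esub> z) \<in> J ` carrier Z" by (rule imageI) (use z in simp)
        ultimately show ?thesis by simp
      qed
      obtain \<Phi> where \<Phi>: "linear_functional ?E \<Phi>" "\<And>v. v \<in> ?A \<Longrightarrow> norm (\<Phi> v) \<le> 1"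
        "\<And>v. v \<in> J ` carrier Z \<Longrightarrow> \<Phi> v = 0" "1 \<le> norm (\<Phi> u)"
        using E.hahn_banach_subspace[OF sub zero add smult acA absorbing _ notin] u by auto
      obtain x where x: "x \<in> carrier X" "\<And>v. v \<in> bdual \<Longrightarrow> \<Phi> v = v x"
        using bdual_representation[OF \<Phi>(1) B e] \<Phi>(2) by auto
      \<comment> \<open>\<Phi> is evaluation at x and vanishes on the image of J, so \<psi> x is
        zero on all of Z.\<close>
      have "\<psi> x z = 0" if "z \<in> carrier Z" for z
        using \<Phi>(3)[of "J z"] x(2)[OF J_bdual[OF that]] that J[OF x(1)] by simp
      then have "x = \<zero>" using separating[OF x(1)] by blast
      then have "\<Phi> u = 0" using x(2)[OF u] linear_functional_zero[OF bdual_linear[OF u]] by simp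
      then show False using \<Phi>(4) by simp
    qed
    then obtain z v where z: "z \<in> carrier Z" "v \<in> ?A" "u = J z \<oplus>\<^bsub>?E\<^esub> v"
      by (auto simp: E.set_sum_def)
    then have "\<forall>x\<in>B. norm (u x - J z x) < e" by auto
    with z(1) show ?thesis by blast
  qed

  have surj: "\<exists>z\<in>carrier Z. J z = u" if u: "u \<in> bdual" for u
  proof -
    \<comment> \<open>A filter base indexed by pairs (B, e): the z for which J z is within e of u on
      B. It is Cauchy because \<open>Znbhd\<close> tests neighbourhoods on the same pairs; members
      are compared through u, whence e / 2.\<close>
    define I where "I = {(B, e). bounded_in X B \<and> (0::real) < e}"
    define A where "A = (\<lambda>(B, e). {z \<in> carrier Z. \<forall>x\<in>B. norm (u x - J z x) < e})"
    define F where "F = (INF p\<in>I. principal (A p))"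
    have "\<exists>r\<in>I. principal (A r) \<le> inf (principal (A p)) (principal (A q))" if "p \<in> I" "q \<in> I" for p q
    proof -
      obtain B e C d where pq: "p = (B, e)" "q = (C, d)" by fastforce
      then have "(B \<union> C, min e d) \<in> I"
        using that bounded_in_Un by (auto simp: I_def)
      moreover have "A (B \<union> C, min e d) \<subseteq> A p \<inter> A q" by (auto simp: pq A_def)
      ultimately show ?thesis by (intro bexI[of _ "(B \<union> C, min e d)"]) simp_all
    qed
    moreover have "({}, 1) \<in> I" by (simp add: I_def)
    then have "I \<noteq> {}" by blast
    ultimately have ev: "eventually P F \<longleftrightarrow> (\<exists>B e. bounded_in X B \<and> 0 < e \<and> (\<forall>z\<in>A (B, e). P z))" for P
      unfolding F_def by (subst eventually_INF_base) (auto simp: eventually_principal I_def)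
    have nonempty: "A (B, e) \<noteq> {}" if "bounded_in X B" "0 < e" for B e
      using approx[OF u that] by (auto simp: A_def)
    have "cauchy_filter_in Z F"
      unfolding cauchy_filter_in_def
    proof (intro conjI allI impI)
      have "\<not> eventually (\<lambda>_. False) F" unfolding ev using nonempty by blast
      then show "F \<noteq> bot" by auto
      fix U assume U: "zero_nbhd Z U"
      then obtain B e where B: "bounded_in X B" "0 < e" "{z \<in> carrier Z. \<forall>x\<in>B. norm (J z x) < e} \<subseteq> U"
        using Znbhd[of U] zero_nbhd_subset[OF U] by blast
      have "y \<ominus>\<^bsub>Z\<^esub> z \<in> U" if "y \<in> A (B, e / 2)" "z \<in> A (B, e / 2)" for y z
      proof -
        have yz: "y \<in> carrier Z" "z \<in> carrier Z" using that by (simp_all add: A_def)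
        have "norm (J (y \<ominus>\<^bsub>Z\<^esub> z) x) < e" if x: "x \<in> B" for x
        proof -
          have "x \<in> carrier X" using x bounded_in_subset[OF B(1)] by blast
          then have "J (y \<ominus>\<^bsub>Z\<^esub> z) x = (u x - J z x) - (u x - J y x)"
            using yz J Z.linear_functional_diff[OF \<psi>_lin] by simp
          moreover have "norm (u x - J y x) < e / 2" "norm (u x - J z x) < e / 2"
            using \<open>y \<in> A (B, e / 2)\<close> \<open>z \<in> A (B, e / 2)\<close> x by (auto simp: A_def)
          ultimately show ?thesis
            using norm_triangle_ineq4[of "u x - J z x" "u x - J y x"] by simp
        qed
        then show ?thesis using B(3) yz by auto
      qed
      moreover have "eventually (\<lambda>z. z \<in> A (B, e / 2)) F"
        unfolding ev using B(1,2) by (intro exI[of _ B] exI[of _ "e / 2"]) simp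
      moreover have "A (B, e / 2) \<subseteq> carrier Z" by (auto simp: A_def)
      ultimately show "\<exists>A\<subseteq>carrier Z. (\<forall>\<^sub>F x in F. x \<in> A) \<and> (\<forall>x\<in>A. \<forall>y\<in>A. x \<ominus>\<^bsub>Z\<^esub> y \<in> U)"
        by blast
    qed
    then obtain l where l: "l \<in> carrier Z" "F \<le> nhdsin (topol Z) l"
      using complete unfolding complete_in_def by blast
    have "J l x = u x" for x
    proof (cases "x \<in> carrier X")
      case x: True
      have "norm (u x - J l x) \<le> 0"
      proof (rule field_le_epsilon)
        fix e :: real assume e: "0 < e"
        let ?G = "{z \<in> topspace (topol Z). \<psi> x z \<in> ball (\<psi> x l) (e / 2)}"
        have "openin (topol Z) ?G"
          using \<psi>_dual[OF x] by (intro openin_continuous_map_preimage[of _ euclidean]) (auto simp: dual_def)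
        moreover have "l \<in> ?G" using l(1) e by (simp add: Z.topspace_topol)
        ultimately have "eventually (\<lambda>z. z \<in> ?G) (nhdsin (topol Z) l)"
          unfolding eventually_nhdsin by blast
        then have "eventually (\<lambda>z. z \<in> ?G) F" using l(2) by (rule filter_leD[rotated])
        then obtain B d where B: "bounded_in X B" "0 < d" "A (B, d) \<subseteq> ?G" unfolding ev by blast
        \<comment> \<open>Enlarging B by x and shrinking d yields a z for which J z x is close both
          to J l x and to u x.\<close>
        have "bounded_in X (B \<union> {x})" using B(1) bounded_in_singleton[OF x] by (rule bounded_in_Un)
        then obtain z where z: "z \<in> A (B \<union> {x}, min d (e / 2))"
          using nonempty[of "B \<union> {x}" "min d (e / 2)"] B(2) e by auto
        then have "z \<in> A (B, d)" by (auto simp: A_def)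
        then have "z \<in> ?G" using B(3) by blast
        then have "norm (J z x - J l x) < e / 2"
          using J[OF x] by (simp add: dist_norm norm_minus_commute)
        moreover have "norm (u x - J z x) < e / 2" using z by (auto simp: A_def)
        ultimately show "norm (u x - J l x) \<le> 0 + e"
          using norm_triangle_ineq[of "u x - J z x" "J z x - J l x"] by simp
      qed
      then show ?thesis by simp
    next
      case False
      then show ?thesis using bdual_linear[OF u] by (simp add: J_def linear_functional_def functions_on_def)
    qed
    then show ?thesis using l(1) by blast
  qed

  have "linear_map Z (bounded_continuous_dual X \<tau>') J"
    unfolding bounded_continuous_dual_eq linear_map_function_space
    using J_bdual J_add J_smult by blast
  moreover have "bij_betw J (carrier Z) bdual"
    unfolding bij_betw_def using inj J_bdual surj by blast
  ultimately show ?thesis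
    unfolding bounded_continuous_dual_eq Z.topological_isomorphism_uniform_iff[OF directed_family_bounded]
    using Znbhd by blast
qed

lemma scalar_module_bounded_continuous_dual: "scalar_module (bounded_continuous_dual X \<tau>')"
  unfolding bounded_continuous_dual_eq
  by (rule scalar_module_function_space[OF bdual_zero bdual_add bdual_smult])

lemma topspace_bounded_continuous_dual:
  "topspace (topol (bounded_continuous_dual X \<tau>')) = carrier (bounded_continuous_dual X \<tau>')"
  by (simp add: bounded_continuous_dual_eq topspace_uniform_directed[OF directed_family_bounded])

end

theorem corollary5p11:
  fixes \<Omega> :: "'a set"
    and V :: "('a \<Rightarrow> 'k::real_or_complex) set"
    and \<tau> \<tau>' :: "('a \<Rightarrow> 'k) topology"
    and C :: "('k, 'v) top_module set"
  assumes "\<Omega> \<noteq> {}"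
    and "V \<subseteq> functions_on \<Omega>"
    and "lc_hausdorff (function_space V \<tau>)"
    and "bornological (function_space V \<tau>)"
    and "bc_space (function_space V \<tau>)"
    and "lc_hausdorff (function_space V \<tau>')"
    and "coarser (pointwise_topology V) \<tau>'"
    and "BBC (function_space V \<tau>) \<tau>'"
    and "CNC (function_space V \<tau>) \<tau>'"
    and "\<forall>Y\<in>C. lc_hausdorff Y \<and> complete_in Y \<and> barrelled Y"
    and "iso_closed C"
    and "iso_member (bounded_continuous_dual (function_space V \<tau>) \<tau>') C"
  shows "has_unique_predual C (function_space V \<tau>) \<longleftrightarrow>
    (\<forall>Z\<in>C. \<forall>\<phi>. predual (function_space V \<tau>) Z \<phi> \<longrightarrow>
       (\<exists>\<psi>. topological_isomorphism (function_space V \<tau>) (strong_dual Z) \<psi> \<and>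
            (\<forall>x\<in>\<Omega>. \<exists>z\<in>carrier Z. \<forall>f\<in>V. f x = \<psi> f z)))"
    (is "?unique \<longleftrightarrow> ?evaluations")
proof -
  let ?X = "function_space V \<tau>"
  let ?E = "bounded_continuous_dual ?X \<tau>'"
  have weak: "?X\<lparr>topol := \<tau>'\<rparr> = function_space V \<tau>'"
    by (simp add: function_space_def)
  interpret X: lc_hausdorff ?X by fact
  interpret T: lc_hausdorff "?X\<lparr>topol := \<tau>'\<rparr>"
    unfolding weak by fact
  interpret compact_predual ?X \<tau>'
    by unfold_locales fact+
  have C: "lc_hausdorff Y" "complete_in Y" "barrelled Y" if "Y \<in> C" for Y
    using assms(10) that by auto
  define \<delta> where "\<delta> x f = (if f \<in> V then f x else 0)" for x :: 'a and f :: "'a \<Rightarrow> 'k"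
  \<comment> \<open>\<tau>' refines pointwise convergence, so evaluation at x is \<tau>'-continuous.
    This serves both for \<delta> and, in the converse, for the functionals that come from points of
    Z.\<close>
  have eval_bdual: "v \<in> bdual" if "linear_functional ?X v" and v: "\<And>f. f \<in> V \<Longrightarrow> v f = f x" for v x
  proof -
    have "continuous_map (product_topology (\<lambda>_. euclidean) UNIV) euclidean (\<lambda>f :: 'a \<Rightarrow> 'k. f x)"
      by (rule continuous_map_product_projection) simp
    then have "continuous_map (pointwise_topology V) euclidean (\<lambda>f. f x)"
      unfolding pointwise_topology_def by (rule continuous_map_from_subtopology)
    then have "continuous_map \<tau>' euclidean (\<lambda>f. f x)"
      using assms(7) topspace_weak unfolding coarser_def continuous_map_def
      by (auto simp: pointwise_topology_def)
    then have "continuous_map \<tau>' euclidean v"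
      by (rule continuous_map_eq) (use topspace_weak v in simp)
    then show ?thesis
      using that(1) by (simp add: bdual_def continuous_map_from_subtopology)
  qed
  have \<delta>_bdual: "\<delta> x \<in> bdual" for x
  proof (rule eval_bdual)
    show "linear_functional ?X (\<delta> x)"
      using X.M.add.m_closed X.smult_mem by (auto simp: linear_functional_def functions_on_def \<delta>_def)
  qed (simp add: \<delta>_def)
  show ?thesis
  proof
    assume unique: ?unique
    show ?evaluations
    proof (intro ballI allI impI)
      fix Z \<phi> assume Z: "Z \<in> C" and \<phi>: "predual ?X Z \<phi>"
      interpret Z: lc_hausdorff Z by (rule C[OF Z])
      \<comment> \<open>Y is a copy of E inside C, as uniqueness compares only members of C.\<close>
      obtain Y f where Y: "Y \<in> C" and f: "topological_isomorphism ?E Y f"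
        using assms(12) unfolding iso_member_def by blast
      interpret Y: lc_hausdorff Y by (rule C[OF Y])
      obtain g where g: "topological_isomorphism Y ?E g"
        using scalar_module.topological_isomorphism_inverse[OF scalar_module_bounded_continuous_dual f
            topspace_bounded_continuous_dual Y.topspace_topol] by blast
      have "predual ?X Y (\<lambda>x z. if z \<in> carrier Y then g z x else 0)"
        unfolding predual_def using strong_dual_isomorphism[OF C(1)[OF Y] g] C(1)[OF Y] by blast
      then obtain h where h: "topological_isomorphism Z Y h"
        using unique \<phi> Y Z unfolding has_unique_predual_def by blast
      let ?J = "g \<circ> h"
      let ?\<psi> = "\<lambda>x z. if z \<in> carrier Z then ?J z x else 0"
      have J: "topological_isomorphism Z ?E ?J"
        by (rule topological_isomorphism_compose[OF h g])
      then have "topological_isomorphism ?X (strong_dual Z) ?\<psi>"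
        by (rule strong_dual_isomorphism[OF C(1)[OF Z]])
      \<comment> \<open>The composite isomorphism maps onto \<open>bdual\<close>, which contains
        \<delta> x; a preimage is the required point.\<close>
      moreover have "\<exists>z\<in>carrier Z. \<forall>f\<in>V. f x = ?\<psi> f z" for x
      proof -
        have "?J ` topspace (topol Z) = topspace (topol ?E)"
          using J unfolding topological_isomorphism_def homeomorphic_eq_everything_map by blast
        then have "?J ` carrier Z = bdual"
          unfolding topspace_bounded_continuous_dual Z.topspace_topol
          by (simp add: bounded_continuous_dual_eq)
        then obtain z where "z \<in> carrier Z" "?J z = \<delta> x" using \<delta>_bdual[of x] by (metis imageE)
        then show ?thesis by (intro bexI[of _ z]) (simp_all add: \<delta>_def)
      qed
      ultimately show "\<exists>\<psi>. topological_isomorphism ?X (strong_dual Z) \<psi> \<and>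
            (\<forall>x\<in>\<Omega>. \<exists>z\<in>carrier Z. \<forall>f\<in>V. f x = \<psi> f z)" by blast
    qed
  next
    assume evaluations: ?evaluations
    have iso: "\<exists>J. topological_isomorphism Z ?E J" if Z: "Z \<in> C" and \<phi>: "predual ?X Z \<phi>" for Z \<phi>
    proof -
      obtain \<psi> where \<psi>: "topological_isomorphism ?X (strong_dual Z) \<psi>"
        and eval: "\<And>x. x \<in> \<Omega> \<Longrightarrow> \<exists>z\<in>carrier Z. \<forall>f\<in>V. f x = \<psi> f z"
        using evaluations Z \<phi> by blast
      let ?J = "\<lambda>z f. if f \<in> carrier ?X then \<psi> f z else 0"
      have lin: "linear_map ?X (strong_dual Z) \<psi>"
        using \<psi> by (simp add: topological_isomorphism_def)
      have J_lin: "linear_functional ?X (?J z)" for z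
        using lin X.M.add.m_closed X.smult_mem
        by (auto simp: linear_functional_def functions_on_def strong_dual_def linear_map_function_space)
      have "topological_isomorphism Z ?E ?J"
      proof (rule separating_predual_isomorphism[OF C[OF Z] \<psi>])
        fix f assume f: "f \<in> carrier ?X"
          and zero: "\<And>z. z \<in> carrier Z \<Longrightarrow> ?J z \<in> bdual \<Longrightarrow> \<psi> f z = 0"
        \<comment> \<open>The evaluations are among the functionals \<psi>(.)(z) and lie in E, so
          the assumption on f makes it vanish on \<Omega>; off \<Omega> it vanishes as a member of
          \<open>functions_on \<Omega>\<close>.\<close>
        have "f x = 0" for x
        proof (cases "x \<in> \<Omega>")
          case True
          then obtain z where z: "z \<in> carrier Z" "\<forall>f\<in>V. f x = \<psi> f z" using eval by blast
          have "?J z \<in> bdual" by (rule eval_bdual[OF J_lin]) (use z(2) in simp)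
          then have "\<psi> f z = 0" using zero z(1) by blast
          then show ?thesis using z(2) f by simp
        next
          case False
          then show ?thesis using f assms(2) by (auto simp: functions_on_def)
        qed
        then show "f = \<zero>\<^bsub>?X\<^esub>" by auto
      qed
      then show ?thesis by blast
    qed
    show ?unique
      unfolding has_unique_predual_def
    proof (intro ballI allI impI)
      fix Y Z \<phi> \<phi>' assume Y: "Y \<in> C" and Z: "Z \<in> C" and preduals: "predual ?X Y \<phi> \<and> predual ?X Z \<phi>'"
      interpret Z: lc_hausdorff Z by (rule C[OF Z])
      obtain g where g: "topological_isomorphism Y ?E g"
        using iso[OF Y conjunct1[OF preduals]] by (elim exE)
      obtain h where h: "topological_isomorphism Z ?E h"
        using iso[OF Z conjunct2[OF preduals]] by (elim exE)
      obtain k where "topological_isomorphism ?E Z k"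
        by (rule Z.topological_isomorphism_inverse[OF h Z.topspace_topol topspace_bounded_continuous_dual])
      then have "topological_isomorphism Y Z (k \<circ> g)"
        by (rule topological_isomorphism_compose[OF g])
      then show "\<exists>f. topological_isomorphism Y Z f"
        by (rule exI[where x = "k \<circ> g"])
    qed
  qed
qed

end
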